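(* The map $$B_{\mathbb{K}}^A(G)\to \Bigl(\prod_{(H,\Phi)\in\mathcal{X}(G)} \mathbb{K}\Bigr)^G,\quad x\mapsto \bigl(s_{(H,\Phi)}^G(x)\bigr)_{(H,\Phi)},$$ is a $\mathbb{K}$-algebra isomorphism, where $G$ acts on $\prod_{(H,\Phi)\in\mathcal{X}(G)}\mathbb{K}$ by permuting the coordinates according to the $G$-action on $\mathcal{X}(G)$. In particular, every $\mathbb{K}$-algebra homomorphism $B_{\mathbb{K}}^A(G)\to \mathbb{K}$ is of the form $s_{(H,\Phi)}^G$ for some $(H,\Phi)\in\mathcal{X}(G)$. For $(H,\Phi),(K,\Psi)\in\mathcal{X}(G)$ one has $s_{(H,\Phi)}^G=s_{(K,\Psi)}^G$ if and only if $(H,\Phi)$ and $(K,\Psi)$ are $G$-conjugate.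
   Context: $A$ is a multiplicatively written abelian group; for a finite group $H$, $H^*:=\mathrm{Hom}(H,A)$ with pointwise multiplication. $G$ is a finite group such that $H^*$ is finite for every $H\le G$, and $\mathbb{K}$ is a field of characteristic zero which is a splitting field for $H^*$ for all $H\le G$. $\mathcal{M}(G)$ is the set of pairs $(U,\phi)$ with $U\le G$, $\phi\in U^*$; $G$ acts by ${}^g(U,\phi)=({}^gU,{}^g\phi)$ with ${}^gU=gUg^{-1}$, $({}^g\phi)(x)=\phi(g^{-1}xg)$; $[U,\phi]_G$ denotes the $G$-orbit of $(U,\phi)$. The $A$-fibered Burnside algebra $B^A_{\mathbb{K}}(G)$ is the $\mathbb{K}$-vector space with basis the set of these orbits and multiplication $[U,\phi]_G\cdot[V,\psi]_G=\sum_{g\in[U\backslash G/V]}[U\cap{}^gV,\phi|_{U\cap{}^gV}\cdot({}^g\psi)|_{U\cap{}^gV}]_G$; its identity is $[G,1]_G$. $\mathcal{X}(G)$ is the set of pairs $(H,\Phi)$ with $H\le G$ and $\Phi\in\mathrm{Hom}(H^*,\mathbb{K}^\times)$, with $G$-action ${}^g(H,\Phi)=({}^gH,{}^g\Phi)$, ${}^g\Phi(\phi)=\Phi({}^{g^{-1}}\phi)$. For $(H,\Phi)\in\mathcal{X}(G)$, $s^G_{(H,\Phi)}:=s^H_\Phi\circ\pi_H\circ\mathrm{res}^G_H\colon B^A_{\mathbb{K}}(G)\to B^A_{\mathbb{K}}(H)\to\mathbb{K}H^*\to\mathbb{K}$, where $\mathrm{res}^G_H([U,\phi]_G)=\sum_{g\in[H\backslash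 G/U]}[H\cap{}^gU,({}^g\phi)|_{H\cap{}^gU}]_H$; $\pi_H([U,\phi]_H)=\phi$ if $U=H$ and $0$ otherwise; and $s^H_\Phi$ is the $\mathbb{K}$-linear extension of $\Phi$. A superscript $G$ denotes fixed points. *)

theory Defs
  imports
    "HOL-Algebra.Algebra"
    "HOL-Algebra.Algebraic_Closure_Type"
    "HOL-Library.Poly_Mapping"
    "Jordan_Normal_Form.VS_Connect"
begin

text \<open>
  Groups are records of HOL-Algebra; a subgroup \<open>H\<close> of \<open>G\<close>, as a group, is \<open>G\<lparr>carrier := H\<rparr>\<close>.
  The coefficient field is a type of class \<^class>\<open>field\<close>, seen as the record \<^const>\<open>class_ring\<close>
  where algebras over it are concerned. Functions with domain a set are taken extensional,
  so that equality of functions is equality on the domain.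
\<close>

section \<open>Splitting fields\<close>

definition representation ::
    "('g, 'm) monoid_scheme \<Rightarrow> nat \<Rightarrow> ('g \<Rightarrow> 'f::field mat) \<Rightarrow> bool" where
  "representation \<Gamma> n \<rho> \<longleftrightarrow> \<rho> \<in> hom \<Gamma> (units_of (ring_mat TYPE('f) n ()))"

definition irreducible_representation ::
    "('g, 'm) monoid_scheme \<Rightarrow> nat \<Rightarrow> ('g \<Rightarrow> 'f::field mat) \<Rightarrow> bool" where
  "irreducible_representation \<Gamma> n \<rho> \<longleftrightarrow>
     representation \<Gamma> n \<rho> \<and> n > 0 \<and>
     (\<forall>W. subspace class_ring W (module_vec TYPE('f) n) \<and>
          (\<forall>\<gamma>\<in>carrier \<Gamma>. \<forall>w\<in>W. \<rho> \<gamma> *\<^sub>v w \<in> W) \<longrightarrow>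
          W = {0\<^sub>v n} \<or> W = carrier_vec n)"

text \<open>
  Absolute irreducibility is irreducibility after extension of scalars to the algebraic closure
  (equivalently, to every extension field).
\<close>

definition absolutely_irreducible_representation ::
    "('g, 'm) monoid_scheme \<Rightarrow> nat \<Rightarrow> ('g \<Rightarrow> 'f::field mat) \<Rightarrow> bool" where
  "absolutely_irreducible_representation \<Gamma> n \<rho> \<longleftrightarrow>
     irreducible_representation \<Gamma> n (\<lambda>\<gamma>. map_mat to_ac (\<rho> \<gamma>))"

definition splitting_field :: "'f::field itself \<Rightarrow> ('g, 'm) monoid_scheme \<Rightarrow> bool" where
  "splitting_field _ \<Gamma> \<longleftrightarrow>
     (\<forall>n (\<rho> :: 'g \<Rightarrow> 'f mat).
        irreducible_representation \<Gamma> n \<rho> \<longrightarrow> absolutely_irreducible_representation \<Gamma> n \<rho>)"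


section \<open>Algebras and their homomorphisms\<close>

definition algebra_hom ::
    "('r, 'm) ring_scheme \<Rightarrow> ('r, 'b, 'n) module_scheme \<Rightarrow> ('r, 'c, 'p) module_scheme \<Rightarrow> ('b \<Rightarrow> 'c) set"
  where
  "algebra_hom R M N =
     {f \<in> Ring.ring_hom M N. \<forall>c\<in>carrier R. \<forall>x\<in>carrier M. f (c \<odot>\<^bsub>M\<^esub> x) = c \<odot>\<^bsub>N\<^esub> f x}"

definition algebra_iso ::
    "('r, 'm) ring_scheme \<Rightarrow> ('r, 'b, 'n) module_scheme \<Rightarrow> ('r, 'c, 'p) module_scheme \<Rightarrow> ('b \<Rightarrow> 'c) set"
  where
  "algebra_iso R M N = {f \<in> algebra_hom R M N. bij_betw f (carrier M) (carrier N)}"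

definition scalar_algebra :: "('k::field, 'k) module" where
  "scalar_algebra =
     \<lparr>carrier = UNIV, monoid.mult = (*), one = 1, ring.zero = 0, add = (+), module.smult = (*)\<rparr>"

text \<open>The algebra of all \<open>'k\<close>-valued functions on \<open>S\<close>, that is, the product of copies of \<open>'k\<close> over \<open>S\<close>.\<close>

definition product_algebra :: "'x set \<Rightarrow> ('k::field, 'x \<Rightarrow> 'k) module" where
  "product_algebra S =
     \<lparr>carrier = S \<rightarrow>\<^sub>E UNIV,
      monoid.mult = (\<lambda>a b. \<lambda>x\<in>S. a x * b x), one = (\<lambda>x\<in>S. 1),
      ring.zero = (\<lambda>x\<in>S. 0), add = (\<lambda>a b. \<lambda>x\<in>S. a x + b x),
      module.smult = (\<lambda>c a. \<lambda>x\<in>S. c * a x)\<rparr>"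

text \<open>Its fixed points under the permutation of coordinates induced by an action of \<open>G\<close> on \<open>S\<close>.\<close>

definition permute_coords ::
    "('g, 'm) monoid_scheme \<Rightarrow> 'x set \<Rightarrow> ('g \<Rightarrow> 'x \<Rightarrow> 'x) \<Rightarrow> 'g \<Rightarrow> ('x \<Rightarrow> 'k) \<Rightarrow> 'x \<Rightarrow> 'k" where
  "permute_coords G S act g a = (\<lambda>x\<in>S. a (act (inv\<^bsub>G\<^esub> g) x))"

definition fixed_product_algebra ::
    "('g, 'm) monoid_scheme \<Rightarrow> 'x set \<Rightarrow> ('g \<Rightarrow> 'x \<Rightarrow> 'x) \<Rightarrow> ('k::field, 'x \<Rightarrow> 'k) module" where
  "fixed_product_algebra G S act =
     (product_algebra S)
       \<lparr>carrier := {a \<in> S \<rightarrow>\<^sub>E UNIV. \<forall>g\<in>carrier G. permute_coords G S act g a = a}\<rparr>"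


section \<open>Free vector spaces\<close>

text \<open>
  The vector space with basis \<open>B\<close> consists of the \<open>x :: 'b \<Rightarrow>\<^sub>0 'k\<close> with
  \<open>Poly_Mapping.keys x \<subseteq> B\<close>; a basis element \<open>b\<close> is \<open>Poly_Mapping.single b 1\<close>. The ring structure that
  \<^theory>\<open>HOL-Library.Poly_Mapping\<close> puts on such functions plays no role beyond addition.
\<close>

definition pm_scale :: "'k::field \<Rightarrow> ('b \<Rightarrow>\<^sub>0 'k) \<Rightarrow> ('b \<Rightarrow>\<^sub>0 'k)" where
  "pm_scale c x = Poly_Mapping.map (\<lambda>y. c * y) x"

text \<open>Linear extension of \<open>f\<close> from the basis, \<open>scale\<close> being the scalar multiplication of the target.\<close>

definition lin_ext :: "('k::field \<Rightarrow> 'v \<Rightarrow> 'v::comm_monoid_add) \<Rightarrow> ('b \<Rightarrow> 'v) \<Rightarrow> ('b \<Rightarrow>\<^sub>0 'k) \<Rightarrow> 'v" where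
  "lin_ext scale f x = (\<Sum>b\<in>Poly_Mapping.keys x. scale (Poly_Mapping.lookup x b) (f b))"


section \<open>Conjugation, and the pairs \<open>(U, \<phi>)\<close>\<close>

definition char_group :: "('g, 'm) monoid_scheme \<Rightarrow> ('a, 'n) monoid_scheme \<Rightarrow> 'g set \<Rightarrow> ('g \<Rightarrow> 'a) monoid" where
  "char_group G A H =
     \<lparr>carrier = hom (G\<lparr>carrier := H\<rparr>) A \<inter> extensional H,
      monoid.mult = (\<lambda>\<phi> \<psi>. \<lambda>x\<in>H. \<phi> x \<otimes>\<^bsub>A\<^esub> \<psi> x),
      one = (\<lambda>x\<in>H. \<one>\<^bsub>A\<^esub>)\<rparr>"

definition conj_set :: "('g, 'm) monoid_scheme \<Rightarrow> 'g \<Rightarrow> 'g set \<Rightarrow> 'g set" where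
  "conj_set G g U = g <#\<^bsub>G\<^esub> U #>\<^bsub>G\<^esub> inv\<^bsub>G\<^esub> g"

definition conj_char :: "('g, 'm) monoid_scheme \<Rightarrow> 'g \<Rightarrow> 'g set \<Rightarrow> ('g \<Rightarrow> 'a) \<Rightarrow> 'g \<Rightarrow> 'a" where
  "conj_char G g U \<phi> = (\<lambda>x \<in> conj_set G g U. \<phi> (inv\<^bsub>G\<^esub> g \<otimes>\<^bsub>G\<^esub> x \<otimes>\<^bsub>G\<^esub> g))"

definition fib_pairs ::
    "('g, 'm) monoid_scheme \<Rightarrow> ('a, 'n) monoid_scheme \<Rightarrow> ('g set \<times> ('g \<Rightarrow> 'a)) set" where
  "fib_pairs G A = {(U, \<phi>). subgroup U G \<and> \<phi> \<in> carrier (char_group G A U)}"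

definition fib_act ::
    "('g, 'm) monoid_scheme \<Rightarrow> 'g \<Rightarrow> 'g set \<times> ('g \<Rightarrow> 'a) \<Rightarrow> 'g set \<times> ('g \<Rightarrow> 'a)" where
  "fib_act G g = (\<lambda>(U, \<phi>). (conj_set G g U, conj_char G g U \<phi>))"

abbreviation fib_orbit ::
    "('g, 'm) monoid_scheme \<Rightarrow> 'g set \<times> ('g \<Rightarrow> 'a) \<Rightarrow> ('g set \<times> ('g \<Rightarrow> 'a)) set" where
  "fib_orbit G p \<equiv> orbit G (fib_act G) p"


section \<open>The fibered Burnside algebra\<close>

definition double_cosets :: "('g, 'm) monoid_scheme \<Rightarrow> 'g set \<Rightarrow> 'g set \<Rightarrow> 'g set set" where
  "double_cosets G U V = {(U #>\<^bsub>G\<^esub> g) <#>\<^bsub>G\<^esub> V | g. g \<in> carrier G}"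

text \<open>
  A chosen element of a double coset, or a chosen pair in an orbit. All the sums below are
  independent of these choices, as the classical formulas are.
\<close>

definition rep :: "'x set \<Rightarrow> 'x" where
  "rep D = (SOME g. g \<in> D)"

definition fib_mult_pairs ::
    "('g, 'm) monoid_scheme \<Rightarrow> ('a, 'n) monoid_scheme \<Rightarrow> 'g set \<times> ('g \<Rightarrow> 'a) \<Rightarrow> 'g set \<times> ('g \<Rightarrow> 'a) \<Rightarrow>
     ('g set \<times> ('g \<Rightarrow> 'a)) set \<Rightarrow>\<^sub>0 'k::field" where
  "fib_mult_pairs G A = (\<lambda>(U, \<phi>) (V, \<psi>).
     \<Sum>D\<in>double_cosets G U V.
       let g = rep D; W = U \<inter> conj_set G g V
       in Poly_Mapping.single
            (fib_orbit G (W, restrict \<phi> W \<otimes>\<^bsub>char_group G A W\<^esub> restrict (conj_char G g V \<psi>) W)) 1)"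

definition fib_burnside ::
    "('g, 'm) monoid_scheme \<Rightarrow> ('a, 'n) monoid_scheme \<Rightarrow>
     ('k::field, ('g set \<times> ('g \<Rightarrow> 'a)) set \<Rightarrow>\<^sub>0 'k) module" where
  "fib_burnside G A =
     \<lparr>carrier = {x. Poly_Mapping.keys x \<subseteq> orbits G (fib_pairs G A) (fib_act G)},
      monoid.mult = (\<lambda>x y.
        lin_ext pm_scale (\<lambda>a. lin_ext pm_scale (\<lambda>b. fib_mult_pairs G A (rep a) (rep b)) y) x),
      one = Poly_Mapping.single (fib_orbit G (carrier G, \<one>\<^bsub>char_group G A (carrier G)\<^esub>)) 1,
      ring.zero = 0, add = (+), module.smult = pm_scale\<rparr>"


section \<open>The maps \<open>s\<close>\<close>

definition fib_res ::
    "('g, 'm) monoid_scheme \<Rightarrow> 'g set \<Rightarrow>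
     (('g set \<times> ('g \<Rightarrow> 'a)) set \<Rightarrow>\<^sub>0 'k::field) \<Rightarrow> (('g set \<times> ('g \<Rightarrow> 'a)) set \<Rightarrow>\<^sub>0 'k)" where
  "fib_res G H = lin_ext pm_scale (\<lambda>a. case rep a of (U, \<phi>) \<Rightarrow>
     \<Sum>D\<in>double_cosets G H U.
       let g = rep D; W = H \<inter> conj_set G g U
       in Poly_Mapping.single (fib_orbit (G\<lparr>carrier := H\<rparr>) (W, restrict (conj_char G g U \<phi>) W)) 1)"

text \<open>The target is the group algebra of the character group of \<open>H\<close>, as a vector space.\<close>

definition fib_proj ::
    "'g set \<Rightarrow> (('g set \<times> ('g \<Rightarrow> 'a)) set \<Rightarrow>\<^sub>0 'k::field) \<Rightarrow> (('g \<Rightarrow> 'a) \<Rightarrow>\<^sub>0 'k)" where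
  "fib_proj H = lin_ext pm_scale (\<lambda>a. case rep a of (U, \<phi>) \<Rightarrow>
     if U = H then Poly_Mapping.single \<phi> 1 else 0)"

definition species_pairs ::
    "('g, 'm) monoid_scheme \<Rightarrow> ('a, 'n) monoid_scheme \<Rightarrow> ('g set \<times> (('g \<Rightarrow> 'a) \<Rightarrow> 'k::field)) set" where
  "species_pairs G A =
     {(H, \<Phi>). subgroup H G \<and>
        \<Phi> \<in> hom (char_group G A H) (units_of class_ring) \<inter> extensional (carrier (char_group G A H))}"

definition species_act ::
    "('g, 'm) monoid_scheme \<Rightarrow> ('a, 'n) monoid_scheme \<Rightarrow> 'g \<Rightarrow>
     'g set \<times> (('g \<Rightarrow> 'a) \<Rightarrow> 'k::field) \<Rightarrow> 'g set \<times> (('g \<Rightarrow> 'a) \<Rightarrow> 'k)" where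
  "species_act G A g = (\<lambda>(H, \<Phi>).
     (conj_set G g H,
      \<lambda>\<phi> \<in> carrier (char_group G A (conj_set G g H)).
        \<Phi> (conj_char G (inv\<^bsub>G\<^esub> g) (conj_set G g H) \<phi>)))"

definition species ::
    "('g, 'm) monoid_scheme \<Rightarrow> 'g set \<times> (('g \<Rightarrow> 'a) \<Rightarrow> 'k::field) \<Rightarrow>
     (('g set \<times> ('g \<Rightarrow> 'a)) set \<Rightarrow>\<^sub>0 'k) \<Rightarrow> 'k" where
  "species G = (\<lambda>(H, \<Phi>). lin_ext (*) \<Phi> \<circ> fib_proj H \<circ> fib_res G H)"

end

theory Submission
  imports Defs "Jordan_Normal_Form.Char_Poly"
begin

text \<open>
  The species \<open>s\<^sub>p\<close> are better behaved than their definition by double cosets suggests. For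
  \<open>p = (H, \<Phi>)\<close> and \<open>h \<in> G\<close> put \<open>m\<^sub>p(U, \<phi>)(h) = \<Phi>(\<^sup>h\<phi> restricted to H)\<close> if \<open>H\<close> lies in \<open>hUh\<^sup>-\<^sup>1\<close>, and \<open>0\<close>
  otherwise (\<open>mark\<close>). As a double coset \<open>UgV\<close> has \<open>|U||V| / |U \<inter> gVg\<^sup>-\<^sup>1|\<close> elements, a sum over
  representatives of double cosets is a weighted sum over \<open>G\<close> (\<open>sum_double_cosets\<close>), and one finds
  \<open>s\<^sub>p[U, \<phi>] = (1/|U|) \<Sum>\<^sub>h m\<^sub>p(U, \<phi>)(h)\<close> (\<open>species_single\<close>). Conjugating \<open>(U, \<phi>)\<close> or \<open>p\<close> translates the function
  \<open>m\<^sub>p(U, \<phi>)\<close> on the right or on the left, and the mark of the summand of \<open>[U, \<phi>] [V, \<psi>]\<close> belonging to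
  \<open>g\<close> is \<open>h \<mapsto> m\<^sub>p(U, \<phi>)(h) m\<^sub>p(V, \<psi>)(hg)\<close>. Summing over \<open>h\<close> and \<open>g\<close> shows that \<open>s\<^sub>p\<close> is multiplicative
  (\<open>species_mult\<close>) and depends only on the conjugacy class of \<open>p\<close> (\<open>species_invariant\<close>).

  Bijectivity is a triangularity argument along the order of the subgroups. On basis elements
  \<open>[U, \<phi>]\<close> with \<open>|U| \<le> |H|\<close> only the conjugates of \<open>H\<close> contribute to \<open>s\<^sub>p\<close>, and there \<open>s\<^sub>p\<close> is the linear
  extension of \<open>\<Phi>\<close> to the group algebra of \<open>H\<^sup>*\<close>, averaged over conjugation. So injectivity reduces
  to the fact that the linear characters of \<open>H\<^sup>*\<close> over \<open>K\<close> separate the elements of \<open>KH\<^sup>*\<close>, and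
  surjectivity to the fact that their values can be prescribed: the two orthogonality relations
  for the finite abelian group \<open>H\<^sup>*\<close> (\<open>linear_characters_separate\<close>, \<open>linear_characters_interpolate\<close>,
  \<open>species_injective\<close>, \<open>species_surjective\<close>).

  The first of these needs enough characters, and here the splitting hypothesis enters: an
  irreducible representation of an abelian group over a splitting field stays irreducible over
  the algebraic closure, where Schur's lemma makes it one-dimensional. Applied to a minimal
  invariant subspace inside \<open>(1 - \<gamma>) K\<Gamma>\<close>, this yields a linear character that is not trivial
  on \<open>\<gamma>\<close> (\<open>exists_linear_character_nontrivial\<close>).

  The remaining claims are formal. The ring axioms of the Burnside algebra are inherited from \<open>K\<close>
  because the species separate its elements; an algebra homomorphism different from all of the
  finitely many species would be nonzero on a product annihilated by all of them; and the
  indicator function of a \<open>G\<close>-orbit is in the image, so that species of non-conjugate pairs differ.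
\<close>

section \<open>Irreducible representations of abelian groups over a splitting field\<close>

lemma subspace_vec_iff:
  "subspace class_ring W (module_vec TYPE('f::field) n) \<longleftrightarrow>
     W \<subseteq> carrier_vec n \<and> 0\<^sub>v n \<in> W \<and> (\<forall>v\<in>W. \<forall>w\<in>W. v + w \<in> W) \<and> (\<forall>c. \<forall>v\<in>W. c \<cdot>\<^sub>v v \<in> W)"
  using vec_vs[where 'a = 'f, of n] vec_module[where 'a = 'f, of n]
  by (auto simp: subspace_def submodule_def module_vec_simps)

lemma representationD:
  assumes "representation \<Gamma> n (\<rho> :: 'g \<Rightarrow> 'f::field mat)"
  shows "\<gamma> \<in> carrier \<Gamma> \<Longrightarrow> \<rho> \<gamma> \<in> carrier_mat n n"
    and "\<lbrakk>\<gamma> \<in> carrier \<Gamma>; \<delta> \<in> carrier \<Gamma>\<rbrakk> \<Longrightarrow> \<rho> (\<gamma> \<otimes>\<^bsub>\<Gamma>\<^esub> \<delta>) = \<rho> \<gamma> * \<rho> \<delta>"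
  using assms
  by (auto simp: representation_def hom_def units_of_def Units_def ring_mat_simps Pi_iff)

lemma representationI:
  fixes \<rho> :: "'g \<Rightarrow> 'f::field mat"
  assumes "group \<Gamma>"
    and carr: "\<And>\<gamma>. \<gamma> \<in> carrier \<Gamma> \<Longrightarrow> \<rho> \<gamma> \<in> carrier_mat n n"
    and mult: "\<And>\<gamma> \<delta>. \<lbrakk>\<gamma> \<in> carrier \<Gamma>; \<delta> \<in> carrier \<Gamma>\<rbrakk> \<Longrightarrow> \<rho> (\<gamma> \<otimes>\<^bsub>\<Gamma>\<^esub> \<delta>) = \<rho> \<gamma> * \<rho> \<delta>"
    and one: "\<rho> \<one>\<^bsub>\<Gamma>\<^esub> = 1\<^sub>m n"
  shows "representation \<Gamma> n \<rho>"
proof -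
  interpret group \<Gamma> by fact
  have "\<rho> \<gamma> \<in> Units (ring_mat TYPE('f) n ())" if "\<gamma> \<in> carrier \<Gamma>" for \<gamma>
    using that carr mult[of \<gamma> "inv\<^bsub>\<Gamma>\<^esub> \<gamma>"] mult[of "inv\<^bsub>\<Gamma>\<^esub> \<gamma>" \<gamma>] one
    by (auto simp: Units_def ring_mat_simps intro!: bexI[of _ "\<rho> (inv\<^bsub>\<Gamma>\<^esub> \<gamma>)"])
  then show ?thesis
    using mult by (auto simp: representation_def hom_def units_of_def ring_mat_simps)
qed

lemma irreducible_representationI:
  fixes \<rho> :: "'g \<Rightarrow> 'f::field mat"
  assumes "representation \<Gamma> n \<rho>" and "n > 0"
    and "\<And>W. \<lbrakk>W \<subseteq> carrier_vec n; 0\<^sub>v n \<in> W; \<And>v w. v \<in> W \<Longrightarrow> w \<in> W \<Longrightarrow> v + w \<in> W;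
              \<And>c v. v \<in> W \<Longrightarrow> c \<cdot>\<^sub>v v \<in> W;
              \<And>\<gamma> w. \<gamma> \<in> carrier \<Gamma> \<Longrightarrow> w \<in> W \<Longrightarrow> \<rho> \<gamma> *\<^sub>v w \<in> W\<rbrakk>
           \<Longrightarrow> W = {0\<^sub>v n} \<or> W = carrier_vec n"
  shows "irreducible_representation \<Gamma> n \<rho>"
  unfolding irreducible_representation_def subspace_vec_iff using assms by simp

text \<open>
  Schur's lemma: since the group is abelian, an eigenspace of one \<open>\<rho> \<gamma>\<close> is invariant under the whole
  group, hence everything. So every \<open>\<rho> \<gamma>\<close> is a scalar, every line is invariant, and irreducibility
  leaves room for only one dimension.
\<close>

lemma irreducible_representation_comm_group_alg_closed:
  fixes \<rho> :: "'g \<Rightarrow> 'f::alg_closed_field mat"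
  assumes "comm_group \<Gamma>" and irr: "irreducible_representation \<Gamma> n \<rho>"
  shows "n = 1"
proof -
  interpret comm_group \<Gamma> by fact
  have n: "n > 0" and rep: "representation \<Gamma> n \<rho>"
    and irrD: "\<And>W. subspace class_ring W (module_vec TYPE('f) n) \<Longrightarrow>
        (\<And>\<gamma> w. \<gamma> \<in> carrier \<Gamma> \<Longrightarrow> w \<in> W \<Longrightarrow> \<rho> \<gamma> *\<^sub>v w \<in> W) \<Longrightarrow> W = {0\<^sub>v n} \<or> W = carrier_vec n"
    using irr by (auto simp: irreducible_representation_def)
  note carr = representationD(1)[OF rep] and mult = representationD(2)[OF rep]
  have scalar: "\<exists>k. \<forall>w\<in>carrier_vec n. \<rho> \<gamma> *\<^sub>v w = k \<cdot>\<^sub>v w" if \<gamma>: "\<gamma> \<in> carrier \<Gamma>" for \<gamma>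
  proof -
    have "degree (char_poly (\<rho> \<gamma>)) > 0"
      using degree_monic_char_poly[OF carr[OF \<gamma>]] n by simp
    then obtain k where "poly (char_poly (\<rho> \<gamma>)) k = 0"
      using alg_closed_imp_poly_has_root by blast
    then have "eigenvalue (\<rho> \<gamma>) k"
      using eigenvalue_root_char_poly[OF carr[OF \<gamma>]] by simp
    then obtain v where v: "v \<in> carrier_vec n" "v \<noteq> 0\<^sub>v n" "\<rho> \<gamma> *\<^sub>v v = k \<cdot>\<^sub>v v"
      using carr[OF \<gamma>] by (auto simp: eigenvalue_def eigenvector_def)
    define W where "W = {w \<in> carrier_vec n. \<rho> \<gamma> *\<^sub>v w = k \<cdot>\<^sub>v w}"
    have "W = {0\<^sub>v n} \<or> W = carrier_vec n"
    proof (rule irrD)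
      show "subspace class_ring W (module_vec TYPE('f) n)"
        using carr[OF \<gamma>] unfolding subspace_vec_iff W_def
        by (auto simp: mult_add_distrib_mat_vec smult_add_distrib_vec mult_mat_vec smult_smult_assoc
            mult.commute)
    next
      fix \<delta> w assume \<delta>: "\<delta> \<in> carrier \<Gamma>" and w: "w \<in> W"
      have w': "w \<in> carrier_vec n" using w by (simp add: W_def)
      have "\<rho> \<gamma> *\<^sub>v (\<rho> \<delta> *\<^sub>v w) = (\<rho> \<gamma> * \<rho> \<delta>) *\<^sub>v w"
        using carr[OF \<gamma>] carr[OF \<delta>] w' by (simp add: assoc_mult_mat_vec)
      also have "\<dots> = (\<rho> \<delta> * \<rho> \<gamma>) *\<^sub>v w"
        using \<gamma> \<delta> by (metis m_comm mult)
      also have "\<dots> = \<rho> \<delta> *\<^sub>v (\<rho> \<gamma> *\<^sub>v w)"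
        using carr[OF \<gamma>] carr[OF \<delta>] w' by (simp add: assoc_mult_mat_vec)
      also have "\<dots> = k \<cdot>\<^sub>v (\<rho> \<delta> *\<^sub>v w)"
        using w carr[OF \<delta>] by (simp add: W_def mult_mat_vec)
      finally show "\<rho> \<delta> *\<^sub>v w \<in> W"
        using carr[OF \<delta>] w' by (simp add: W_def)
    qed
    moreover have "v \<in> W" using v by (simp add: W_def)
    ultimately have "W = carrier_vec n" using v(2) by auto
    then show ?thesis by (auto simp: W_def)
  qed
  define L where "L = {c \<cdot>\<^sub>v unit_vec n 0 | c :: 'f. True}"
  have "L = {0\<^sub>v n} \<or> L = carrier_vec n"
  proof (rule irrD)
    have "0\<^sub>v n = (0::'f) \<cdot>\<^sub>v unit_vec n 0" by auto
    then show "subspace class_ring L (module_vec TYPE('f) n)"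
      unfolding subspace_vec_iff L_def
      by (auto simp: smult_smult_assoc simp flip: add_smult_distrib_vec)
  next
    fix \<delta> w assume \<delta>: "\<delta> \<in> carrier \<Gamma>" and w: "w \<in> L"
    obtain k where k: "\<forall>w\<in>carrier_vec n. \<rho> \<delta> *\<^sub>v w = k \<cdot>\<^sub>v w" using scalar[OF \<delta>] ..
    have "w \<in> carrier_vec n" using w by (auto simp: L_def)
    then show "\<rho> \<delta> *\<^sub>v w \<in> L" using w k by (auto simp: L_def smult_smult_assoc)
  qed
  moreover have "unit_vec n 0 \<in> L"
    unfolding L_def by (auto intro!: exI[of _ 1])
  moreover have "unit_vec n 0 \<noteq> (0\<^sub>v n :: 'f vec)"
    using n by (metis index_unit_vec(1) index_zero_vec(1) zero_neq_one)
  ultimately have L: "L = carrier_vec n" by auto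
  show "n = 1"
  proof (rule ccontr)
    assume "n \<noteq> 1"
    with n have n1: "1 < n" by simp
    have "unit_vec n 1 \<in> L" unfolding L by simp
    then obtain c :: 'f where "unit_vec n 1 = c \<cdot>\<^sub>v unit_vec n 0" by (auto simp: L_def)
    then have "unit_vec n 1 $ 1 = (c \<cdot>\<^sub>v unit_vec n 0) $ 1" by simp
    then show False using n1 by simp
  qed
qed

lemma (in vector_space) finite_basis_of_subspace:
  assumes "subspace W" and "finite S" and "W \<subseteq> span S"
  obtains B where "B \<subseteq> W" "independent B" "finite B" "span B = W"
proof -
  obtain B where B: "B \<subseteq> W" "independent B" "W \<subseteq> span B"
    using basis_exists by metis
  have "finite B"
    using independent_span_bound[OF assms(2) B(2)] B(1) assms(3) by auto
  moreover have "span B = W" using B span_subspace[OF B(1,3) assms(1)] by simp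
  ultimately show ?thesis using that B by blast
qed

text \<open>
  A subspace \<open>W\<close> of least dimension will do: a basis of a smaller candidate extends to a basis of \<open>W\<close>,
  which by minimality has no further elements. The predicate \<open>P\<close> stands for invariance under a group action.
\<close>

lemma (in vector_space) minimal_subspace_exists:
  assumes "finite S" and "subspace U" "U \<subseteq> span S" "U \<noteq> {0}" "P U"
  obtains W where "subspace W" "W \<subseteq> U" "W \<noteq> {0}" "P W"
    and "\<And>W'. \<lbrakk>subspace W'; W' \<subseteq> W; P W'; W' \<noteq> {0}\<rbrakk> \<Longrightarrow> W' = W"
proof -
  let ?Q = "\<lambda>W. subspace W \<and> W \<subseteq> U \<and> W \<noteq> {0} \<and> P W"
  have "?Q U" using assms by simp
  then obtain W where W: "?Q W" and min: "\<And>W'. ?Q W' \<Longrightarrow> dim W \<le> dim W'"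
    using ex_has_least_nat[of ?Q U dim] by metis
  have "W' = W" if W': "subspace W'" "W' \<subseteq> W" "P W'" "W' \<noteq> {0}" for W'
  proof -
    obtain B where B: "B \<subseteq> W'" "independent B" "finite B" "span B = W'"
      using finite_basis_of_subspace[OF W'(1) assms(1)] W' W assms(3) by blast
    obtain C where C: "B \<subseteq> C" "C \<subseteq> W" "independent C" "W \<subseteq> span C"
      using maximal_independent_subset_extend[of B W] B W' by blast
    have "finite C"
      using independent_span_bound[OF assms(1) C(3)] C(2) W assms(3) by auto
    moreover have "card C \<le> card B"
      using min[of W'] W' W dim_eq_card_independent[OF B(2)] dim_eq_card_independent[OF C(3)]
        dim_eq_card[of C W] dim_eq_card[of B W'] B C span_subspace[OF C(2,4)] span_eq_iff
      by (metis dim_span subset_trans)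
    ultimately have "C = B" using C(1) by (metis card_seteq)
    then show ?thesis using B C W' by auto
  qed
  with W show ?thesis using that by blast
qed

text \<open>
  In coordinates for a basis of \<open>W\<close> the action becomes an irreducible matrix representation. By the
  splitting hypothesis it is irreducible over the algebraic closure too, so it has degree one.
\<close>

lemma (in vector_space) linear_character_on_irreducible_subspace:
  fixes \<Gamma> :: "('g, 'm) monoid_scheme" and T :: "'g \<Rightarrow> 'b \<Rightarrow> 'b"
  assumes "comm_group \<Gamma>" and split: "splitting_field TYPE('a) \<Gamma>"
    and add: "\<And>\<gamma> v w. \<gamma> \<in> carrier \<Gamma> \<Longrightarrow> T \<gamma> (v + w) = T \<gamma> v + T \<gamma> w"
    and smult: "\<And>\<gamma> c v. \<gamma> \<in> carrier \<Gamma> \<Longrightarrow> T \<gamma> (c *s v) = c *s T \<gamma> v"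
    and mult: "\<And>\<gamma> \<delta> v. \<gamma> \<in> carrier \<Gamma> \<Longrightarrow> \<delta> \<in> carrier \<Gamma> \<Longrightarrow> T (\<gamma> \<otimes>\<^bsub>\<Gamma>\<^esub> \<delta>) v = T \<gamma> (T \<delta> v)"
    and one: "\<And>v. T \<one>\<^bsub>\<Gamma>\<^esub> v = v"
    and W: "subspace W" "W \<noteq> {0}" "finite S" "W \<subseteq> span S"
    and inv: "\<And>\<gamma> w. \<gamma> \<in> carrier \<Gamma> \<Longrightarrow> w \<in> W \<Longrightarrow> T \<gamma> w \<in> W"
    and irr: "\<And>W'. \<lbrakk>subspace W'; W' \<subseteq> W; \<And>\<gamma> w. \<gamma> \<in> carrier \<Gamma> \<Longrightarrow> w \<in> W' \<Longrightarrow> T \<gamma> w \<in> W';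
                    W' \<noteq> {0}\<rbrakk> \<Longrightarrow> W' = W"
  obtains \<Phi> where "\<Phi> \<in> hom \<Gamma> (units_of (class_ring :: 'a ring))"
    and "\<And>\<gamma> w. \<lbrakk>\<gamma> \<in> carrier \<Gamma>; w \<in> W\<rbrakk> \<Longrightarrow> T \<gamma> w = \<Phi> \<gamma> *s w"
proof -
  interpret G: comm_group \<Gamma> by fact
  obtain B where B: "B \<subseteq> W" "independent B" "finite B" "span B = W"
    using finite_basis_of_subspace[OF W(1,3,4)] by metis
  define n where "n = card B"
  obtain b where b: "bij_betw b {..<n} B"
    using ex_bij_betw_nat_finite[OF B(3)] unfolding n_def atLeast0LessThan by blast
  have n: "n > 0" using B W(2) by (auto simp: n_def card_gt_0_iff)
  \<comment> \<open>the isomorphism from column vectors onto \<open>W\<close> given by the basis; \<open>\<rho>\<close> below is the action in these coordinates\<close>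
  define emb where "emb x = (\<Sum>i<n. (x $ i) *s b i)" for x :: "'a vec"
  have emb_W: "emb x \<in> W" for x
    unfolding emb_def using W(1) B(1) b
    by (auto intro!: subspace_sum subspace_scale simp: bij_betw_def)
  have emb_add: "emb (x + y) = emb x + emb y" if "x \<in> carrier_vec n" "y \<in> carrier_vec n" for x y
    using that by (simp add: emb_def scale_left_distrib sum.distrib)
  have emb_smult: "emb (c \<cdot>\<^sub>v x) = c *s emb x" if "x \<in> carrier_vec n" for c x
    using that by (simp add: emb_def scale_sum_right)
  have emb_0: "emb (0\<^sub>v n) = 0" by (simp add: emb_def)
  have emb_eq: "emb x = (\<Sum>v\<in>B. (x $ (the_inv_into {..<n} b v)) *s v)" for x
    using sum.reindex_bij_betw[OF b, of "\<lambda>v. (x $ the_inv_into {..<n} b v) *s v"] b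
    by (simp add: emb_def bij_betw_def the_inv_into_f_f)
  have emb_inj: "x = y" if xy: "x \<in> carrier_vec n" "y \<in> carrier_vec n" "emb x = emb y" for x y
  proof (rule eq_vecI)
    fix i assume "i < dim_vec y"
    then have i: "i < n" using xy by simp
    have "(\<Sum>v\<in>B. (x $ (the_inv_into {..<n} b v) - y $ (the_inv_into {..<n} b v)) *s v) = 0"
      using xy(3) by (simp add: emb_eq scale_left_diff_distrib sum_subtractf)
    then have "x $ (the_inv_into {..<n} b (b i)) - y $ (the_inv_into {..<n} b (b i)) = 0"
      by (rule independentD[OF B(2,3) order_refl]) (use b i in \<open>auto simp: bij_betw_def\<close>)
    then show "x $ i = y $ i" using b i by (simp add: bij_betw_def the_inv_into_f_f)
  qed (use xy in auto)
  have emb_surj: "\<exists>x\<in>carrier_vec n. emb x = w" if "w \<in> W" for w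
  proof -
    obtain u where u: "w = (\<Sum>v\<in>B. u v *s v)"
      using \<open>w \<in> W\<close> B span_finite[OF B(3)] by auto
    have "emb (vec n (\<lambda>i. u (b i))) = (\<Sum>i<n. u (b i) *s b i)" by (simp add: emb_def)
    also have "\<dots> = w" unfolding u using sum.reindex_bij_betw[OF b, of "\<lambda>v. u v *s v"] by simp
    finally show ?thesis by (intro bexI[of _ "vec n (\<lambda>i. u (b i))"]) auto
  qed
  have T_sum: "T \<gamma> (\<Sum>i\<in>I. f i) = (\<Sum>i\<in>I. T \<gamma> (f i))" if "\<gamma> \<in> carrier \<Gamma>" for \<gamma> I and f :: "nat \<Rightarrow> 'b"
    using add[OF that] smult[OF that, of 0 0]
    by (induction I rule: infinite_finite_induct) auto
  define co where "co w = (SOME x. x \<in> carrier_vec n \<and> emb x = w)" for w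
  have co: "co w \<in> carrier_vec n" "emb (co w) = w" if "w \<in> W" for w
    using someI_ex[of "\<lambda>x. x \<in> carrier_vec n \<and> emb x = w"] emb_surj[OF that]
    unfolding co_def by auto
  define \<rho> where "\<rho> \<gamma> = mat n n (\<lambda>(i, j). co (T \<gamma> (b j)) $ i)" for \<gamma>
  have \<rho>_carr: "\<rho> \<gamma> \<in> carrier_mat n n" for \<gamma> by (simp add: \<rho>_def)
  have emb_\<rho>: "emb (\<rho> \<gamma> *\<^sub>v x) = T \<gamma> (emb x)" if \<gamma>: "\<gamma> \<in> carrier \<Gamma>" and x: "x \<in> carrier_vec n" for \<gamma> x
  proof -
    have TbW: "T \<gamma> (b j) \<in> W" if "j < n" for j
      using b B(1) inv[OF \<gamma>] that by (auto simp: bij_betw_def)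
    have "emb (\<rho> \<gamma> *\<^sub>v x) = (\<Sum>i<n. (\<Sum>j<n. co (T \<gamma> (b j)) $ i * x $ j) *s b i)"
      using x by (auto simp: emb_def \<rho>_def scalar_prod_def lessThan_atLeast0 intro!: sum.cong)
    also have "\<dots> = (\<Sum>j<n. \<Sum>i<n. (x $ j) *s ((co (T \<gamma> (b j)) $ i) *s b i))"
      by (subst sum.swap) (simp add: scale_sum_left mult.commute)
    also have "\<dots> = (\<Sum>j<n. (x $ j) *s emb (co (T \<gamma> (b j))))"
      by (simp add: emb_def scale_sum_right)
    also have "\<dots> = (\<Sum>j<n. (x $ j) *s T \<gamma> (b j))"
      using co(2)[OF TbW] by simp
    also have "\<dots> = T \<gamma> (emb x)"
      using \<gamma> by (simp add: emb_def T_sum smult)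
    finally show ?thesis .
  qed
  have mat_eq: "M = N" if "M \<in> carrier_mat n n" "N \<in> carrier_mat n n"
    "\<And>x. x \<in> carrier_vec n \<Longrightarrow> emb (M *\<^sub>v x) = emb (N *\<^sub>v x)" for M N
  proof (rule eq_matI)
    fix i j assume "i < dim_row N" "j < dim_col N"
    then have ij: "i < n" "j < n" using that(2) by auto
    have "M *\<^sub>v unit_vec n j = N *\<^sub>v unit_vec n j"
      by (rule emb_inj) (use that in auto)
    then have "(M *\<^sub>v unit_vec n j) $ i = (N *\<^sub>v unit_vec n j) $ i" by simp
    then show "M $$ (i, j) = N $$ (i, j)" using ij that(1,2) by simp
  qed (use that in auto)
  have rep: "Defs.representation \<Gamma> n \<rho>"
  proof (rule representationI)
    show "\<rho> (\<gamma> \<otimes>\<^bsub>\<Gamma>\<^esub> \<delta>) = \<rho> \<gamma> * \<rho> \<delta>" if "\<gamma> \<in> carrier \<Gamma>" "\<delta> \<in> carrier \<Gamma>" for \<gamma> \<delta>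
      by (rule mat_eq)
         (use that in \<open>auto simp: \<rho>_carr emb_\<rho> mult assoc_mult_mat_vec[OF \<rho>_carr \<rho>_carr]
           mult_mat_vec_carrier[OF \<rho>_carr] intro: mult_carrier_mat[OF \<rho>_carr \<rho>_carr]\<close>)
    show "\<rho> \<one>\<^bsub>\<Gamma>\<^esub> = 1\<^sub>m n"
      by (rule mat_eq) (auto simp: \<rho>_carr emb_\<rho> one)
  qed (auto simp: \<rho>_carr G.is_group)
  have "irreducible_representation \<Gamma> n \<rho>"
  proof (rule irreducible_representationI[OF rep n])
    fix Y :: "'a vec set"
    assume Yc: "Y \<subseteq> carrier_vec n" and Y0: "0\<^sub>v n \<in> Y"
      and Yadd: "\<And>v w. v \<in> Y \<Longrightarrow> w \<in> Y \<Longrightarrow> v + w \<in> Y" and Ysmult: "\<And>c v. v \<in> Y \<Longrightarrow> c \<cdot>\<^sub>v v \<in> Y"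
      and Yinv: "\<And>\<gamma> w. \<gamma> \<in> carrier \<Gamma> \<Longrightarrow> w \<in> Y \<Longrightarrow> \<rho> \<gamma> *\<^sub>v w \<in> Y"
    have sub: "subspace (emb ` Y)"
    proof (rule subspaceI)
      show "0 \<in> emb ` Y" using Y0 emb_0 by (metis imageI)
    next
      fix x y assume "x \<in> emb ` Y" "y \<in> emb ` Y"
      then obtain x' y' where xy: "x' \<in> Y" "y' \<in> Y" "x = emb x'" "y = emb y'" by blast
      then have "x + y = emb (x' + y')" using emb_add Yc by (metis subsetD)
      then show "x + y \<in> emb ` Y" using xy Yadd by blast
    next
      fix c x assume "x \<in> emb ` Y"
      then obtain x' where x: "x' \<in> Y" "x = emb x'" by blast
      then have "c *s x = emb (c \<cdot>\<^sub>v x')" using emb_smult Yc by (metis subsetD)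
      then show "c *s x \<in> emb ` Y" using x Ysmult by blast
    qed
    show "Y = {0\<^sub>v n} \<or> Y = carrier_vec n"
    proof (cases "emb ` Y = {0}")
      case True
      have "x = 0\<^sub>v n" if "x \<in> Y" for x
        using that True emb_inj[of x "0\<^sub>v n"] emb_0 Yc by auto
      then show ?thesis using Y0 by blast
    next
      case False
      have "emb ` Y = W"
      proof (rule irr[OF sub _ _ False])
        show "T \<gamma> w \<in> emb ` Y" if "\<gamma> \<in> carrier \<Gamma>" "w \<in> emb ` Y" for \<gamma> w
          using that Yinv Yc emb_\<rho>[OF that(1)] by (auto simp: image_iff) (metis subsetD)
      qed (use emb_W in auto)
      then have "carrier_vec n \<subseteq> Y"
        using emb_W emb_inj Yc by (metis (no_types, lifting) imageE subset_iff)
      then show ?thesis using Yc by blast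
    qed
  qed
  then have "irreducible_representation \<Gamma> n (\<lambda>\<gamma>. map_mat to_ac (\<rho> \<gamma>))"
    using split unfolding splitting_field_def absolutely_irreducible_representation_def by blast
  then have n1: "n = 1"
    using irreducible_representation_comm_group_alg_closed G.comm_group_axioms by blast
  define \<Phi> where "\<Phi> \<gamma> = \<rho> \<gamma> $$ (0, 0)" for \<gamma>
  have \<Phi>: "T \<gamma> w = \<Phi> \<gamma> *s w" if "\<gamma> \<in> carrier \<Gamma>" "w \<in> W" for \<gamma> w
  proof -
    obtain x where x: "x \<in> carrier_vec n" "emb x = w" using emb_surj[OF \<open>w \<in> W\<close>] by blast
    have "\<rho> \<gamma> *\<^sub>v x = \<Phi> \<gamma> \<cdot>\<^sub>v x"
      using x(1) n1 \<rho>_carr[of \<gamma>] by (intro eq_vecI) (auto simp: \<Phi>_def scalar_prod_def)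
    then show ?thesis using emb_\<rho>[OF that(1) x(1)] emb_smult x by simp
  qed
  have mult1: "\<Phi> (\<gamma> \<otimes>\<^bsub>\<Gamma>\<^esub> \<delta>) = \<Phi> \<gamma> * \<Phi> \<delta>" if "\<gamma> \<in> carrier \<Gamma>" "\<delta> \<in> carrier \<Gamma>" for \<gamma> \<delta>
    using representationD(2)[OF rep that] n1 \<rho>_carr[of \<gamma>] \<rho>_carr[of \<delta>]
    by (simp add: \<Phi>_def scalar_prod_def)
  have one1: "\<Phi> \<one>\<^bsub>\<Gamma>\<^esub> = 1"
  proof -
    obtain w where "w \<in> W" "w \<noteq> 0" using W(1,2) subspace_0 by blast
    then show ?thesis using \<Phi>[of "\<one>\<^bsub>\<Gamma>\<^esub>" w] one by (metis G.one_closed scale_one scale_right_imp_eq)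
  qed
  have "\<Phi> \<gamma> \<in> Units (class_ring :: 'a ring)" if "\<gamma> \<in> carrier \<Gamma>" for \<gamma>
    using mult1[of \<gamma> "inv\<^bsub>\<Gamma>\<^esub> \<gamma>"] mult1[of "inv\<^bsub>\<Gamma>\<^esub> \<gamma>" \<gamma>] one1 that
    by (auto simp: Units_def intro!: exI[of _ "\<Phi> (inv\<^bsub>\<Gamma>\<^esub> \<gamma>)"])
  then have "\<Phi> \<in> hom \<Gamma> (units_of (class_ring :: 'a ring))"
    using mult1 by (auto simp: hom_def units_of_def)
  then show ?thesis using \<Phi> that by blast
qed

section \<open>Linear characters of finite abelian groups\<close>

lemma lookup_pm_scale [simp]: "Poly_Mapping.lookup (pm_scale c x) b = c * Poly_Mapping.lookup x b"
  by (simp add: pm_scale_def Poly_Mapping.map.rep_eq when_def)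

interpretation pm: vector_space "pm_scale :: 'k::field \<Rightarrow> ('b \<Rightarrow>\<^sub>0 'k) \<Rightarrow> ('b \<Rightarrow>\<^sub>0 'k)"
  by unfold_locales (auto intro!: poly_mapping_eqI simp: lookup_add algebra_simps)

definition linear_characters :: "('x, 'm) monoid_scheme \<Rightarrow> ('x \<Rightarrow> 'k::field) set" where
  "linear_characters \<Gamma> = hom \<Gamma> (units_of class_ring) \<inter> extensional (carrier \<Gamma>)"

lemma Units_class_ring: "Units (class_ring :: 'k::field ring) = UNIV - {0}"
proof -
  have "\<exists>y. y * x = 1 \<and> x * y = 1" if "x \<noteq> 0" for x :: 'k
    using that by (intro exI[of _ "inverse x"]) simp
  then show ?thesis by (auto simp: Units_def)
qed

lemma linear_charactersD:
  assumes "group \<Gamma>" and "\<Phi> \<in> (linear_characters \<Gamma> :: ('x \<Rightarrow> 'k::field) set)"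
  shows "x \<in> carrier \<Gamma> \<Longrightarrow> \<Phi> x \<noteq> 0"
    and "\<lbrakk>x \<in> carrier \<Gamma>; y \<in> carrier \<Gamma>\<rbrakk> \<Longrightarrow> \<Phi> (x \<otimes>\<^bsub>\<Gamma>\<^esub> y) = \<Phi> x * \<Phi> y"
    and "\<Phi> \<one>\<^bsub>\<Gamma>\<^esub> = 1"
    and "x \<in> carrier \<Gamma> \<Longrightarrow> \<Phi> (inv\<^bsub>\<Gamma>\<^esub> x) = inverse (\<Phi> x)"
    and "\<Phi> \<in> extensional (carrier \<Gamma>)"
proof -
  interpret group \<Gamma> by fact
  have nz: "\<Phi> x \<noteq> 0" if "x \<in> carrier \<Gamma>" for x
    using assms(2) that by (auto simp: linear_characters_def hom_def units_of_def Units_class_ring)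
  have mult: "\<Phi> (x \<otimes>\<^bsub>\<Gamma>\<^esub> y) = \<Phi> x * \<Phi> y" if "x \<in> carrier \<Gamma>" "y \<in> carrier \<Gamma>" for x y
    using assms(2) that by (auto simp: linear_characters_def hom_def units_of_def)
  have one: "\<Phi> \<one>\<^bsub>\<Gamma>\<^esub> = 1"
    using mult[of "\<one>\<^bsub>\<Gamma>\<^esub>" "\<one>\<^bsub>\<Gamma>\<^esub>"] nz[of "\<one>\<^bsub>\<Gamma>\<^esub>"] by simp
  have inv: "\<Phi> (inv\<^bsub>\<Gamma>\<^esub> x) = inverse (\<Phi> x)" if "x \<in> carrier \<Gamma>" for x
    using mult[of x "inv\<^bsub>\<Gamma>\<^esub> x"] one that inverse_unique[of "\<Phi> x"] by simp
  show "x \<in> carrier \<Gamma> \<Longrightarrow> \<Phi> x \<noteq> 0"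
    and "\<lbrakk>x \<in> carrier \<Gamma>; y \<in> carrier \<Gamma>\<rbrakk> \<Longrightarrow> \<Phi> (x \<otimes>\<^bsub>\<Gamma>\<^esub> y) = \<Phi> x * \<Phi> y"
    and "\<Phi> \<one>\<^bsub>\<Gamma>\<^esub> = 1"
    and "x \<in> carrier \<Gamma> \<Longrightarrow> \<Phi> (inv\<^bsub>\<Gamma>\<^esub> x) = inverse (\<Phi> x)"
    and "\<Phi> \<in> extensional (carrier \<Gamma>)"
    using nz mult one inv assms(2) by (auto simp: linear_characters_def)
qed

lemma linear_charactersI:
  fixes \<Phi> :: "'x \<Rightarrow> 'k::field"
  assumes "\<And>x. x \<in> carrier \<Gamma> \<Longrightarrow> \<Phi> x \<noteq> 0"
    and "\<And>x y. \<lbrakk>x \<in> carrier \<Gamma>; y \<in> carrier \<Gamma>\<rbrakk> \<Longrightarrow> \<Phi> (x \<otimes>\<^bsub>\<Gamma>\<^esub> y) = \<Phi> x * \<Phi> y"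
    and "\<Phi> \<in> extensional (carrier \<Gamma>)"
  shows "\<Phi> \<in> linear_characters \<Gamma>"
  using assms by (auto simp: linear_characters_def hom_def units_of_def Units_class_ring)

lemma finite_linear_characters:
  assumes "group \<Gamma>" and "finite (carrier \<Gamma>)"
  shows "finite (linear_characters \<Gamma> :: ('x \<Rightarrow> 'k::field) set)"
proof -
  interpret group \<Gamma> by fact
  let ?n = "Coset.order \<Gamma>"
  have n: "?n > 0" using assms by (simp add: order_gt_0_iff_finite)
  \<comment> \<open>the possible values of a character: roots of unity of order dividing \<open>|\<Gamma>|\<close>\<close>
  let ?R = "{z :: 'k. poly (monom 1 ?n - 1) z = 0}"
  have "coeff (monom 1 ?n - 1 :: 'k poly) ?n = 1" using n by simp
  then have "(monom 1 ?n - 1 :: 'k poly) \<noteq> 0" by force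
  then have "finite ?R" by (rule poly_roots_finite)
  then have "finite (carrier \<Gamma> \<rightarrow>\<^sub>E ?R)" using assms by (intro finite_PiE)
  moreover have "linear_characters \<Gamma> \<subseteq> carrier \<Gamma> \<rightarrow>\<^sub>E ?R"
  proof
    fix \<Phi> :: "'x \<Rightarrow> 'k" assume \<Phi>: "\<Phi> \<in> linear_characters \<Gamma>"
    note D = linear_charactersD[OF \<open>group \<Gamma>\<close> \<Phi>]
    have pow: "\<Phi> (x [^]\<^bsub>\<Gamma>\<^esub> k) = \<Phi> x ^ k" if "x \<in> carrier \<Gamma>" for x and k :: nat
      using that by (induction k) (simp_all add: D(2,3) mult.commute)
    have "\<Phi> x \<in> ?R" if "x \<in> carrier \<Gamma>" for x
      using pow[OF that, of ?n] pow_order_eq_1[OF that] D(3) by (simp add: poly_monom)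
    then show "\<Phi> \<in> carrier \<Gamma> \<rightarrow>\<^sub>E ?R" using D(5) by (auto simp: PiE_def)
  qed
  ultimately show ?thesis by (rule finite_subset[rotated])
qed

lemma trivial_linear_character:
  assumes "group \<Gamma>"
  shows "(\<lambda>x\<in>carrier \<Gamma>. 1) \<in> linear_characters \<Gamma>"
proof -
  interpret group \<Gamma> by fact
  show ?thesis by (rule linear_charactersI) auto
qed

lemma linear_characters_mult:
  assumes "group \<Gamma>" "\<Phi> \<in> linear_characters \<Gamma>" "\<Psi> \<in> linear_characters \<Gamma>"
  shows "(\<lambda>x\<in>carrier \<Gamma>. \<Phi> x * \<Psi> x) \<in> linear_characters \<Gamma>"
proof -
  interpret group \<Gamma> by fact
  note [simp] = linear_charactersD(1,2)[OF assms(1,2)] linear_charactersD(1,2)[OF assms(1,3)]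
  show ?thesis by (rule linear_charactersI) auto
qed

lemma linear_characters_inverse:
  assumes "group \<Gamma>" "\<Phi> \<in> linear_characters \<Gamma>"
  shows "(\<lambda>x\<in>carrier \<Gamma>. inverse (\<Phi> x)) \<in> linear_characters \<Gamma>"
proof -
  interpret group \<Gamma> by fact
  note [simp] = linear_charactersD(1,2)[OF assms(1,2)]
  show ?thesis by (rule linear_charactersI) auto
qed

text \<open>
  The group acts on its group algebra \<open>K\<Gamma>\<close>, and the character is found on a minimal invariant subspace
  \<open>W\<close> of \<open>(1 - \<gamma>) K\<Gamma>\<close>. If \<open>\<gamma>\<close> fixed some \<open>w = v - \<gamma>v \<noteq> 0\<close> in \<open>W\<close>, then \<open>\<gamma>\<^sup>k v = v - kw\<close> for all \<open>k\<close>; for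
  \<open>k = |\<Gamma>|\<close> this gives \<open>|\<Gamma>| w = 0\<close>, which is impossible in characteristic zero.
\<close>

lemma exists_linear_character_nontrivial:
  fixes \<Gamma> :: "('x, 'm) monoid_scheme"
  assumes "comm_group \<Gamma>" and fin: "finite (carrier \<Gamma>)"
    and split: "splitting_field TYPE('k::field_char_0) \<Gamma>"
    and \<gamma>: "\<gamma> \<in> carrier \<Gamma>" "\<gamma> \<noteq> \<one>\<^bsub>\<Gamma>\<^esub>"
  obtains \<Phi> :: "'x \<Rightarrow> 'k::field_char_0" where "\<Phi> \<in> linear_characters \<Gamma>" and "\<Phi> \<gamma> \<noteq> 1"
proof -
  interpret G: comm_group \<Gamma> by fact
  \<comment> \<open>the identity off the group, so that \<open>f \<delta>\<close> is injective on the whole type and can be used to reindex\<close>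
  define f where "f \<delta> x = (if x \<in> carrier \<Gamma> then inv\<^bsub>\<Gamma>\<^esub> \<delta> \<otimes>\<^bsub>\<Gamma>\<^esub> x else x)" for \<delta> x
  have f_inj: "inj (f \<delta>)" if "\<delta> \<in> carrier \<Gamma>" for \<delta>
    using that G.l_cancel G.m_closed G.inv_closed by (auto simp: f_def inj_def)
  have f_mult: "f (\<delta> \<otimes>\<^bsub>\<Gamma>\<^esub> \<epsilon>) x = f \<epsilon> (f \<delta> x)" if "\<delta> \<in> carrier \<Gamma>" "\<epsilon> \<in> carrier \<Gamma>" for \<delta> \<epsilon> x
    using that by (simp add: f_def G.inv_mult_group G.m_assoc)
  define T :: "'x \<Rightarrow> ('x \<Rightarrow>\<^sub>0 'k) \<Rightarrow> ('x \<Rightarrow>\<^sub>0 'k)" where "T \<delta> = Poly_Mapping.map_key (f \<delta>)" for \<delta>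
  have lookup_T: "Poly_Mapping.lookup (T \<delta> v) x = Poly_Mapping.lookup v (f \<delta> x)"
    if "\<delta> \<in> carrier \<Gamma>" for \<delta> v x
    by (simp add: T_def map_key.rep_eq[OF f_inj[OF that]])
  have T_add: "T \<delta> (v + w) = T \<delta> v + T \<delta> w" if "\<delta> \<in> carrier \<Gamma>" for \<delta> v w
    using that by (intro poly_mapping_eqI) (simp add: lookup_T lookup_add)
  have T_minus: "T \<delta> (v - w) = T \<delta> v - T \<delta> w" if "\<delta> \<in> carrier \<Gamma>" for \<delta> v w
    using that by (intro poly_mapping_eqI) (simp add: lookup_T lookup_minus)
  have T_scale: "T \<delta> (pm_scale c v) = pm_scale c (T \<delta> v)" if "\<delta> \<in> carrier \<Gamma>" for \<delta> c v
    using that by (intro poly_mapping_eqI) (simp add: lookup_T)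
  have T_mult: "T (\<delta> \<otimes>\<^bsub>\<Gamma>\<^esub> \<epsilon>) v = T \<delta> (T \<epsilon> v)" if "\<delta> \<in> carrier \<Gamma>" "\<epsilon> \<in> carrier \<Gamma>" for \<delta> \<epsilon> v
    using that by (intro poly_mapping_eqI) (simp add: lookup_T f_mult)
  have T_one: "T \<one>\<^bsub>\<Gamma>\<^esub> v = v" for v
    by (intro poly_mapping_eqI) (simp add: lookup_T f_def)
  have T_comm: "T \<delta> (T \<epsilon> v) = T \<epsilon> (T \<delta> v)" if "\<delta> \<in> carrier \<Gamma>" "\<epsilon> \<in> carrier \<Gamma>" for \<delta> \<epsilon> v
    using that by (simp add: G.m_comm flip: T_mult)
  \<comment> \<open>\<open>1 - \<gamma>\<close>, with image \<open>D ` E\<close> on the group algebra \<open>E\<close>\<close>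
  define D where "D v = v - T \<gamma> v" for v
  have D_add: "D (v + w) = D v + D w" for v w using \<gamma> by (simp add: D_def T_add)
  have D_scale: "D (pm_scale c v) = pm_scale c (D v)" for c v
    using \<gamma> by (simp add: D_def T_scale pm.scale_right_diff_distrib)
  have D_T: "D (T \<delta> v) = T \<delta> (D v)" if "\<delta> \<in> carrier \<Gamma>" for \<delta> v
    using \<gamma> that by (simp add: D_def T_minus T_comm)
  define E :: "('x \<Rightarrow>\<^sub>0 'k) set" where "E = {v. Poly_Mapping.keys v \<subseteq> carrier \<Gamma>}"
  define S :: "('x \<Rightarrow>\<^sub>0 'k) set" where "S = (\<lambda>x. Poly_Mapping.single x 1) ` carrier \<Gamma>"
  have E_iff: "v \<in> E \<longleftrightarrow> (\<forall>x. x \<notin> carrier \<Gamma> \<longrightarrow> Poly_Mapping.lookup v x = 0)" for v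
    by (auto simp: E_def in_keys_iff)
  have subE: "pm.subspace E"
    by (rule pm.subspaceI) (auto simp: E_iff lookup_add)
  have E_T: "T \<delta> v \<in> E" if "v \<in> E" "\<delta> \<in> carrier \<Gamma>" for \<delta> v
    using that by (auto simp: E_iff lookup_T f_def)
  have E_span: "E \<subseteq> pm.span S"
  proof
    fix v assume "v \<in> E"
    have "v = (\<Sum>x\<in>Poly_Mapping.keys v. pm_scale (Poly_Mapping.lookup v x) (Poly_Mapping.single x 1))"
      by (intro poly_mapping_eqI) (simp add: lookup_sum lookup_single when_def in_keys_iff if_distrib[of "\<lambda>y. _ * y"] cong: if_cong)
    moreover have "\<dots> \<in> pm.span S"
      using \<open>v \<in> E\<close> by (intro pm.span_sum pm.span_scale pm.span_base) (auto simp: S_def E_def)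
    ultimately show "v \<in> pm.span S" by simp
  qed
  have subU: "pm.subspace (D ` E)"
  proof (rule pm.subspaceI)
    show "0 \<in> D ` E" using pm.subspace_0[OF subE] D_scale[of 0 0] by (force simp: image_iff)
  next
    fix v w assume "v \<in> D ` E" "w \<in> D ` E"
    then show "v + w \<in> D ` E" using pm.subspace_add[OF subE] by (auto simp: image_iff) (metis D_add)
  next
    fix c v assume "v \<in> D ` E"
    then show "pm_scale c v \<in> D ` E" using pm.subspace_scale[OF subE] by (auto simp: image_iff) (metis D_scale)
  qed
  have "D ` E \<subseteq> E"
    using E_T \<gamma> pm.subspace_diff[OF subE] by (auto simp: D_def)
  then have Uspan: "D ` E \<subseteq> pm.span S" using E_span by blast
  have finS: "finite S" using fin by (simp add: S_def)
  have neU: "D ` E \<noteq> {0}"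
  proof -
    let ?e = "Poly_Mapping.single \<one>\<^bsub>\<Gamma>\<^esub> (1 :: 'k)"
    have "\<one>\<^bsub>\<Gamma>\<^esub> \<noteq> inv\<^bsub>\<Gamma>\<^esub> \<gamma>" using \<gamma> by (metis G.inv_inv G.inv_one)
    then have "Poly_Mapping.lookup (D ?e) \<one>\<^bsub>\<Gamma>\<^esub> = 1"
      using \<gamma>(1) by (simp add: D_def lookup_minus lookup_T f_def lookup_single when_def)
    moreover have "?e \<in> E" by (auto simp: E_iff lookup_single when_def)
    ultimately have "D ?e \<noteq> 0" "?e \<in> E" by auto
    then show ?thesis by blast
  qed
  have "\<forall>\<delta>\<in>carrier \<Gamma>. \<forall>v\<in>D ` E. T \<delta> v \<in> D ` E"
    using E_T by (auto simp: image_iff) (metis D_T)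
  then obtain W where W: "pm.subspace W" "W \<subseteq> D ` E" "W \<noteq> {0}"
      "\<forall>\<delta>\<in>carrier \<Gamma>. \<forall>v\<in>W. T \<delta> v \<in> W"
    and W_min: "\<And>W'. \<lbrakk>pm.subspace W'; W' \<subseteq> W; \<forall>\<delta>\<in>carrier \<Gamma>. \<forall>v\<in>W'. T \<delta> v \<in> W'; W' \<noteq> {0}\<rbrakk> \<Longrightarrow> W' = W"
    by (rule pm.minimal_subspace_exists[OF finS subU Uspan neU, where P = "\<lambda>W. \<forall>\<delta>\<in>carrier \<Gamma>. \<forall>v\<in>W. T \<delta> v \<in> W"]) blast
  obtain \<Phi> where \<Phi>: "\<Phi> \<in> hom \<Gamma> (units_of (class_ring :: 'k ring))"
    and T\<Phi>: "\<And>\<delta> w. \<lbrakk>\<delta> \<in> carrier \<Gamma>; w \<in> W\<rbrakk> \<Longrightarrow> T \<delta> w = pm_scale (\<Phi> \<delta>) w"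
  proof (rule pm.linear_character_on_irreducible_subspace[OF \<open>comm_group \<Gamma>\<close> split, of T W S])
    show "finite S" by (rule finS)
    show "W \<subseteq> pm.span S" using W(2) Uspan by blast
  qed (use W W_min T_add T_scale T_mult T_one in auto)
  have "\<Phi> \<gamma> \<noteq> 1"
  proof
    assume \<Phi>1: "\<Phi> \<gamma> = 1"
    obtain w where w: "w \<in> W" "w \<noteq> 0" using W(1,3) pm.subspace_0 by blast
    then obtain v where v: "w = D v" using W(2) by blast
    have Tw: "T \<gamma> w = w" using T\<Phi>[OF \<gamma>(1) w(1)] \<Phi>1 by simp
    have "T (\<gamma> [^]\<^bsub>\<Gamma>\<^esub> k) v = v - pm_scale (of_nat k) w" for k :: nat
    proof (induction k)
      case 0
      show ?case by (simp add: T_one)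
    next
      case (Suc k)
      have "T (\<gamma> [^]\<^bsub>\<Gamma>\<^esub> Suc k) v = T \<gamma> (T (\<gamma> [^]\<^bsub>\<Gamma>\<^esub> k) v)"
        using \<gamma> by (simp add: T_mult T_comm)
      also have "\<dots> = T \<gamma> v - pm_scale (of_nat k) w"
        using \<gamma> Tw by (simp add: Suc.IH T_minus T_scale)
      also have "T \<gamma> v = v - w" by (simp add: v D_def)
      finally show ?case by (simp add: pm.scale_left_distrib)
    qed
    from this[of "Coset.order \<Gamma>"] have "pm_scale (of_nat (Coset.order \<Gamma>)) w = 0"
      using \<gamma> by (simp add: G.pow_order_eq_1 T_one)
    then show False
      using w(2) fin G.one_closed by (auto simp: Coset.order_def card_eq_0_iff)
  qed
  moreover have "restrict \<Phi> (carrier \<Gamma>) \<in> linear_characters \<Gamma>"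
    using \<Phi> by (intro linear_charactersI) (auto simp: hom_def units_of_def Units_class_ring)
  ultimately show ?thesis using that[of "restrict \<Phi> (carrier \<Gamma>)"] \<gamma> by simp
qed

text \<open>
  Multiplication by a character \<open>\<Psi>\<close> with \<open>\<Psi> \<gamma> \<noteq> 1\<close> permutes the characters, so the sum equals \<open>\<Psi> \<gamma>\<close> times
  itself.
\<close>

lemma sum_linear_characters_eq_0:
  fixes \<Gamma> :: "('x, 'm) monoid_scheme"
  assumes "comm_group \<Gamma>" and fin: "finite (carrier \<Gamma>)"
    and "splitting_field TYPE('k::field_char_0) \<Gamma>"
    and \<gamma>: "\<gamma> \<in> carrier \<Gamma>" "\<gamma> \<noteq> \<one>\<^bsub>\<Gamma>\<^esub>"
  shows "(\<Sum>\<Phi>\<in>linear_characters \<Gamma>. \<Phi> \<gamma> :: 'k) = 0"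
proof -
  interpret comm_group \<Gamma> by fact
  let ?L = "linear_characters \<Gamma> :: ('x \<Rightarrow> 'k) set"
  obtain \<Psi> where \<Psi>: "\<Psi> \<in> ?L" "\<Psi> \<gamma> \<noteq> 1"
    using exists_linear_character_nontrivial[OF assms] .
  note nz = linear_charactersD(1)[OF is_group \<Psi>(1)]
  have ext_eq: "\<Phi> = \<Phi>'" if "\<Phi> \<in> ?L" "\<Phi>' \<in> ?L" "\<And>x. x \<in> carrier \<Gamma> \<Longrightarrow> \<Phi> x = \<Phi>' x" for \<Phi> \<Phi>'
    using that by (auto simp: linear_characters_def intro: extensionalityI)
  let ?m = "\<lambda>\<Psi> \<Phi>. \<lambda>x\<in>carrier \<Gamma>. \<Psi> x * \<Phi> x :: 'k"
  let ?i = "\<lambda>x\<in>carrier \<Gamma>. inverse (\<Psi> x)"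
  have "(\<Sum>\<Phi>\<in>?L. \<Phi> \<gamma>) = (\<Sum>\<Phi>\<in>?L. ?m \<Psi> \<Phi> \<gamma>)"
  proof (rule sum.reindex_bij_witness[of _ "?m \<Psi>" "?m ?i"])
    fix \<Phi> assume \<Phi>: "\<Phi> \<in> ?L"
    show m1: "?m \<Psi> \<Phi> \<in> ?L" and m2: "?m ?i \<Phi> \<in> ?L"
      by (intro linear_characters_mult linear_characters_inverse is_group \<Phi> \<Psi>)+
    show "?m \<Psi> (?m ?i \<Phi>) = \<Phi>"
      by (rule ext_eq[OF linear_characters_mult[OF is_group \<Psi>(1) m2] \<Phi>]) (use nz in simp)
    show "?m ?i (?m \<Psi> \<Phi>) = \<Phi>"
      by (rule ext_eq[OF linear_characters_mult[OF is_group linear_characters_inverse[OF is_group \<Psi>(1)] m1] \<Phi>])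
         (use nz in simp)
    show "?m \<Psi> (?m ?i \<Phi>) \<gamma> = \<Phi> \<gamma>" using nz \<gamma> by simp
  qed
  also have "\<dots> = \<Psi> \<gamma> * (\<Sum>\<Phi>\<in>?L. \<Phi> \<gamma>)"
    using \<gamma> by (simp add: sum_distrib_left)
  finally show ?thesis using \<Psi>(2) by (simp add: field_simps)
qed

text \<open>
  Fourier inversion on the group algebra: summing \<open>\<Phi>(f) \<Phi>(\<gamma>\<^sup>-\<^sup>1)\<close> over all characters \<open>\<Phi>\<close> gives \<open>f \<gamma>\<close> times the
  number of characters.
\<close>

lemma linear_characters_separate:
  fixes \<Gamma> :: "('x, 'm) monoid_scheme" and f :: "'x \<Rightarrow> 'k::field_char_0"
  assumes "comm_group \<Gamma>" and fin: "finite (carrier \<Gamma>)"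
    and split: "splitting_field TYPE('k) \<Gamma>"
    and 0: "\<And>\<Phi>. \<Phi> \<in> linear_characters \<Gamma> \<Longrightarrow> (\<Sum>x\<in>carrier \<Gamma>. f x * \<Phi> x) = 0"
    and \<gamma>: "\<gamma> \<in> carrier \<Gamma>"
  shows "f \<gamma> = 0"
proof -
  interpret comm_group \<Gamma> by fact
  let ?L = "linear_characters \<Gamma> :: ('x \<Rightarrow> 'k) set"
  have "0 = (\<Sum>\<Phi>\<in>?L. (\<Sum>x\<in>carrier \<Gamma>. f x * \<Phi> x) * \<Phi> (inv\<^bsub>\<Gamma>\<^esub> \<gamma>))"
    using 0 by simp
  also have "\<dots> = (\<Sum>\<Phi>\<in>?L. \<Sum>x\<in>carrier \<Gamma>. f x * \<Phi> (x \<otimes>\<^bsub>\<Gamma>\<^esub> inv\<^bsub>\<Gamma>\<^esub> \<gamma>))"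
    using \<gamma> by (simp add: sum_distrib_right linear_charactersD(2)[OF is_group] mult.assoc)
  also have "\<dots> = (\<Sum>x\<in>carrier \<Gamma>. f x * (\<Sum>\<Phi>\<in>?L. \<Phi> (x \<otimes>\<^bsub>\<Gamma>\<^esub> inv\<^bsub>\<Gamma>\<^esub> \<gamma>)))"
    by (subst sum.swap) (simp add: sum_distrib_left)
  also have "\<dots> = (\<Sum>x\<in>carrier \<Gamma>. if x = \<gamma> then f x * of_nat (card ?L) else 0)"
  proof (rule sum.cong[OF refl])
    fix x assume x: "x \<in> carrier \<Gamma>"
    show "f x * (\<Sum>\<Phi>\<in>?L. \<Phi> (x \<otimes>\<^bsub>\<Gamma>\<^esub> inv\<^bsub>\<Gamma>\<^esub> \<gamma>)) = (if x = \<gamma> then f x * of_nat (card ?L) else 0)"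
    proof (cases "x = \<gamma>")
      case True
      then show ?thesis using \<gamma> by (simp add: linear_charactersD(3)[OF is_group])
    next
      case False
      then have "x \<otimes>\<^bsub>\<Gamma>\<^esub> inv\<^bsub>\<Gamma>\<^esub> \<gamma> \<noteq> \<one>\<^bsub>\<Gamma>\<^esub>"
        using x \<gamma> by (metis inv_solve_right l_one one_closed)
      then show ?thesis
        using False x \<gamma> sum_linear_characters_eq_0[OF \<open>comm_group \<Gamma>\<close> fin split] by simp
    qed
  qed
  also have "\<dots> = f \<gamma> * of_nat (card ?L)" using \<gamma> fin by simp
  finally show ?thesis
    using finite_linear_characters[OF is_group fin] trivial_linear_character[OF is_group]
    by (auto simp: card_eq_0_iff)
qed

text \<open>
  If \<open>\<Psi> g \<noteq> \<Phi> g\<close>, the substitution \<open>x \<mapsto> gx\<close> multiplies the sum by \<open>\<Phi> g / \<Psi> g \<noteq> 1\<close>.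
\<close>

lemma linear_characters_orthogonal:
  fixes \<Gamma> :: "('x, 'm) monoid_scheme" and \<Phi> :: "'x \<Rightarrow> 'k::field"
  assumes "group \<Gamma>" and fin: "finite (carrier \<Gamma>)"
    and \<Phi>: "\<Phi> \<in> linear_characters \<Gamma>" and \<Psi>: "\<Psi> \<in> linear_characters \<Gamma>"
  shows "(\<Sum>x\<in>carrier \<Gamma>. \<Psi> (inv\<^bsub>\<Gamma>\<^esub> x) * \<Phi> x) = (if \<Psi> = \<Phi> then of_nat (Coset.order \<Gamma>) else 0)"
proof -
  interpret group \<Gamma> by fact
  note \<Phi>D = linear_charactersD[OF is_group \<Phi>] and \<Psi>D = linear_charactersD[OF is_group \<Psi>]
  show ?thesis
  proof (cases "\<Psi> = \<Phi>")
    case True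
    then show ?thesis by (simp add: \<Phi>D Coset.order_def)
  next
    case False
    then obtain g where g: "g \<in> carrier \<Gamma>" "\<Psi> g \<noteq> \<Phi> g"
      using \<Phi>D(5) \<Psi>D(5) by (meson extensionalityI)
    let ?h = "\<lambda>x. \<Psi> (inv\<^bsub>\<Gamma>\<^esub> x) * \<Phi> x"
    have "(\<Sum>x\<in>carrier \<Gamma>. ?h x) = (\<Sum>x\<in>carrier \<Gamma>. ?h (g \<otimes>\<^bsub>\<Gamma>\<^esub> x))"
      by (rule sum.reindex_bij_witness[of _ "\<lambda>x. g \<otimes>\<^bsub>\<Gamma>\<^esub> x" "\<lambda>x. inv\<^bsub>\<Gamma>\<^esub> g \<otimes>\<^bsub>\<Gamma>\<^esub> x"])
         (use g in \<open>auto simp flip: m_assoc\<close>)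
    also have "\<dots> = \<Phi> g / \<Psi> g * (\<Sum>x\<in>carrier \<Gamma>. ?h x)"
      unfolding sum_distrib_left
      by (rule sum.cong) (use g in \<open>auto simp: \<Phi>D \<Psi>D field_simps\<close>)
    finally show ?thesis using False g \<Psi>D(1)[OF g(1)] by (auto simp: field_simps)
  qed
qed

text \<open>
  By orthogonality the element of the group algebra with coefficients
  \<open>c x = (1/|\<Gamma>|) \<Sum>\<^sub>\<Psi> a \<Psi> \<Psi>(x\<^sup>-\<^sup>1)\<close> takes the prescribed value \<open>a \<Phi>\<close> at every character \<open>\<Phi>\<close>.
\<close>

lemma linear_characters_interpolate:
  fixes \<Gamma> :: "('x, 'm) monoid_scheme" and a :: "('x \<Rightarrow> 'k::field_char_0) \<Rightarrow> 'k"
  assumes "group \<Gamma>" and fin: "finite (carrier \<Gamma>)"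
  obtains c where "\<And>\<Phi>. \<Phi> \<in> linear_characters \<Gamma> \<Longrightarrow> (\<Sum>x\<in>carrier \<Gamma>. c x * \<Phi> x) = a \<Phi>"
proof
  interpret group \<Gamma> by fact
  let ?L = "linear_characters \<Gamma> :: ('x \<Rightarrow> 'k) set"
  have finL: "finite ?L" by (rule finite_linear_characters[OF is_group fin])
  fix \<Phi> assume \<Phi>: "\<Phi> \<in> ?L"
  have "(\<Sum>x\<in>carrier \<Gamma>. (\<Sum>\<Psi>\<in>?L. a \<Psi> * \<Psi> (inv\<^bsub>\<Gamma>\<^esub> x)) / of_nat (Coset.order \<Gamma>) * \<Phi> x)
      = (\<Sum>x\<in>carrier \<Gamma>. \<Sum>\<Psi>\<in>?L. a \<Psi> / of_nat (Coset.order \<Gamma>) * (\<Psi> (inv\<^bsub>\<Gamma>\<^esub> x) * \<Phi> x))"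
    by (simp add: sum_distrib_left sum_distrib_right sum_divide_distrib mult_ac)
  also have "\<dots> = (\<Sum>\<Psi>\<in>?L. a \<Psi> / of_nat (Coset.order \<Gamma>) * (\<Sum>x\<in>carrier \<Gamma>. \<Psi> (inv\<^bsub>\<Gamma>\<^esub> x) * \<Phi> x))"
    by (subst sum.swap) (simp add: sum_distrib_left)
  also have "\<dots> = (\<Sum>\<Psi>\<in>?L. if \<Psi> = \<Phi> then a \<Psi> else 0)"
    using fin order_gt_0_iff_finite
    by (intro sum.cong) (auto simp: linear_characters_orthogonal[OF is_group fin \<Phi>])
  also have "\<dots> = a \<Phi>"
    using \<Phi> finL by simp
  finally show "(\<Sum>x\<in>carrier \<Gamma>. (\<Sum>\<Psi>\<in>?L. a \<Psi> * \<Psi> (inv\<^bsub>\<Gamma>\<^esub> x)) / of_nat (Coset.order \<Gamma>) * \<Phi> x) = a \<Phi>" .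
qed

section \<open>Conjugation of subgroups and of their characters\<close>

context group
begin

lemma conj_set_image:
  assumes "g \<in> carrier G" "U \<subseteq> carrier G"
  shows "conj_set G g U = (\<lambda>u. g \<otimes> u \<otimes> inv g) ` U"
  by (auto simp: conj_set_def l_coset_def r_coset_def)

lemma mem_conj_set:
  assumes g: "g \<in> carrier G" and U: "U \<subseteq> carrier G"
  shows "x \<in> conj_set G g U \<longleftrightarrow> x \<in> carrier G \<and> inv g \<otimes> x \<otimes> g \<in> U"
proof
  assume "x \<in> conj_set G g U"
  then obtain u where u: "u \<in> U" "x = g \<otimes> u \<otimes> inv g" using assms by (auto simp: conj_set_image)
  have uc: "u \<in> carrier G" using u U by blast
  have "inv g \<otimes> x \<otimes> g = (inv g \<otimes> g) \<otimes> u \<otimes> (inv g \<otimes> g)"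
    unfolding u(2) using g uc by (simp only: m_assoc m_closed inv_closed)
  then show "x \<in> carrier G \<and> inv g \<otimes> x \<otimes> g \<in> U" using u g uc by simp
next
  assume x: "x \<in> carrier G \<and> inv g \<otimes> x \<otimes> g \<in> U"
  then have "g \<otimes> (inv g \<otimes> x \<otimes> g) \<otimes> inv g = (g \<otimes> inv g) \<otimes> x \<otimes> (g \<otimes> inv g)"
    using g by (simp only: m_assoc m_closed inv_closed)
  then have "x = g \<otimes> (inv g \<otimes> x \<otimes> g) \<otimes> inv g" using x g by simp
  then show "x \<in> conj_set G g U" using x assms by (auto simp: conj_set_image)
qed

lemma conj_set_subset: "\<lbrakk>g \<in> carrier G; U \<subseteq> carrier G\<rbrakk> \<Longrightarrow> conj_set G g U \<subseteq> carrier G"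
  by (auto simp: mem_conj_set)

lemma conj_set_mult:
  assumes "g \<in> carrier G" "h \<in> carrier G" "U \<subseteq> carrier G"
  shows "conj_set G g (conj_set G h U) = conj_set G (g \<otimes> h) U"
  using assms by (auto simp: mem_conj_set conj_set_subset inv_mult_group m_assoc)

lemma conj_set_one: "U \<subseteq> carrier G \<Longrightarrow> conj_set G \<one> U = U"
  by (auto simp: mem_conj_set subset_iff)

lemma conj_set_self: 
  assumes "subgroup U G" "u \<in> U"
  shows "conj_set G u U = U"
proof -
  have U: "U \<subseteq> carrier G" using assms(1) by (rule subgroup.subset)
  have u: "u \<in> carrier G" using U assms(2) by blast
  have "inv u \<otimes> x \<otimes> u \<in> U \<longleftrightarrow> x \<in> U" if x: "x \<in> carrier G" for x
  proof
    assume "x \<in> U"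
    then show "inv u \<otimes> x \<otimes> u \<in> U"
      using assms by (simp add: subgroup.m_closed subgroup.m_inv_closed)
  next
    assume "inv u \<otimes> x \<otimes> u \<in> U"
    then have "u \<otimes> (inv u \<otimes> x \<otimes> u) \<otimes> inv u \<in> U"
      using assms by (simp add: subgroup.m_closed subgroup.m_inv_closed)
    moreover have "u \<otimes> (inv u \<otimes> x \<otimes> u) \<otimes> inv u = (u \<otimes> inv u) \<otimes> x \<otimes> (u \<otimes> inv u)"
      using u x by (simp only: m_assoc m_closed inv_closed)
    ultimately show "x \<in> U" using u x by simp
  qed
  then show ?thesis using u U by (auto simp: mem_conj_set subset_iff)
qed

lemma subgroup_conj_set:
  assumes "subgroup U G" "g \<in> carrier G"
  shows "subgroup (conj_set G g U) G"
proof -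
  have U: "U \<subseteq> carrier G" using assms(1) by (rule subgroup.subset)
  show ?thesis
  proof (rule subgroupI)
    show "conj_set G g U \<subseteq> carrier G" using U assms by (simp add: conj_set_subset)
    have "g \<otimes> \<one> \<otimes> inv g \<in> conj_set G g U"
      using U assms subgroup.one_closed[OF assms(1)] by (simp only: conj_set_image image_eqI)
    then show "conj_set G g U \<noteq> {}" by blast
  next
    fix a assume "a \<in> conj_set G g U"
    then have a: "a \<in> carrier G" "inv g \<otimes> a \<otimes> g \<in> U" using U assms by (auto simp: mem_conj_set)
    have "inv g \<otimes> inv a \<otimes> g = inv (inv g \<otimes> a \<otimes> g)"
      using a assms by (simp add: inv_mult_group m_assoc)
    then show "inv a \<in> conj_set G g U"
      using a U assms by (simp add: mem_conj_set subgroup.m_inv_closed)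
  next
    fix a b assume "a \<in> conj_set G g U" "b \<in> conj_set G g U"
    then have ab: "a \<in> carrier G" "inv g \<otimes> a \<otimes> g \<in> U" "b \<in> carrier G" "inv g \<otimes> b \<otimes> g \<in> U"
      using U assms by (auto simp: mem_conj_set)
    have "inv g \<otimes> (a \<otimes> b) \<otimes> g = (inv g \<otimes> a \<otimes> g) \<otimes> (inv g \<otimes> b \<otimes> g)"
      using ab assms by (simp add: m_assoc inv_solve_left' flip: m_assoc[of g "inv g"])
    then show "a \<otimes> b \<in> conj_set G g U"
      using ab U assms by (simp add: mem_conj_set subgroup.m_closed)
  qed
qed

lemma card_conj_set:
  assumes "g \<in> carrier G" "U \<subseteq> carrier G"
  shows "card (conj_set G g U) = card U"
proof -
  have "inj_on (\<lambda>u. g \<otimes> u \<otimes> inv g) U"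
    using assms by (auto simp: inj_on_def subset_iff)
  then show ?thesis using assms by (simp add: conj_set_image card_image)
qed

lemma mem_char_group:
  "\<phi> \<in> carrier (char_group G A U) \<longleftrightarrow>
     (\<forall>x\<in>U. \<phi> x \<in> carrier A) \<and> (\<forall>x\<in>U. \<forall>y\<in>U. \<phi> (x \<otimes> y) = \<phi> x \<otimes>\<^bsub>A\<^esub> \<phi> y) \<and> \<phi> \<in> extensional U"
  by (auto simp: char_group_def hom_def)

lemma char_group_simps:
  "x \<in> U \<Longrightarrow> (\<phi> \<otimes>\<^bsub>char_group G A U\<^esub> \<psi>) x = \<phi> x \<otimes>\<^bsub>A\<^esub> \<psi> x"
  "x \<in> U \<Longrightarrow> \<one>\<^bsub>char_group G A U\<^esub> x = \<one>\<^bsub>A\<^esub>"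
  by (simp_all add: char_group_def)

lemma char_group_ext:
  assumes "\<phi> \<in> carrier (char_group G A U)" "\<psi> \<in> carrier (char_group G A U)"
    and "\<And>x. x \<in> U \<Longrightarrow> \<phi> x = \<psi> x"
  shows "\<phi> = \<psi>"
  using assms by (auto simp: char_group_def intro: extensionalityI)

lemma comm_group_char_group:
  assumes "comm_group A" and U: "subgroup U G"
  shows "comm_group (char_group G A U)"
proof -
  interpret A: comm_group A by fact
  note cl = subgroup.m_closed[OF U]
  have mult: "\<phi> \<otimes>\<^bsub>char_group G A U\<^esub> \<psi> \<in> carrier (char_group G A U)"
    if "\<phi> \<in> carrier (char_group G A U)" "\<psi> \<in> carrier (char_group G A U)" for \<phi> \<psi>
    using that unfolding mem_char_group
    by (auto simp: char_group_simps cl A.m_ac) (auto simp: char_group_def)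
  have one: "\<one>\<^bsub>char_group G A U\<^esub> \<in> carrier (char_group G A U)"
    unfolding mem_char_group by (auto simp: char_group_simps cl) (auto simp: char_group_def)
  show ?thesis
  proof (rule comm_groupI)
    show "\<phi> \<otimes>\<^bsub>char_group G A U\<^esub> \<psi> \<in> carrier (char_group G A U)"
      if "\<phi> \<in> carrier (char_group G A U)" "\<psi> \<in> carrier (char_group G A U)" for \<phi> \<psi>
      using mult that .
    show "\<one>\<^bsub>char_group G A U\<^esub> \<in> carrier (char_group G A U)" by (rule one)
  next
    fix \<phi> \<psi> \<chi>
    assume *: "\<phi> \<in> carrier (char_group G A U)" "\<psi> \<in> carrier (char_group G A U)" "\<chi> \<in> carrier (char_group G A U)"
    show "\<phi> \<otimes>\<^bsub>char_group G A U\<^esub> \<psi> \<otimes>\<^bsub>char_group G A U\<^esub> \<chi> =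
        \<phi> \<otimes>\<^bsub>char_group G A U\<^esub> (\<psi> \<otimes>\<^bsub>char_group G A U\<^esub> \<chi>)"
      by (rule char_group_ext[OF mult[OF mult[OF *(1,2)] *(3)] mult[OF *(1) mult[OF *(2,3)]]])
         (use * in \<open>simp add: char_group_simps mem_char_group A.m_assoc\<close>)
  next
    fix \<phi> \<psi>
    assume *: "\<phi> \<in> carrier (char_group G A U)" "\<psi> \<in> carrier (char_group G A U)"
    show "\<phi> \<otimes>\<^bsub>char_group G A U\<^esub> \<psi> = \<psi> \<otimes>\<^bsub>char_group G A U\<^esub> \<phi>"
      by (rule char_group_ext[OF mult[OF *] mult[OF *(2,1)]])
         (use * in \<open>simp add: char_group_simps mem_char_group A.m_comm\<close>)
  next
    fix \<phi> assume *: "\<phi> \<in> carrier (char_group G A U)"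
    show "\<one>\<^bsub>char_group G A U\<^esub> \<otimes>\<^bsub>char_group G A U\<^esub> \<phi> = \<phi>"
      by (rule char_group_ext[OF mult[OF one *] *])
         (use * in \<open>simp add: char_group_simps mem_char_group\<close>)
    let ?\<psi> = "\<lambda>x\<in>U. inv\<^bsub>A\<^esub> \<phi> x"
    have \<psi>: "?\<psi> \<in> carrier (char_group G A U)"
      using * by (auto simp: mem_char_group cl A.inv_mult)
    moreover have "?\<psi> \<otimes>\<^bsub>char_group G A U\<^esub> \<phi> = \<one>\<^bsub>char_group G A U\<^esub>"
      by (rule char_group_ext[where A = A and U = U, OF mult[OF \<psi> *] one])
         (use * in \<open>simp add: char_group_simps mem_char_group\<close>)
    ultimately show "\<exists>\<psi>\<in>carrier (char_group G A U). \<psi> \<otimes>\<^bsub>char_group G A U\<^esub> \<phi> = \<one>\<^bsub>char_group G A U\<^esub>"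
      by blast
  qed
qed

lemma restrict_mem_char_group:
  assumes "\<phi> \<in> carrier (char_group G A U)" "subgroup W G" "W \<subseteq> U"
  shows "restrict \<phi> W \<in> carrier (char_group G A W)"
  using assms subgroup.m_closed[OF assms(2)] by (auto simp: mem_char_group subset_iff)

lemma conj_char_apply:
  "x \<in> conj_set G g U \<Longrightarrow> conj_char G g U \<phi> x = \<phi> (inv g \<otimes> x \<otimes> g)"
  by (simp add: conj_char_def)

lemma conj_char_extensional: "conj_char G g U \<phi> \<in> extensional (conj_set G g U)"
  by (simp add: conj_char_def)

lemma inv_conj_mult:
  assumes "g \<in> carrier G" "x \<in> carrier G" "y \<in> carrier G"
  shows "inv g \<otimes> (x \<otimes> y) \<otimes> g = (inv g \<otimes> x \<otimes> g) \<otimes> (inv g \<otimes> y \<otimes> g)"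
proof -
  have "(inv g \<otimes> x \<otimes> g) \<otimes> (inv g \<otimes> y \<otimes> g) = inv g \<otimes> x \<otimes> (g \<otimes> inv g) \<otimes> y \<otimes> g"
    using assms by (simp only: m_assoc m_closed inv_closed)
  then show ?thesis using assms by (simp add: m_assoc)
qed

lemma conj_char_mem:
  assumes U: "subgroup U G" and g: "g \<in> carrier G" and \<phi>: "\<phi> \<in> carrier (char_group G A U)"
  shows "conj_char G g U \<phi> \<in> carrier (char_group G A (conj_set G g U))"
proof -
  have Uc: "U \<subseteq> carrier G" using U by (rule subgroup.subset)
  note cl = subgroup.m_closed[OF subgroup_conj_set[OF U g]]
  show ?thesis
    using \<phi> cl by (auto simp: mem_char_group conj_char_apply conj_char_extensional mem_conj_set[OF g Uc] inv_conj_mult[OF g])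
qed

lemma conj_char_mult:
  assumes "U \<subseteq> carrier G" "g \<in> carrier G" "h \<in> carrier G"
  shows "conj_char G g (conj_set G h U) (conj_char G h U \<phi>) = conj_char G (g \<otimes> h) U \<phi>"
proof
  fix x
  show "conj_char G g (conj_set G h U) (conj_char G h U \<phi>) x = conj_char G (g \<otimes> h) U \<phi> x"
  proof (cases "x \<in> conj_set G (g \<otimes> h) U")
    case True
    then have "x \<in> conj_set G g (conj_set G h U)" using assms by (simp add: conj_set_mult)
    then show ?thesis
      using True assms
      by (simp add: conj_char_apply mem_conj_set conj_set_subset inv_mult_group m_assoc)
  next
    case False
    then show ?thesis using assms by (simp add: conj_char_def conj_set_mult)
  qed
qed

text \<open>
  The values lie in an abelian group, so \<open>\<phi>(u\<^sup>-\<^sup>1xu) = \<phi>(u)\<^sup>-\<^sup>1\<phi>(x)\<phi>(u) = \<phi>(x)\<close>. Consequently a subgroup acts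
  trivially on its own pairs, and chosen representatives do no harm.
\<close>

lemma conj_char_self:
  assumes "comm_group A" and U: "subgroup U G" and u: "u \<in> U" and \<phi>: "\<phi> \<in> carrier (char_group G A U)"
  shows "conj_char G u U \<phi> = \<phi>"
proof (rule char_group_ext[where A = A and U = U])
  interpret A: comm_group A by fact
  have Uc: "U \<subseteq> carrier G" using U by (rule subgroup.subset)
  have uc: "u \<in> carrier G" using Uc u by blast
  note cl = subgroup.m_closed[OF U] and icl = subgroup.m_inv_closed[OF U]
  show "conj_char G u U \<phi> \<in> carrier (char_group G A U)"
    using conj_char_mem[OF U uc \<phi>] conj_set_self[OF U u] by simp
  fix x assume x: "x \<in> U"
  have "conj_char G u U \<phi> x = \<phi> (inv u \<otimes> x \<otimes> u)"
    using x conj_set_self[OF U u] by (simp add: conj_char_apply)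
  also have "\<dots> = \<phi> (inv u) \<otimes>\<^bsub>A\<^esub> \<phi> x \<otimes>\<^bsub>A\<^esub> \<phi> u"
    using \<phi> x u cl icl by (simp add: mem_char_group)
  also have "\<dots> = \<phi> (inv u) \<otimes>\<^bsub>A\<^esub> \<phi> u \<otimes>\<^bsub>A\<^esub> \<phi> x"
    using \<phi> x u icl by (simp add: mem_char_group A.m_ac)
  also have "\<dots> = \<phi> (inv u \<otimes> u) \<otimes>\<^bsub>A\<^esub> \<phi> x"
    using \<phi> u icl by (simp add: mem_char_group)
  also have "\<dots> = \<phi> \<one> \<otimes>\<^bsub>A\<^esub> \<phi> x" using uc by simp
  also have "\<dots> = \<phi> (\<one> \<otimes> x)" using \<phi> x subgroup.one_closed[OF U] by (simp add: mem_char_group)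
  also have "\<dots> = \<phi> x" using x Uc by auto
  finally show "conj_char G u U \<phi> x = \<phi> x" .
qed (rule \<phi>)

lemma restrict_conj_char:
  assumes "V \<subseteq> U" "U \<subseteq> carrier G" "g \<in> carrier G"
  shows "conj_char G g V (restrict \<phi> V) = restrict (conj_char G g U \<phi>) (conj_set G g V)"
proof -
  have "conj_set G g V \<subseteq> conj_set G g U" using assms by (auto simp: mem_conj_set[OF _ order_trans])
  then show ?thesis using assms by (auto simp: conj_char_def fun_eq_iff mem_conj_set[OF _ order_trans])
qed

lemma conj_char_char_group_mult:
  assumes "subgroup U G" "g \<in> carrier G"
  shows "conj_char G g U (\<phi> \<otimes>\<^bsub>char_group G A U\<^esub> \<psi>) =
     conj_char G g U \<phi> \<otimes>\<^bsub>char_group G A (conj_set G g U)\<^esub> conj_char G g U \<psi>"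
  using assms subgroup.subset[OF assms(1)]
  by (auto simp: char_group_def conj_char_def fun_eq_iff mem_conj_set)

lemma double_coset_mem:
  assumes "U \<subseteq> carrier G" "V \<subseteq> carrier G" "g \<in> carrier G"
  shows "x \<in> (U #> g) <#> V \<longleftrightarrow> (\<exists>u\<in>U. \<exists>v\<in>V. x = u \<otimes> g \<otimes> v)"
  by (auto simp: r_coset_def set_mult_def)

end

section \<open>Sums over double cosets\<close>

context group
begin

lemma inv_mult_cancel:
  "\<lbrakk>x \<in> carrier G; y \<in> carrier G\<rbrakk> \<Longrightarrow> x \<otimes> (inv x \<otimes> y) = y"
  "\<lbrakk>x \<in> carrier G; y \<in> carrier G\<rbrakk> \<Longrightarrow> inv x \<otimes> (x \<otimes> y) = y"
  by (simp_all flip: m_assoc)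

text \<open>
  Rewriting to right-associated words without adjacent inverses, the normal form of the free group.
\<close>

lemmas group_normalize = m_assoc inv_mult_group inv_mult_cancel

lemma double_coset_eq:
  assumes U: "subgroup U G" and V: "subgroup V G" and g: "g \<in> carrier G" and x: "x \<in> (U #> g) <#> V"
  shows "(U #> x) <#> V = (U #> g) <#> V"
proof -
  have Uc: "U \<subseteq> carrier G" and Vc: "V \<subseteq> carrier G" using U V by (auto dest: subgroup.subset)
  obtain u v where uv: "u \<in> U" "v \<in> V" "x = u \<otimes> g \<otimes> v"
    using x Uc Vc g by (auto simp: double_coset_mem)
  have c: "u \<in> carrier G" "v \<in> carrier G" using uv Uc Vc by auto
  have xc: "x \<in> carrier G" using uv(3) c g by simp
  have "\<exists>u'\<in>U. \<exists>v'\<in>V. a \<otimes> x \<otimes> b = u' \<otimes> g \<otimes> v'" if "a \<in> U" "b \<in> V" for a b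
  proof (intro bexI)
    show "a \<otimes> u \<in> U" "v \<otimes> b \<in> V" using that uv U V by (auto simp: subgroup.m_closed)
    show "a \<otimes> x \<otimes> b = (a \<otimes> u) \<otimes> g \<otimes> (v \<otimes> b)"
      using that c g Uc Vc by (simp add: uv(3) m_assoc subset_iff)
  qed
  moreover have "\<exists>u'\<in>U. \<exists>v'\<in>V. a \<otimes> g \<otimes> b = u' \<otimes> x \<otimes> v'" if "a \<in> U" "b \<in> V" for a b
  proof (intro bexI)
    show "a \<otimes> inv u \<in> U" "inv v \<otimes> b \<in> V" using that uv U V by (auto simp: subgroup.m_closed subgroup.m_inv_closed)
    show "a \<otimes> g \<otimes> b = (a \<otimes> inv u) \<otimes> x \<otimes> (inv v \<otimes> b)"
      using that c g Uc Vc by (simp add: uv(3) group_normalize subset_iff)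
  qed
  ultimately show ?thesis
    using Uc Vc g xc by (auto simp: double_coset_mem set_eq_iff)
qed

text \<open>
  If \<open>x = u\<^sub>0gv\<^sub>0\<close>, then \<open>(u, v) \<mapsto> uu\<^sub>0\<^sup>-\<^sup>1\<close> identifies the factorizations \<open>x = ugv\<close> with \<open>U \<inter> xVx\<^sup>-\<^sup>1\<close>.
\<close>

lemma card_double_coset_fiber:
  assumes U: "subgroup U G" and V: "subgroup V G" and g: "g \<in> carrier G" and x: "x \<in> (U #> g) <#> V"
  shows "card {p \<in> U \<times> V. fst p \<otimes> g \<otimes> snd p = x} = card (U \<inter> conj_set G x V)"
proof -
  have Uc: "U \<subseteq> carrier G" and Vc: "V \<subseteq> carrier G" using U V by (auto dest: subgroup.subset)
  obtain u0 v0 where uv: "u0 \<in> U" "v0 \<in> V" "x = u0 \<otimes> g \<otimes> v0"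
    using x Uc Vc g by (auto simp: double_coset_mem)
  have c: "u0 \<in> carrier G" "v0 \<in> carrier G" using uv Uc Vc by auto
  have xc: "x \<in> carrier G" using uv(3) c g by simp
  note Ucl = subgroup.m_closed[OF U] subgroup.m_inv_closed[OF U]
  note Vcl = subgroup.m_closed[OF V] subgroup.m_inv_closed[OF V]
  let ?F = "{p \<in> U \<times> V. fst p \<otimes> g \<otimes> snd p = x}"
  \<comment> \<open>\<open>?j w\<close> solves \<open>(w \<otimes> u0) \<otimes> g \<otimes> v = x\<close> for \<open>v\<close>\<close>
  let ?i = "\<lambda>p. fst p \<otimes> inv u0" and ?j = "\<lambda>w. (w \<otimes> u0, v0 \<otimes> inv (inv x \<otimes> w \<otimes> x))"
  have "bij_betw ?i ?F (U \<inter> conj_set G x V)"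
  proof (rule bij_betw_byWitness[where f' = ?j])
    show "\<forall>p\<in>?F. ?j (?i p) = p"
    proof
      fix p assume "p \<in> ?F"
      then obtain u v where p: "p = (u, v)" "u \<in> U" "v \<in> V" "u \<otimes> g \<otimes> v = x" by (cases p) auto
      have pc: "u \<in> carrier G" "v \<in> carrier G" using p Uc Vc by auto
      have "inv x \<otimes> (u \<otimes> inv u0) \<otimes> x = inv (u \<otimes> g \<otimes> v) \<otimes> (u \<otimes> inv u0) \<otimes> (u0 \<otimes> g \<otimes> v0)"
        using p(4) uv(3) by simp
      also have "\<dots> = inv v \<otimes> v0" using pc c g by (simp add: group_normalize)
      finally show "?j (?i p) = p" using pc c by (simp add: p(1) group_normalize)
    qed
    show "\<forall>w\<in>U \<inter> conj_set G x V. ?i (?j w) = w"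
      using c Uc by (simp add: group_normalize subset_iff)
    show "?i ` ?F \<subseteq> U \<inter> conj_set G x V"
    proof
      fix y assume "y \<in> ?i ` ?F"
      then obtain u v where p: "u \<in> U" "v \<in> V" "u \<otimes> g \<otimes> v = x" "y = u \<otimes> inv u0" by auto
      have pc: "u \<in> carrier G" "v \<in> carrier G" using p Uc Vc by auto
      have "inv x \<otimes> y \<otimes> x = inv (u \<otimes> g \<otimes> v) \<otimes> (u \<otimes> inv u0) \<otimes> (u0 \<otimes> g \<otimes> v0)"
        using p(3,4) uv(3) by simp
      also have "\<dots> = inv v \<otimes> v0" using pc c g by (simp add: group_normalize)
      finally show "y \<in> U \<inter> conj_set G x V"
        using p pc c uv xc Vc Ucl Vcl by (simp add: mem_conj_set)
    qed
    show "?j ` (U \<inter> conj_set G x V) \<subseteq> ?F"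
    proof
      fix p assume "p \<in> ?j ` (U \<inter> conj_set G x V)"
      then obtain w where w: "w \<in> U" "inv x \<otimes> w \<otimes> x \<in> V" "p = ?j w"
        using xc Vc by (auto simp: mem_conj_set)
      have wc: "w \<in> carrier G" using w Uc by auto
      have "w \<otimes> u0 \<otimes> g \<otimes> (v0 \<otimes> inv (inv x \<otimes> w \<otimes> x)) = w \<otimes> (u0 \<otimes> g \<otimes> v0) \<otimes> inv (inv x \<otimes> w \<otimes> x)"
        using wc c g xc by (simp add: m_assoc)
      also have "\<dots> = x" unfolding uv(3)[symmetric] using wc xc by (simp add: group_normalize)
      finally show "p \<in> ?F" using w uv Ucl Vcl by simp
    qed
  qed
  then show ?thesis by (rule bij_betw_same_card)
qed

text \<open>
  This replaces sums over chosen representatives by sums over the whole group: summing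
  \<open>f (u \<otimes> rep D \<otimes> v)\<close> over \<open>U \<times> V\<close> counts each \<open>x\<close> in the double coset \<open>D\<close> exactly
  \<open>card (U \<inter> conj_set G x V)\<close> times.
\<close>

lemma sum_double_cosets:
  fixes f :: "'a \<Rightarrow> 'k::field_char_0"
  assumes fin: "finite (carrier G)" and U: "subgroup U G" and V: "subgroup V G"
    and f: "\<And>u g v. \<lbrakk>u \<in> U; g \<in> carrier G; v \<in> V\<rbrakk> \<Longrightarrow> f (u \<otimes> g \<otimes> v) = f g"
  shows "(\<Sum>D\<in>double_cosets G U V. f (rep D)) =
    (\<Sum>g\<in>carrier G. of_nat (card (U \<inter> conj_set G g V)) * f g) / (of_nat (card U) * of_nat (card V))"
proof -
  have Uc: "U \<subseteq> carrier G" and Vc: "V \<subseteq> carrier G" using U V by (auto dest: subgroup.subset)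
  have finUV: "finite U" "finite V" using Uc Vc fin by (auto intro: finite_subset)
  have ne: "U \<noteq> {}" "V \<noteq> {}" using U V by (auto dest: subgroup.one_closed)
  let ?DC = "double_cosets G U V"
  have self: "g \<in> (U #> g) <#> V" if "g \<in> carrier G" for g
    using that Uc Vc subgroup.one_closed[OF U] subgroup.one_closed[OF V]
    by (auto simp: double_coset_mem intro!: bexI[of _ \<one>])
  have sub: "(U #> g) <#> V \<subseteq> carrier G" if "g \<in> carrier G" for g
    using that Uc Vc by (auto simp: double_coset_mem subset_iff)
  have DC: "D \<subseteq> carrier G \<and> D \<noteq> {} \<and> (\<forall>x\<in>D. D = (U #> x) <#> V)" if D: "D \<in> ?DC" for D
  proof -
    obtain g where g: "g \<in> carrier G" "D = (U #> g) <#> V" using D by (auto simp: double_cosets_def)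
    show ?thesis unfolding g(2) using self[OF g(1)] sub[OF g(1)] double_coset_eq[OF U V g(1)] by blast
  qed
  have rep: "rep D \<in> D" if "D \<in> ?DC" for D
    using DC[OF that] unfolding rep_def some_in_eq by blast
  have Un: "\<Union>?DC = carrier G"
  proof
    show "\<Union>?DC \<subseteq> carrier G" using DC by blast
    show "carrier G \<subseteq> \<Union>?DC" using self unfolding double_cosets_def by blast
  qed
  have disj: "D \<inter> D' = {}" if "D \<in> ?DC" "D' \<in> ?DC" "D \<noteq> D'" for D D'
  proof (rule ccontr)
    assume "D \<inter> D' \<noteq> {}"
    then obtain x where "x \<in> D" "x \<in> D'" by blast
    then have "D = (U #> x) <#> V" "D' = (U #> x) <#> V"
      using DC[OF that(1)] DC[OF that(2)] by blast+
    then show False using that(3) by simp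
  qed
  have one: "of_nat (card U) * of_nat (card V) * f (rep D) =
      (\<Sum>x\<in>D. of_nat (card (U \<inter> conj_set G x V)) * f x)" if D: "D \<in> ?DC" for D
  proof -
    let ?g = "rep D"
    have g: "?g \<in> carrier G" and Dg: "D = (U #> ?g) <#> V" using rep[OF D] DC[OF D] by blast+
    have finD: "finite D" using DC[OF D] fin by (meson finite_subset)
    have "of_nat (card U) * of_nat (card V) * f ?g = (\<Sum>p\<in>U \<times> V. f ?g)"
      by (simp add: card_cartesian_product)
    also have "\<dots> = (\<Sum>p\<in>U \<times> V. f (fst p \<otimes> ?g \<otimes> snd p))"
      by (rule sum.cong) (use f g in auto)
    also have "\<dots> = (\<Sum>x\<in>D. \<Sum>p\<in>{p \<in> U \<times> V. fst p \<otimes> ?g \<otimes> snd p = x}. f (fst p \<otimes> ?g \<otimes> snd p))"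
    proof (rule sum.group[symmetric])
      have "(\<lambda>p. fst p \<otimes> ?g \<otimes> snd p) ` (U \<times> V) \<subseteq> (U #> ?g) <#> V"
        using Uc Vc g by (auto simp: double_coset_mem) blast
      then show "(\<lambda>p. fst p \<otimes> ?g \<otimes> snd p) ` (U \<times> V) \<subseteq> D"
        by (simp only: Dg[symmetric])
    qed (use finUV finD in auto)
    also have "\<dots> = (\<Sum>x\<in>D. of_nat (card (U \<inter> conj_set G x V)) * f x)"
    proof (rule sum.cong[OF refl])
      fix x assume "x \<in> D"
      then have "x \<in> (U #> ?g) <#> V" by (subst (asm) Dg)
      from card_double_coset_fiber[OF U V g this]
      show "(\<Sum>p\<in>{p \<in> U \<times> V. fst p \<otimes> ?g \<otimes> snd p = x}. f (fst p \<otimes> ?g \<otimes> snd p)) =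
          of_nat (card (U \<inter> conj_set G x V)) * f x" by simp
    qed
    finally show ?thesis .
  qed
  have "of_nat (card U) * of_nat (card V) * (\<Sum>D\<in>?DC. f (rep D)) =
      (\<Sum>D\<in>?DC. \<Sum>x\<in>D. of_nat (card (U \<inter> conj_set G x V)) * f x)"
    unfolding sum_distrib_left by (rule sum.cong) (use one in auto)
  also have "\<dots> = (\<Sum>x\<in>\<Union>?DC. of_nat (card (U \<inter> conj_set G x V)) * f x)"
  proof (rule sum.Union_disjoint[symmetric, unfolded comp_def])
    show "\<forall>D\<in>?DC. finite D" using DC fin by (meson finite_subset)
    show "\<forall>D\<in>?DC. \<forall>D'\<in>?DC. D \<noteq> D' \<longrightarrow> D \<inter> D' = {}" using disj by blast
  qed
  finally have "of_nat (card U) * of_nat (card V) * (\<Sum>D\<in>?DC. f (rep D)) =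
      (\<Sum>x\<in>carrier G. of_nat (card (U \<inter> conj_set G x V)) * f x)" by (simp only: Un)
  then show ?thesis
    using finUV ne by (simp add: field_simps)
qed

end

section \<open>Marks\<close>

text \<open>
  The contribution of a group element \<open>h\<close> to the value of the species at \<open>p\<close> on the orbit of \<open>q\<close>. For
  trivial \<open>A\<close> it is \<open>1\<close> if \<open>H\<close> fixes the coset \<open>hU\<close> in \<open>G/U\<close> and \<open>0\<close> otherwise, and
  \<open>species_value\<close> is then the classical table of marks.
\<close>

definition mark ::
  "('g, 'm) monoid_scheme \<Rightarrow> 'g set \<times> (('g \<Rightarrow> 'a) \<Rightarrow> 'k::field) \<Rightarrow> 'g set \<times> ('g \<Rightarrow> 'a) \<Rightarrow> 'g \<Rightarrow> 'k" where
  "mark G p q h = (case p of (H, \<Phi>) \<Rightarrow> case q of (U, \<phi>) \<Rightarrow>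
     if H \<subseteq> conj_set G h U then \<Phi> (restrict (conj_char G h U \<phi>) H) else 0)"

definition species_value ::
  "('g, 'm) monoid_scheme \<Rightarrow> 'g set \<times> (('g \<Rightarrow> 'a) \<Rightarrow> 'k::field) \<Rightarrow> 'g set \<times> ('g \<Rightarrow> 'a) \<Rightarrow> 'k" where
  "species_value G p q = (\<Sum>h\<in>carrier G. mark G p q h) / of_nat (card (fst q))"

locale fibered_burnside_setting = group G for G :: "('g, 'm) monoid_scheme" (structure) +
  fixes A :: "('a, 'n) monoid_scheme"
  assumes finite_G: "finite (carrier G)"
    and comm_A: "comm_group A"
    and finite_chars: "subgroup H G \<Longrightarrow> finite (carrier (char_group G A H))"
begin

abbreviation "\<M> \<equiv> fib_pairs G A"
abbreviation chars where "chars U \<equiv> carrier (char_group G A U)"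

lemma mem_fib_pairs: "(U, \<phi>) \<in> \<M> \<longleftrightarrow> subgroup U G \<and> \<phi> \<in> chars U"
  by (simp add: fib_pairs_def)

lemma mem_species_pairs:
  "(H, \<Phi>) \<in> species_pairs G A \<longleftrightarrow> subgroup H G \<and> \<Phi> \<in> linear_characters (char_group G A H)"
  by (simp add: species_pairs_def linear_characters_def)

lemma fib_act_closed:
  assumes "g \<in> carrier G" "q \<in> \<M>" shows "fib_act G g q \<in> \<M>"
  using assms by (cases q) (auto simp: mem_fib_pairs fib_act_def subgroup_conj_set conj_char_mem)

lemma fib_act_mult:
  assumes "g \<in> carrier G" "h \<in> carrier G" "q \<in> \<M>"
  shows "fib_act G g (fib_act G h q) = fib_act G (g \<otimes> h) q"
  using assms
  by (cases q) (auto simp: mem_fib_pairs fib_act_def conj_char_mult conj_set_mult dest: subgroup.subset)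

lemma fib_act_self:
  assumes "(U, \<phi>) \<in> \<M>" "u \<in> U"
  shows "fib_act G u (U, \<phi>) = (U, \<phi>)"
  using assms comm_A by (simp add: fib_act_def mem_fib_pairs conj_set_self conj_char_self)

lemma fib_act_one: "q \<in> \<M> \<Longrightarrow> fib_act G \<one> q = q"
  using fib_act_self[of "fst q" "snd q" \<one>] by (cases q) (simp add: mem_fib_pairs subgroup.one_closed)

lemma mem_fib_orbit: "q' \<in> fib_orbit G q \<longleftrightarrow> (\<exists>g\<in>carrier G. q' = fib_act G g q)"
  by (auto simp: orbit_def)

lemma fib_orbit_act:
  assumes "g \<in> carrier G" "q \<in> \<M>"
  shows "fib_orbit G (fib_act G g q) = fib_orbit G q"
proof -
  have "\<exists>h'\<in>carrier G. fib_act G h q = fib_act G h' (fib_act G g q)" if "h \<in> carrier G" for h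
    using that assms by (intro bexI[of _ "h \<otimes> inv g"]) (simp_all add: fib_act_mult m_assoc)
  moreover have "\<exists>h'\<in>carrier G. fib_act G h (fib_act G g q) = fib_act G h' q" if "h \<in> carrier G" for h
    using that assms by (intro bexI[of _ "h \<otimes> g"]) (simp_all add: fib_act_mult)
  ultimately show ?thesis by (auto simp: mem_fib_orbit set_eq_iff)
qed

lemma rep_fib_orbit:
  assumes "q \<in> \<M>"
  obtains g where "g \<in> carrier G" "rep (fib_orbit G q) = fib_act G g q"
proof -
  have "q \<in> fib_orbit G q" using fib_act_one[OF assms] by (auto simp: mem_fib_orbit intro!: bexI[of _ \<one>])
  then have "rep (fib_orbit G q) \<in> fib_orbit G q" unfolding rep_def by (rule someI)
  then show ?thesis using that by (auto simp: mem_fib_orbit)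
qed

lemma rep_mem_fib_pairs:
  assumes "a \<in> orbits G \<M> (fib_act G)"
  shows "rep a \<in> \<M>" and "fib_orbit G (rep a) = a"
proof -
  obtain q where q: "q \<in> \<M>" "a = fib_orbit G q" using assms by (auto simp: orbits_def)
  obtain g where g: "g \<in> carrier G" "rep a = fib_act G g q" using rep_fib_orbit[OF q(1)] q(2) by blast
  show "rep a \<in> \<M>" using g q by (simp add: fib_act_closed)
  show "fib_orbit G (rep a) = a" using g q by (simp add: fib_orbit_act)
qed

lemma fib_orbit_mem: "q \<in> \<M> \<Longrightarrow> fib_orbit G q \<in> orbits G \<M> (fib_act G)"
  unfolding orbits_def by blast

lemma finite_subgroups: "finite {U. subgroup U G}"
  by (rule finite_subset[of _ "Pow (carrier G)"]) (use finite_G in \<open>auto dest: subgroup.subset\<close>)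

lemma finite_fib_pairs: "finite \<M>"
proof -
  have "\<M> = Sigma {U. subgroup U G} chars" by (auto simp: fib_pairs_def)
  then show ?thesis using finite_subgroups finite_chars by auto
qed

lemma finite_species_pairs: "finite (species_pairs G A :: ('g set \<times> (('g \<Rightarrow> 'a) \<Rightarrow> 'k::field)) set)"
proof -
  have "species_pairs G A = Sigma {U. subgroup U G} (\<lambda>H. linear_characters (char_group G A H) :: (('g \<Rightarrow> 'a) \<Rightarrow> 'k) set)"
    by (auto simp: species_pairs_def linear_characters_def)
  then show ?thesis
    using finite_subgroups finite_chars
    by (auto intro!: finite_linear_characters comm_group.axioms(2) comm_group_char_group comm_A)
qed

lemma conj_set_inv:
  "\<lbrakk>g \<in> carrier G; U \<subseteq> carrier G\<rbrakk> \<Longrightarrow> conj_set G (inv g) (conj_set G g U) = U"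
  by (simp add: conj_set_mult conj_set_one)

lemma group_chars: "subgroup H G \<Longrightarrow> group (char_group G A H)"
  by (intro comm_group.axioms(2) comm_group_char_group comm_A)

lemma species_act_closed:
  fixes p :: "'g set \<times> (('g \<Rightarrow> 'a) \<Rightarrow> 'k::field)"
  assumes g: "g \<in> carrier G" and p: "p \<in> species_pairs G A"
  shows "species_act G A g p \<in> species_pairs G A"
proof (cases p)
  case (Pair H \<Phi>)
  then have H: "subgroup H G" and \<Phi>: "\<Phi> \<in> linear_characters (char_group G A H)"
    using p by (auto simp: mem_species_pairs)
  note D = linear_charactersD[OF group_chars[OF H] \<Phi>]
  have Hc: "H \<subseteq> carrier G" using H by (rule subgroup.subset)
  note gH = subgroup_conj_set[OF H g]
  let ?r = "conj_char G (inv g) (conj_set G g H)"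
  have r: "?r \<phi> \<in> chars H" if "\<phi> \<in> chars (conj_set G g H)" for \<phi>
    using conj_char_mem[OF gH inv_closed[OF g] that] g Hc by (simp add: conj_set_inv)
  have m: "\<phi> \<otimes>\<^bsub>char_group G A (conj_set G g H)\<^esub> \<psi> \<in> chars (conj_set G g H)"
    if "\<phi> \<in> chars (conj_set G g H)" "\<psi> \<in> chars (conj_set G g H)" for \<phi> \<psi>
    using that group_chars[OF gH] by (simp add: group.is_monoid monoid.m_closed)
  have "(\<lambda>\<phi>\<in>chars (conj_set G g H). \<Phi> (?r \<phi>)) \<in> linear_characters (char_group G A (conj_set G g H))"
    by (rule linear_charactersI)
       (use r m D g Hc in \<open>auto simp: conj_char_char_group_mult[OF gH inv_closed[OF g]] conj_set_inv\<close>)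
  then show ?thesis
    using gH by (simp add: Pair species_act_def mem_species_pairs)
qed

lemma species_act_mult:
  fixes p :: "'g set \<times> (('g \<Rightarrow> 'a) \<Rightarrow> 'k::field)"
  assumes g: "g \<in> carrier G" and h: "h \<in> carrier G" and p: "p \<in> species_pairs G A"
  shows "species_act G A g (species_act G A h p) = species_act G A (g \<otimes> h) p"
proof (cases p)
  case (Pair H \<Phi>)
  then have H: "subgroup H G" using p by (auto simp: mem_species_pairs)
  have Hc: "H \<subseteq> carrier G" using H by (rule subgroup.subset)
  let ?ghH = "conj_set G (g \<otimes> h) H"
  have inv_gh: "conj_set G (inv g) ?ghH = conj_set G h H"
    using g h Hc by (simp add: conj_set_mult group_normalize)
  have gh: "subgroup ?ghH G" using H g h by (simp add: subgroup_conj_set)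
  have "\<Phi> (conj_char G (inv h) (conj_set G h H) (conj_char G (inv g) ?ghH \<phi>)) =
        \<Phi> (conj_char G (inv (g \<otimes> h)) ?ghH \<phi>)" for \<phi>
    using conj_char_mult[of ?ghH "inv h" "inv g" \<phi>] g h Hc subgroup.subset[OF gh]
    by (simp add: inv_gh inv_mult_group)
  moreover have "conj_char G (inv g) ?ghH \<phi> \<in> chars (conj_set G h H)" if "\<phi> \<in> chars ?ghH" for \<phi>
    using conj_char_mem[OF gh inv_closed[OF g] that] inv_gh by simp
  ultimately show ?thesis
    using g h Hc by (simp add: Pair species_act_def conj_set_mult cong: restrict_cong)
qed

lemma species_act_self:
  fixes \<Phi> :: "('g \<Rightarrow> 'a) \<Rightarrow> 'k::field"
  assumes p: "(H, \<Phi>) \<in> species_pairs G A" and h: "h \<in> H"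
  shows "species_act G A h (H, \<Phi>) = (H, \<Phi>)"
proof -
  have H: "subgroup H G" and \<Phi>: "\<Phi> \<in> extensional (chars H)"
    using p by (auto simp: species_pairs_def)
  have "inv h \<in> H" using H h by (rule subgroup.m_inv_closed)
  then have "(\<lambda>\<phi>\<in>chars H. \<Phi> (conj_char G (inv h) H \<phi>)) = restrict \<Phi> (chars H)"
    using H by (intro restrict_ext) (simp add: conj_char_self[OF comm_A H])
  then show ?thesis
    using \<Phi> conj_set_self[OF H h] by (simp add: species_act_def extensional_restrict)
qed

lemma species_act_one: "p \<in> species_pairs G A \<Longrightarrow> species_act G A \<one> p = (p :: 'g set \<times> (('g \<Rightarrow> 'a) \<Rightarrow> 'k::field))"
  using species_act_self[of "fst p" "snd p" \<one>] by (cases p) (simp add: mem_species_pairs subgroup.one_closed)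

text \<open>
  The two actions become translations: conjugating \<open>q\<close> translates the mark on the right, and
  conjugating \<open>p\<close> translates it on the left. Averages over the group do not see either.
\<close>

lemma mark_fib_act:
  assumes "q \<in> \<M>" "g \<in> carrier G" "h \<in> carrier G"
  shows "mark G p (fib_act G g q) h = mark G p q (h \<otimes> g)"
  using assms
  by (cases q; cases p) (auto simp: mark_def fib_act_def mem_fib_pairs conj_set_mult conj_char_mult dest!: subgroup.subset)

lemma mark_species_act:
  fixes p :: "'g set \<times> (('g \<Rightarrow> 'a) \<Rightarrow> 'k::field)"
  assumes p: "p \<in> species_pairs G A" and q: "q \<in> \<M>" and k: "k \<in> carrier G" and h: "h \<in> carrier G"
  shows "mark G (species_act G A k p) q h = mark G p q (inv k \<otimes> h)"
proof (cases p; cases q)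
  fix H \<Phi> U \<phi> assume pq: "p = (H, \<Phi>)" "q = (U, \<phi>)"
  have H: "subgroup H G" and U: "subgroup U G" and \<phi>: "\<phi> \<in> chars U"
    using p q by (auto simp: pq mem_species_pairs mem_fib_pairs)
  have Hc: "H \<subseteq> carrier G" and Uc: "U \<subseteq> carrier G" using H U by (auto dest: subgroup.subset)
  note kH = subgroup_conj_set[OF H k]
  have mono: "conj_set G g S \<subseteq> conj_set G g T" if "S \<subseteq> T" "T \<subseteq> carrier G" "g \<in> carrier G" for g S T
    using that by (auto simp: conj_set_image)
  have iff: "conj_set G k H \<subseteq> conj_set G h U \<longleftrightarrow> H \<subseteq> conj_set G (inv k \<otimes> h) U"
  proof
    assume "conj_set G k H \<subseteq> conj_set G h U"
    from mono[OF this conj_set_subset[OF h Uc] inv_closed[OF k]]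
    show "H \<subseteq> conj_set G (inv k \<otimes> h) U" using k h Hc Uc by (simp add: conj_set_one conj_set_mult)
  next
    assume "H \<subseteq> conj_set G (inv k \<otimes> h) U"
    from mono[OF this conj_set_subset[OF _ Uc] k]
    show "conj_set G k H \<subseteq> conj_set G h U" using k h Hc Uc by (simp add: conj_set_mult inv_mult_cancel)
  qed
  show ?thesis
  proof (cases "conj_set G k H \<subseteq> conj_set G h U")
    case True
    have "restrict (conj_char G h U \<phi>) (conj_set G k H) \<in> chars (conj_set G k H)"
      using restrict_mem_char_group[OF conj_char_mem[OF U h \<phi>] kH True] .
    moreover have "conj_char G (inv k) (conj_set G k H) (restrict (conj_char G h U \<phi>) (conj_set G k H)) =
        restrict (conj_char G (inv k \<otimes> h) U \<phi>) H"
      using restrict_conj_char[OF True conj_set_subset[OF h Uc] inv_closed[OF k], of "conj_char G h U \<phi>"] k h Hc Uc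
      by (simp add: conj_set_inv conj_char_mult)
    ultimately show ?thesis using True iff by (simp add: pq mark_def species_act_def)
  next
    case False
    then show ?thesis using iff by (simp add: pq mark_def species_act_def)
  qed
qed

text \<open>
  The conjugate of \<open>U \<inter> gVg\<^sup>-\<^sup>1\<close> by \<open>h\<close> contains \<open>H\<close> iff both \<open>hUh\<^sup>-\<^sup>1\<close> and \<open>(hg)V(hg)\<^sup>-\<^sup>1\<close> do, and then \<open>\<Phi>\<close> is
  multiplicative on the restricted characters.
\<close>

lemma mark_mult:
  fixes p :: "'g set \<times> (('g \<Rightarrow> 'a) \<Rightarrow> 'k::field)"
  assumes p: "p \<in> species_pairs G A" and q: "(U, \<phi>) \<in> \<M>" and r: "(V, \<psi>) \<in> \<M>"
    and g: "g \<in> carrier G" and h: "h \<in> carrier G" and W: "W = U \<inter> conj_set G g V"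
  shows "mark G p (W, restrict \<phi> W \<otimes>\<^bsub>char_group G A W\<^esub> restrict (conj_char G g V \<psi>) W) h =
    mark G p (U, \<phi>) h * mark G p (V, \<psi>) (h \<otimes> g)"
proof (cases p)
  case (Pair H \<Phi>)
  have H: "subgroup H G" and \<Phi>: "\<Phi> \<in> linear_characters (char_group G A H)"
    and U: "subgroup U G" and V: "subgroup V G" and \<phi>: "\<phi> \<in> chars U" and \<psi>: "\<psi> \<in> chars V"
    using p q r by (auto simp: Pair mem_species_pairs mem_fib_pairs)
  have Hc: "H \<subseteq> carrier G" and Uc: "U \<subseteq> carrier G" and Vc: "V \<subseteq> carrier G"
    using H U V by (auto dest: subgroup.subset)
  have Wc: "W \<subseteq> carrier G" using W Uc by auto
  have conjW: "conj_set G h W = conj_set G h U \<inter> conj_set G (h \<otimes> g) V"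
    using g h Uc Vc Wc unfolding W by (auto simp: mem_conj_set inv_mult_group m_assoc)
  show ?thesis
  proof (cases "H \<subseteq> conj_set G h W")
    case True
    let ?a = "restrict (conj_char G h U \<phi>) H" and ?b = "restrict (conj_char G (h \<otimes> g) V \<psi>) H"
    have "?a \<in> chars H"
      by (rule restrict_mem_char_group[OF conj_char_mem[OF U h \<phi>] H]) (use True conjW in blast)
    moreover have "?b \<in> chars H"
      by (rule restrict_mem_char_group[OF conj_char_mem[OF V _ \<psi>] H]) (use True conjW g h in auto)
    ultimately have "\<Phi> (?a \<otimes>\<^bsub>char_group G A H\<^esub> ?b) = \<Phi> ?a * \<Phi> ?b"
      using linear_charactersD(2)[OF group_chars[OF H] \<Phi>] by simp
    moreover have "restrict (conj_char G h W (restrict \<phi> W \<otimes>\<^bsub>char_group G A W\<^esub> restrict (conj_char G g V \<psi>) W)) H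
       = ?a \<otimes>\<^bsub>char_group G A H\<^esub> ?b"
    proof
      fix x
      show "restrict (conj_char G h W (restrict \<phi> W \<otimes>\<^bsub>char_group G A W\<^esub> restrict (conj_char G g V \<psi>) W)) H x
       = (?a \<otimes>\<^bsub>char_group G A H\<^esub> ?b) x"
      proof (cases "x \<in> H")
        case x: True
        then have xW: "x \<in> conj_set G h W" using True by blast
        then have *: "x \<in> carrier G" "inv h \<otimes> x \<otimes> h \<in> W" using h Wc by (auto simp: mem_conj_set)
        moreover have "inv h \<otimes> x \<otimes> h \<in> conj_set G g V" using * W by simp
        moreover have "x \<in> conj_set G h U" "x \<in> conj_set G (h \<otimes> g) V" using xW conjW by auto
        ultimately show ?thesis
          using x xW g h by (simp add: char_group_simps conj_char_apply inv_mult_group m_assoc)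
      qed (simp add: char_group_def)
    qed
    ultimately show ?thesis using True conjW by (simp add: Pair mark_def)
  next
    case False
    then show ?thesis using conjW by (auto simp: Pair mark_def)
  qed
qed

end

section \<open>Species as averages of marks\<close>

lemma (in vector_space) lin_ext_superset:
  assumes "finite T" "Poly_Mapping.keys x \<subseteq> T"
  shows "lin_ext scale f x = (\<Sum>b\<in>T. scale (Poly_Mapping.lookup x b) (f b))"
  unfolding lin_ext_def using assms by (intro sum.mono_neutral_left) (auto simp: in_keys_iff)

lemma (in vector_space) linear_lin_ext:
  "Vector_Spaces.linear pm_scale scale (lin_ext scale f)"
proof -
  have "lin_ext scale f (x + y) = lin_ext scale f x + lin_ext scale f y" for x y
  proof -
    let ?T = "Poly_Mapping.keys x \<union> Poly_Mapping.keys y"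
    have "Poly_Mapping.keys (x + y) \<subseteq> ?T" by (rule Poly_Mapping.keys_add)
    then show ?thesis
      by (simp add: lin_ext_superset[of ?T] lookup_add scale_left_distrib sum.distrib)
  qed
  moreover have "lin_ext scale f (pm_scale c x) = scale c (lin_ext scale f x)" for c x
  proof -
    have "Poly_Mapping.keys (pm_scale c x) \<subseteq> Poly_Mapping.keys x" by (auto simp: in_keys_iff)
    then show ?thesis
      by (simp add: lin_ext_superset[of "Poly_Mapping.keys x"] scale_sum_right)
  qed
  ultimately show ?thesis
    by (simp add: Vector_Spaces.linear_iff vector_space_axioms pm.vector_space_axioms)
qed

lemma (in vector_space) lin_ext_single [simp]: "lin_ext scale f (Poly_Mapping.single b 1) = f b"
  by (simp add: lin_ext_def)

lemma vector_space_mult: "vector_space ((*) :: 'k::field \<Rightarrow> 'k \<Rightarrow> 'k)"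
  by unfold_locales (auto simp: algebra_simps)

lemma linear_lin_ext_commute:
  assumes "Vector_Spaces.linear pm_scale scale L"
  shows "L (lin_ext pm_scale f x) = lin_ext scale (\<lambda>b. L (f b)) x"
proof -
  interpret Vector_Spaces.linear pm_scale scale L by fact
  show ?thesis by (simp add: lin_ext_def sum scale)
qed

lemma lin_ext_singles: "lin_ext pm_scale (\<lambda>b. Poly_Mapping.single b 1) x = x"
  by (intro poly_mapping_eqI)
     (simp add: lin_ext_def lookup_sum lookup_single when_def in_keys_iff if_distrib[of "\<lambda>y. _ * y"] cong: if_cong)

lemma lin_ext_cong: "(\<And>b. b \<in> Poly_Mapping.keys x \<Longrightarrow> f b = g b) \<Longrightarrow> lin_ext scale f x = lin_ext scale g x"
  by (simp add: lin_ext_def)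

lemma proj_linear: "Vector_Spaces.linear pm_scale (*) (lin_ext (*) \<Phi> \<circ> fib_proj H)"
  unfolding fib_proj_def
  by (rule Vector_Spaces.linear_compose[OF pm.linear_lin_ext vector_space.linear_lin_ext[OF vector_space_mult]])

lemma species_linear: "Vector_Spaces.linear pm_scale (*) (species G p)"
proof (cases p)
  case (Pair H \<Phi>)
  show ?thesis
    unfolding species_def Pair split_conv fib_res_def
    by (rule Vector_Spaces.linear_compose[OF pm.linear_lin_ext proj_linear])
qed

context group
begin

lemma sum_translate_right:
  assumes "g \<in> carrier G" shows "(\<Sum>h\<in>carrier G. f (h \<otimes> g)) = (\<Sum>h\<in>carrier G. f h)"
  by (rule sum.reindex_bij_witness[of _ "\<lambda>h. h \<otimes> inv g" "\<lambda>h. h \<otimes> g"])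
     (use assms in \<open>auto simp: m_assoc\<close>)

lemma sum_translate_left:
  assumes "g \<in> carrier G" shows "(\<Sum>h\<in>carrier G. f (g \<otimes> h)) = (\<Sum>h\<in>carrier G. f h)"
  by (rule sum.reindex_bij_witness[of _ "\<lambda>h. inv g \<otimes> h" "\<lambda>h. g \<otimes> h"])
     (use assms in \<open>auto simp: inv_mult_cancel\<close>)

lemma rep_double_coset:
  assumes U: "subgroup U G" and V: "subgroup V G" and D: "D \<in> double_cosets G U V"
  shows "rep D \<in> carrier G"
proof -
  have Uc: "U \<subseteq> carrier G" and Vc: "V \<subseteq> carrier G" using U V by (auto dest: subgroup.subset)
  obtain g where g: "g \<in> carrier G" "D = (U #> g) <#> V" using D by (auto simp: double_cosets_def)
  have "g \<in> D" unfolding g(2)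
    using g(1) Uc Vc subgroup.one_closed[OF U] subgroup.one_closed[OF V]
    by (auto simp: double_coset_mem intro!: bexI[of _ \<one>])
  then have "rep D \<in> D" unfolding rep_def by (rule someI)
  then show ?thesis
    unfolding g(2) using g(1) Uc Vc by (auto simp: double_coset_mem subset_iff)
qed

lemma conj_set_Int:
  assumes "g \<in> carrier G" "U \<subseteq> carrier G" "V \<subseteq> carrier G"
  shows "conj_set G g (U \<inter> V) = conj_set G g U \<inter> conj_set G g V"
  using assms by (auto simp: mem_conj_set le_infI1)

lemma fib_act_subgroup:
  assumes H: "subgroup H G" and h: "h \<in> H"
  shows "fib_act (G\<lparr>carrier := H\<rparr>) h q = fib_act G h q"
proof -
  have "conj_set (G\<lparr>carrier := H\<rparr>) h U = conj_set G h U" for U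
    using m_inv_consistent[OF H h] by (simp add: conj_set_def l_coset_def r_coset_def)
  then show ?thesis
    using m_inv_consistent[OF H h] by (cases q) (simp add: fib_act_def conj_char_def)
qed

end

context fibered_burnside_setting
begin

lemma species_value_fib_act:
  assumes "q \<in> \<M>" "g \<in> carrier G"
  shows "species_value G p (fib_act G g q) = species_value G p q"
proof -
  have "card (fst (fib_act G g q)) = card (fst q)"
    using assms by (cases q) (simp add: fib_act_def mem_fib_pairs card_conj_set subgroup.subset)
  then show ?thesis
    using assms sum_translate_right[OF assms(2), of "mark G p q"]
    by (simp add: species_value_def mark_fib_act cong: sum.cong)
qed

lemma species_value_species_act:
  fixes p :: "'g set \<times> (('g \<Rightarrow> 'a) \<Rightarrow> 'k::field)"
  assumes "p \<in> species_pairs G A" "q \<in> \<M>" "g \<in> carrier G"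
  shows "species_value G (species_act G A g p) q = species_value G p q"
  using assms sum_translate_left[of "inv g" "mark G p q"]
  by (simp add: species_value_def mark_species_act cong: sum.cong)

lemma species_value_rep:
  assumes "q \<in> \<M>"
  shows "species_value G p (rep (fib_orbit G q)) = species_value G p q"
  using rep_fib_orbit[OF assms] species_value_fib_act[OF assms] by metis

text \<open>
  An \<open>H\<close>-orbit through \<open>(H, \<chi>)\<close> is a single point, and no other orbit contains a pair with first
  component \<open>H\<close>. So the projection does not depend on the representative.
\<close>

lemma fib_proj_orbit:
  assumes H: "subgroup H G" and q: "(W, \<chi>) \<in> \<M>" and "W \<subseteq> H"
  shows "fib_proj H (Poly_Mapping.single (fib_orbit (G\<lparr>carrier := H\<rparr>) (W, \<chi>)) (1 :: 'k::field)) =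
    (if W = H then Poly_Mapping.single \<chi> 1 else 0)"
proof -
  let ?O = "fib_orbit (G\<lparr>carrier := H\<rparr>) (W, \<chi>)"
  have Hc: "H \<subseteq> carrier G" using H by (rule subgroup.subset)
  have mem: "q' \<in> ?O \<longleftrightarrow> (\<exists>h\<in>H. q' = fib_act G h (W, \<chi>))" for q'
    using fib_act_subgroup[OF H] unfolding orbit_def by auto metis
  have "(W, \<chi>) \<in> ?O"
    using fib_act_one[OF q] subgroup.one_closed[OF H] unfolding mem by (intro bexI[of _ \<one>]) simp_all
  then have "rep ?O \<in> ?O" unfolding rep_def by (rule someI)
  then obtain h where h: "h \<in> H" "rep ?O = fib_act G h (W, \<chi>)" unfolding mem by blast
  have hc: "h \<in> carrier G" using h Hc by blast
  show ?thesis
  proof (cases "W = H")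
    case True
    then have "rep ?O = (H, \<chi>)" using h fib_act_self[OF q] by simp
    then show ?thesis using True by (simp add: fib_proj_def)
  next
    case False
    have "conj_set G h W \<noteq> H"
    proof
      assume "conj_set G h W = H"
      then have "W = conj_set G (inv h) H"
        using conj_set_inv[OF hc, of W] assms(3) Hc by auto
      then show False using conj_set_self[OF H subgroup.m_inv_closed[OF H h(1)]] False by simp
    qed
    then show ?thesis using False h(2) by (simp add: fib_proj_def fib_act_def)
  qed
qed

text \<open>
  Composing restriction, projection and \<open>\<Phi>\<close> gives the sum of \<open>mark G p (rep a) (rep D)\<close> over the double
  cosets \<open>D = HgU\<close>. In the weighted sum over the group only those \<open>g\<close> count for which
  \<open>H \<inter> gUg\<^sup>-\<^sup>1 = H\<close>, so that the weight is \<open>1/|U|\<close>.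
\<close>

lemma species_single:
  fixes p :: "'g set \<times> (('g \<Rightarrow> 'a) \<Rightarrow> 'k::field_char_0)"
  assumes p: "p \<in> species_pairs G A" and a: "rep a \<in> \<M>"
  shows "species G p (Poly_Mapping.single a 1) = species_value G p (rep a)"
proof (cases p; cases "rep a")
  fix H \<Phi> U \<phi> assume pq: "p = (H, \<Phi>)" "rep a = (U, \<phi>)"
  have H: "subgroup H G" and U: "subgroup U G" and \<phi>: "\<phi> \<in> chars U"
    using p a by (auto simp: pq mem_species_pairs mem_fib_pairs)
  have Hc: "H \<subseteq> carrier G" and Uc: "U \<subseteq> carrier G" using H U by (auto dest: subgroup.subset)
  have finH: "finite H" "H \<noteq> {}" using Hc finite_G subgroup.one_closed[OF H] by (auto intro: finite_subset)
  let ?W = "\<lambda>g. H \<inter> conj_set G g U"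
  let ?\<chi> = "\<lambda>g. restrict (conj_char G g U \<phi>) (?W g)"
  let ?e = "\<lambda>g. Poly_Mapping.single (fib_orbit (G\<lparr>carrier := H\<rparr>) (?W g, ?\<chi> g)) (1 :: 'k)"
  let ?s = "lin_ext (*) \<Phi> \<circ> fib_proj H"
  interpret s: Vector_Spaces.linear pm_scale "(*)" ?s by (rule proj_linear)
  have value_at: "?s (?e g) = mark G p (rep a) g" if g: "g \<in> carrier G" for g
  proof -
    have sub: "subgroup (?W g) G" using H subgroup_conj_set[OF U g] by (rule subgroups_Inter_pair)
    have "(?W g, ?\<chi> g) \<in> \<M>"
      using sub restrict_mem_char_group[OF conj_char_mem[OF U g \<phi>] sub] by (simp add: mem_fib_pairs)
    moreover have "?W g = H \<longleftrightarrow> H \<subseteq> conj_set G g U" by blast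
    ultimately show ?thesis
      using fib_proj_orbit[OF H, of "?W g" "?\<chi> g", where 'k = 'k]
      by (auto simp: pq mark_def vector_space.lin_ext_single[OF vector_space_mult]) (simp add: lin_ext_def)
  qed
  have "species G p (Poly_Mapping.single a 1) = ?s (\<Sum>D\<in>double_cosets G H U. ?e (rep D))"
    by (simp add: species_def pq fib_res_def Let_def)
  also have "\<dots> = (\<Sum>D\<in>double_cosets G H U. ?s (?e (rep D)))" by (rule s.sum)
  also have "\<dots> = (\<Sum>D\<in>double_cosets G H U. mark G p (rep a) (rep D))"
    by (intro sum.cong refl value_at rep_double_coset[OF H U])
  also have "\<dots> = (\<Sum>g\<in>carrier G. of_nat (card (?W g)) * mark G p (rep a) g) / (of_nat (card H) * of_nat (card U))"
  proof (rule sum_double_cosets[OF finite_G H U])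
    fix u g v assume u: "u \<in> H" and g: "g \<in> carrier G" and v: "v \<in> U"
    have c: "u \<in> carrier G" "v \<in> carrier G" using u v Hc Uc by auto
    have "mark G p (rep a) (u \<otimes> g \<otimes> v) = mark G p (fib_act G v (rep a)) (u \<otimes> g)"
      using mark_fib_act[OF a c(2), where p = p and h = "u \<otimes> g"] c g by simp
    also have "\<dots> = mark G p (rep a) (u \<otimes> g)"
      using fib_act_self a v by (simp add: pq)
    also have "\<dots> = mark G (species_act G A (inv u) p) (rep a) g"
      using mark_species_act[OF p a _ g, of "inv u"] c by simp
    also have "\<dots> = mark G p (rep a) g"
      using species_act_self[of H \<Phi> "inv u"] p subgroup.m_inv_closed[OF H u] by (simp add: pq)
    finally show "mark G p (rep a) (u \<otimes> g \<otimes> v) = mark G p (rep a) g" .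
  qed
  also have "(\<Sum>g\<in>carrier G. of_nat (card (?W g)) * mark G p (rep a) g) =
      (\<Sum>g\<in>carrier G. of_nat (card H) * mark G p (rep a) g)"
  proof (rule sum.cong[OF refl])
    fix g
    show "of_nat (card (?W g)) * mark G p (rep a) g = of_nat (card H) * mark G p (rep a) g"
      by (cases "H \<subseteq> conj_set G g U") (auto simp: pq mark_def Int_absorb2)
  qed
  finally show ?thesis
    using finH by (simp add: species_value_def pq flip: sum_distrib_left)
qed

lemma species_eq:
  fixes p :: "'g set \<times> (('g \<Rightarrow> 'a) \<Rightarrow> 'k::field_char_0)"
  assumes p: "p \<in> species_pairs G A" and x: "Poly_Mapping.keys x \<subseteq> orbits G \<M> (fib_act G)"
  shows "species G p x = lin_ext (*) (\<lambda>a. species_value G p (rep a)) x"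
proof -
  have "species G p x = species G p (lin_ext pm_scale (\<lambda>b. Poly_Mapping.single b 1) x)"
    by (simp add: lin_ext_singles)
  also have "\<dots> = lin_ext (*) (\<lambda>b. species G p (Poly_Mapping.single b 1)) x"
    by (rule linear_lin_ext_commute[OF species_linear])
  also have "\<dots> = lin_ext (*) (\<lambda>a. species_value G p (rep a)) x"
    using x by (intro lin_ext_cong species_single p rep_mem_fib_pairs) auto
  finally show ?thesis .
qed

lemma species_orbit:
  fixes p :: "'g set \<times> (('g \<Rightarrow> 'a) \<Rightarrow> 'k::field_char_0)"
  assumes "p \<in> species_pairs G A" and "q \<in> \<M>"
  shows "species G p (Poly_Mapping.single (fib_orbit G q) 1) = species_value G p q"
  using species_single[OF assms(1) rep_mem_fib_pairs(1)[OF fib_orbit_mem[OF assms(2)]]]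
    species_value_rep[OF assms(2)] by simp

lemma mult_pair_mem:
  assumes "(U, \<phi>) \<in> \<M>" and "(V, \<psi>) \<in> \<M>" and g: "g \<in> carrier G" and W: "W = U \<inter> conj_set G g V"
  shows "(W, restrict \<phi> W \<otimes>\<^bsub>char_group G A W\<^esub> restrict (conj_char G g V \<psi>) W) \<in> \<M>"
proof -
  have U: "subgroup U G" and V: "subgroup V G" and \<phi>: "\<phi> \<in> chars U" and \<psi>: "\<psi> \<in> chars V"
    using assms by (auto simp: mem_fib_pairs)
  have sW: "subgroup W G" unfolding W using U subgroup_conj_set[OF V g] by (rule subgroups_Inter_pair)
  have "restrict \<phi> W \<in> chars W" using restrict_mem_char_group[OF \<phi> sW] W by simp
  moreover have "restrict (conj_char G g V \<psi>) W \<in> chars W"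
    using restrict_mem_char_group[OF conj_char_mem[OF V g \<psi>] sW] W by simp
  ultimately show ?thesis
    using sW group_chars[OF sW] by (simp add: mem_fib_pairs group.is_monoid monoid.m_closed)
qed

text \<open>
  The weight \<open>card (U \<inter> conj_set G g V)\<close> of \<open>g\<close> cancels the denominator of the species value of the
  summand at \<open>g\<close>. What is left is the double sum of \<open>m(h) n(hg)\<close> over \<open>g\<close> and \<open>h\<close>, with \<open>m\<close> and \<open>n\<close> the
  marks of the factors; it is the product of the two sums.
\<close>

lemma species_fib_mult_pairs:
  fixes p :: "'g set \<times> (('g \<Rightarrow> 'a) \<Rightarrow> 'k::field_char_0)"
  assumes p: "p \<in> species_pairs G A" and q: "q \<in> \<M>" and r: "r \<in> \<M>"
  shows "species G p (fib_mult_pairs G A q r) = species_value G p q * species_value G p r"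
proof (cases q; cases r)
  fix U \<phi> V \<psi> assume qr: "q = (U, \<phi>)" "r = (V, \<psi>)"
  have U: "subgroup U G" and V: "subgroup V G" using q r by (auto simp: qr mem_fib_pairs)
  have Uc: "U \<subseteq> carrier G" and Vc: "V \<subseteq> carrier G" using U V by (auto dest: subgroup.subset)
  let ?W = "\<lambda>g. U \<inter> conj_set G g V"
  let ?q = "\<lambda>g. (?W g, restrict \<phi> (?W g) \<otimes>\<^bsub>char_group G A (?W g)\<^esub> restrict (conj_char G g V \<psi>) (?W g))"
  let ?m = "mark G p q" and ?n = "mark G p r"
  interpret s: Vector_Spaces.linear pm_scale "(*)" "species G p" by (rule species_linear)
  have val: "species_value G p (?q g) = (\<Sum>h\<in>carrier G. ?m h * ?n (h \<otimes> g)) / of_nat (card (?W g))"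
    if g: "g \<in> carrier G" for g
    using mark_mult[OF p q[unfolded qr] r[unfolded qr] g _ refl] by (simp add: species_value_def qr)
  have m_right: "mark G p t (h \<otimes> u) = mark G p t h" if "t \<in> \<M>" "u \<in> fst t" "h \<in> carrier G" for t u h
  proof -
    have "u \<in> carrier G" using that by (cases t) (auto simp: mem_fib_pairs dest: subgroup.subset)
    then have "mark G p (fib_act G u t) h = mark G p t (h \<otimes> u)" using that by (intro mark_fib_act)
    then show ?thesis using that fib_act_self[of "fst t" "snd t" u] by simp
  qed
  have "species G p (fib_mult_pairs G A q r) =
      (\<Sum>D\<in>double_cosets G U V. species G p (Poly_Mapping.single (fib_orbit G (?q (rep D))) 1))"
    by (simp add: fib_mult_pairs_def qr Let_def s.sum)
  also have "\<dots> = (\<Sum>D\<in>double_cosets G U V. species_value G p (?q (rep D)))"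
    using mult_pair_mem[OF q[unfolded qr] r[unfolded qr] rep_double_coset[OF U V] refl]
    by (intro sum.cong refl species_orbit p)
  also have "\<dots> = (\<Sum>g\<in>carrier G. of_nat (card (?W g)) * species_value G p (?q g)) / (of_nat (card U) * of_nat (card V))"
  proof (rule sum_double_cosets[OF finite_G U V])
    fix u g v assume u: "u \<in> U" and g: "g \<in> carrier G" and v: "v \<in> V"
    have c: "u \<in> carrier G" "v \<in> carrier G" using u v Uc Vc by auto
    have "?W (u \<otimes> g \<otimes> v) = conj_set G u U \<inter> conj_set G u (conj_set G g (conj_set G v V))"
      using c g Uc Vc conj_set_self[OF U u] by (simp add: conj_set_mult m_assoc)
    also have "\<dots> = conj_set G u (?W g)"
      using c g Uc Vc conj_set_self[OF V v] by (simp add: conj_set_Int conj_set_subset)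
    finally have card: "card (?W (u \<otimes> g \<otimes> v)) = card (?W g)"
      using c Uc by (simp add: card_conj_set le_infI1)
    have "(\<Sum>h\<in>carrier G. ?m h * ?n (h \<otimes> (u \<otimes> g \<otimes> v))) = (\<Sum>h\<in>carrier G. ?m (h \<otimes> u) * ?n ((h \<otimes> u) \<otimes> g))"
    proof (rule sum.cong[OF refl])
      fix h assume h: "h \<in> carrier G"
      have "h \<otimes> (u \<otimes> g \<otimes> v) = (h \<otimes> u \<otimes> g) \<otimes> v" using h c g by (simp add: m_assoc)
      then show "?m h * ?n (h \<otimes> (u \<otimes> g \<otimes> v)) = ?m (h \<otimes> u) * ?n ((h \<otimes> u) \<otimes> g)"
        using m_right[OF q, of u h] m_right[OF r, of v "h \<otimes> u \<otimes> g"] h c g u v by (simp add: qr)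
    qed
    also have "\<dots> = (\<Sum>h\<in>carrier G. ?m h * ?n (h \<otimes> g))"
      by (rule sum_translate_right[OF c(1), of "\<lambda>h. ?m h * ?n (h \<otimes> g)"])
    finally show "species_value G p (?q (u \<otimes> g \<otimes> v)) = species_value G p (?q g)"
      using val[of "u \<otimes> g \<otimes> v"] val[OF g] card c g by simp
  qed
  also have "(\<Sum>g\<in>carrier G. of_nat (card (?W g)) * species_value G p (?q g)) =
      (\<Sum>g\<in>carrier G. \<Sum>h\<in>carrier G. ?m h * ?n (h \<otimes> g))"
  proof (rule sum.cong[OF refl])
    fix g assume g: "g \<in> carrier G"
    have "\<one> \<in> ?W g" using subgroup.one_closed[OF U] subgroup.one_closed[OF subgroup_conj_set[OF V g]] by simp
    moreover have "finite (?W g)" using Uc finite_G by (meson finite_Int finite_subset)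
    ultimately have "card (?W g) \<noteq> 0" by auto
    then show "of_nat (card (?W g)) * species_value G p (?q g) = (\<Sum>h\<in>carrier G. ?m h * ?n (h \<otimes> g))"
      using val[OF g] by simp
  qed
  also have "\<dots> = (\<Sum>h\<in>carrier G. ?m h * (\<Sum>g\<in>carrier G. ?n (h \<otimes> g)))"
    by (subst sum.swap) (simp add: sum_distrib_left)
  also have "\<dots> = (\<Sum>h\<in>carrier G. ?m h) * (\<Sum>g\<in>carrier G. ?n g)"
    by (simp add: sum_translate_left[where f = ?n] sum_distrib_right)
  finally show ?thesis by (simp add: species_value_def qr)
qed

end

section \<open>The algebra structures and the multiplicativity of species\<close>

text \<open>
  Every axiom is an identity between elements that the evaluations turn into an identity in the field.
  For the product algebra the evaluations are the coordinates, for the Burnside algebra the species.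
\<close>

lemma algebra_of_separating_evaluations:
  fixes M :: "('k::field, 'b, 'n) module_scheme" and e :: "'p \<Rightarrow> 'b \<Rightarrow> 'k"
  assumes closed: "\<And>x y. \<lbrakk>x \<in> carrier M; y \<in> carrier M\<rbrakk> \<Longrightarrow> x \<otimes>\<^bsub>M\<^esub> y \<in> carrier M"
      "\<And>x y. \<lbrakk>x \<in> carrier M; y \<in> carrier M\<rbrakk> \<Longrightarrow> x \<oplus>\<^bsub>M\<^esub> y \<in> carrier M"
      "\<And>c x. x \<in> carrier M \<Longrightarrow> c \<odot>\<^bsub>M\<^esub> x \<in> carrier M"
      "\<one>\<^bsub>M\<^esub> \<in> carrier M" "\<zero>\<^bsub>M\<^esub> \<in> carrier M"
    and ev: "\<And>p x y. \<lbrakk>p \<in> S; x \<in> carrier M; y \<in> carrier M\<rbrakk> \<Longrightarrow> e p (x \<otimes>\<^bsub>M\<^esub> y) = e p x * e p y"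
      "\<And>p x y. \<lbrakk>p \<in> S; x \<in> carrier M; y \<in> carrier M\<rbrakk> \<Longrightarrow> e p (x \<oplus>\<^bsub>M\<^esub> y) = e p x + e p y"
      "\<And>p c x. \<lbrakk>p \<in> S; x \<in> carrier M\<rbrakk> \<Longrightarrow> e p (c \<odot>\<^bsub>M\<^esub> x) = c * e p x"
      "\<And>p. p \<in> S \<Longrightarrow> e p \<one>\<^bsub>M\<^esub> = 1" "\<And>p. p \<in> S \<Longrightarrow> e p \<zero>\<^bsub>M\<^esub> = 0"
    and sep: "\<And>x y. \<lbrakk>x \<in> carrier M; y \<in> carrier M; \<And>p. p \<in> S \<Longrightarrow> e p x = e p y\<rbrakk> \<Longrightarrow> x = y"
  shows "algebra class_ring M"
proof -
  have "abelian_group M"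
  proof (rule abelian_groupI)
    show "x \<oplus>\<^bsub>M\<^esub> y \<oplus>\<^bsub>M\<^esub> z = x \<oplus>\<^bsub>M\<^esub> (y \<oplus>\<^bsub>M\<^esub> z)"
      if "x \<in> carrier M" "y \<in> carrier M" "z \<in> carrier M" for x y z
      using that by (intro sep) (simp_all add: closed ev)
    show "x \<oplus>\<^bsub>M\<^esub> y = y \<oplus>\<^bsub>M\<^esub> x" if "x \<in> carrier M" "y \<in> carrier M" for x y
      using that by (intro sep) (simp_all add: closed ev add.commute)
    show "\<zero>\<^bsub>M\<^esub> \<oplus>\<^bsub>M\<^esub> x = x" if "x \<in> carrier M" for x
      using that by (intro sep) (simp_all add: closed ev)
    show "\<exists>y\<in>carrier M. y \<oplus>\<^bsub>M\<^esub> x = \<zero>\<^bsub>M\<^esub>" if x: "x \<in> carrier M" for x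
    proof
      show "(- 1) \<odot>\<^bsub>M\<^esub> x \<oplus>\<^bsub>M\<^esub> x = \<zero>\<^bsub>M\<^esub>"
        using x by (intro sep) (simp_all add: closed ev)
    qed (rule closed(3)[OF x])
  qed (use closed in auto)
  moreover have "comm_monoid M"
  proof (rule comm_monoidI)
    show "x \<otimes>\<^bsub>M\<^esub> y \<otimes>\<^bsub>M\<^esub> z = x \<otimes>\<^bsub>M\<^esub> (y \<otimes>\<^bsub>M\<^esub> z)"
      if "x \<in> carrier M" "y \<in> carrier M" "z \<in> carrier M" for x y z
      using that by (intro sep) (simp_all add: closed ev)
    show "x \<otimes>\<^bsub>M\<^esub> y = y \<otimes>\<^bsub>M\<^esub> x" if "x \<in> carrier M" "y \<in> carrier M" for x y
      using that by (intro sep) (simp_all add: closed ev mult.commute)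
    show "\<one>\<^bsub>M\<^esub> \<otimes>\<^bsub>M\<^esub> x = x" if "x \<in> carrier M" for x
      using that by (intro sep) (simp_all add: closed ev)
  qed (use closed in auto)
  moreover have "(x \<oplus>\<^bsub>M\<^esub> y) \<otimes>\<^bsub>M\<^esub> z = x \<otimes>\<^bsub>M\<^esub> z \<oplus>\<^bsub>M\<^esub> y \<otimes>\<^bsub>M\<^esub> z"
    if "x \<in> carrier M" "y \<in> carrier M" "z \<in> carrier M" for x y z
    using that by (intro sep) (simp_all add: closed ev distrib_right)
  ultimately have "cring M" by (rule cringI)
  then show ?thesis
  proof (rule algebraI[OF class_cring.cring_axioms])
    fix c d x y assume x: "x \<in> carrier M" and y: "y \<in> carrier M"
    show "(c \<oplus>\<^bsub>class_ring\<^esub> d) \<odot>\<^bsub>M\<^esub> x = c \<odot>\<^bsub>M\<^esub> x \<oplus>\<^bsub>M\<^esub> d \<odot>\<^bsub>M\<^esub> x"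
      using x by (intro sep) (simp_all add: closed ev distrib_right)
    show "c \<odot>\<^bsub>M\<^esub> (x \<oplus>\<^bsub>M\<^esub> y) = c \<odot>\<^bsub>M\<^esub> x \<oplus>\<^bsub>M\<^esub> c \<odot>\<^bsub>M\<^esub> y"
      using x y by (intro sep) (simp_all add: closed ev distrib_left)
    show "(c \<otimes>\<^bsub>class_ring\<^esub> d) \<odot>\<^bsub>M\<^esub> x = c \<odot>\<^bsub>M\<^esub> (d \<odot>\<^bsub>M\<^esub> x)"
      using x by (intro sep) (simp_all add: closed ev)
    show "\<one>\<^bsub>class_ring\<^esub> \<odot>\<^bsub>M\<^esub> x = x"
      using x by (intro sep) (simp_all add: closed ev)
    show "(c \<odot>\<^bsub>M\<^esub> x) \<otimes>\<^bsub>M\<^esub> y = c \<odot>\<^bsub>M\<^esub> (x \<otimes>\<^bsub>M\<^esub> y)"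
      using x y by (intro sep) (simp_all add: closed ev)
  qed (rule closed)
qed

lemma fixed_product_algebra_simps:
  fixes a b :: "'x \<Rightarrow> 'k::field"
  shows "a \<otimes>\<^bsub>fixed_product_algebra G S act\<^esub> b = (\<lambda>x\<in>S. a x * b x)"
  "a \<oplus>\<^bsub>fixed_product_algebra G S act\<^esub> b = (\<lambda>x\<in>S. a x + b x)"
  "c \<odot>\<^bsub>fixed_product_algebra G S act\<^esub> a = (\<lambda>x\<in>S. c * a x)"
  "\<one>\<^bsub>fixed_product_algebra G S act\<^esub> = (\<lambda>x\<in>S. 1 :: 'k)"
  "\<zero>\<^bsub>fixed_product_algebra G S act\<^esub> = (\<lambda>x\<in>S. 0 :: 'k)"
  by (simp_all add: fixed_product_algebra_def product_algebra_def)

lemma mem_fixed_product_algebra: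
  assumes "group G" and act: "\<And>g x. \<lbrakk>g \<in> carrier G; x \<in> S\<rbrakk> \<Longrightarrow> act g x \<in> S"
  shows "(a :: 'x \<Rightarrow> 'k::field) \<in> carrier (fixed_product_algebra G S act) \<longleftrightarrow>
    a \<in> extensional S \<and> (\<forall>g\<in>carrier G. \<forall>x\<in>S. a (act g x) = a x)"
proof -
  interpret group G by fact
  have "permute_coords G S act g a = a \<longleftrightarrow> (\<forall>x\<in>S. a (act (inv\<^bsub>G\<^esub> g) x) = a x)"
    if "a \<in> extensional S" for g
    using that by (auto simp: permute_coords_def fun_eq_iff extensional_def)
  then have "a \<in> carrier (fixed_product_algebra G S act) \<longleftrightarrow>
    a \<in> extensional S \<and> (\<forall>g\<in>carrier G. \<forall>x\<in>S. a (act (inv\<^bsub>G\<^esub> g) x) = a x)"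
    by (auto simp: fixed_product_algebra_def PiE_def)
  also have "\<dots> \<longleftrightarrow> a \<in> extensional S \<and> (\<forall>g\<in>carrier G. \<forall>x\<in>S. a (act g x) = a x)"
    by (metis inv_closed inv_inv)
  finally show ?thesis .
qed

lemma algebra_fixed_product_algebra:
  assumes G: "group G" and act: "\<And>g x. \<lbrakk>g \<in> carrier G; x \<in> S\<rbrakk> \<Longrightarrow> act g x \<in> S"
  shows "algebra class_ring (fixed_product_algebra G S act :: ('k::field, 'x \<Rightarrow> 'k) module)"
proof (rule algebra_of_separating_evaluations[where S = S and e = "\<lambda>x a. a x"])
  note mem = mem_fixed_product_algebra[OF G, of S act, OF act]
  show "a = b" if "a \<in> carrier (fixed_product_algebra G S act)" "b \<in> carrier (fixed_product_algebra G S act)"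
    "\<And>x. x \<in> S \<Longrightarrow> a x = b x" for a b :: "'x \<Rightarrow> 'k"
    using that by (auto simp: mem intro: extensionalityI)
qed (auto simp: mem_fixed_product_algebra[OF G, of S act, OF act] fixed_product_algebra_simps act)

lemma keys_lin_ext:
  assumes "\<And>b. b \<in> Poly_Mapping.keys x \<Longrightarrow> Poly_Mapping.keys (f b) \<subseteq> S"
  shows "Poly_Mapping.keys (lin_ext pm_scale f x) \<subseteq> S"
proof
  fix k assume k: "k \<in> Poly_Mapping.keys (lin_ext pm_scale f x)"
  show "k \<in> S"
  proof (rule ccontr)
    assume "k \<notin> S"
    then have "Poly_Mapping.lookup (f b) k = 0" if "b \<in> Poly_Mapping.keys x" for b
      using assms[OF that] by (auto simp: in_keys_iff)
    then have "Poly_Mapping.lookup (lin_ext pm_scale f x) k = 0"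
      by (simp add: lin_ext_def lookup_sum)
    then show False using k by (simp add: in_keys_iff)
  qed
qed

lemma fib_burnside_simps:
  "x \<in> carrier (fib_burnside G A) \<longleftrightarrow> Poly_Mapping.keys x \<subseteq> orbits G (fib_pairs G A) (fib_act G)"
  "x \<otimes>\<^bsub>fib_burnside G A\<^esub> y =
     lin_ext pm_scale (\<lambda>a. lin_ext pm_scale (\<lambda>b. fib_mult_pairs G A (rep a) (rep b)) y) x"
  "x \<oplus>\<^bsub>fib_burnside G A\<^esub> y = x + y"
  "c \<odot>\<^bsub>fib_burnside G A\<^esub> x = pm_scale c x"
  "\<one>\<^bsub>fib_burnside G A\<^esub> = Poly_Mapping.single (fib_orbit G (carrier G, \<one>\<^bsub>char_group G A (carrier G)\<^esub>)) 1"
  "\<zero>\<^bsub>fib_burnside G A\<^esub> = 0"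
  by (simp_all add: fib_burnside_def)

context fibered_burnside_setting
begin

abbreviation "\<O> \<equiv> orbits G \<M> (fib_act G)"

lemma one_pair_mem: "(carrier G, \<one>\<^bsub>char_group G A (carrier G)\<^esub>) \<in> \<M>"
  using group_chars[OF subgroup_self] by (simp add: mem_fib_pairs subgroup_self group.is_monoid monoid.one_closed)

lemma keys_fib_mult_pairs:
  assumes q: "q \<in> \<M>" and r: "r \<in> \<M>"
  shows "Poly_Mapping.keys (fib_mult_pairs G A q r :: _ \<Rightarrow>\<^sub>0 'k::field) \<subseteq> \<O>"
proof (cases q; cases r)
  fix U \<phi> V \<psi> assume qr: "q = (U, \<phi>)" "r = (V, \<psi>)"
  have U: "subgroup U G" and V: "subgroup V G" using q r by (auto simp: qr mem_fib_pairs)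
  let ?W = "\<lambda>g. U \<inter> conj_set G g V"
  let ?q = "\<lambda>g. (?W g, restrict \<phi> (?W g) \<otimes>\<^bsub>char_group G A (?W g)\<^esub> restrict (conj_char G g V \<psi>) (?W g))"
  have "fib_orbit G (?q (rep D)) \<in> \<O>" if "D \<in> double_cosets G U V" for D
    using mult_pair_mem[OF q[unfolded qr] r[unfolded qr] rep_double_coset[OF U V that] refl] by (rule fib_orbit_mem)
  then have "Poly_Mapping.lookup (fib_mult_pairs G A q r :: _ \<Rightarrow>\<^sub>0 'k) k = 0" if "k \<notin> \<O>" for k
    using that by (auto simp: fib_mult_pairs_def qr Let_def lookup_sum lookup_single when_def intro!: sum.neutral)
  then show ?thesis by (auto simp: in_keys_iff)
qed

lemma species_one:
  fixes p :: "'g set \<times> (('g \<Rightarrow> 'a) \<Rightarrow> 'k::field_char_0)"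
  assumes p: "p \<in> species_pairs G A"
  shows "species G p \<one>\<^bsub>fib_burnside G A\<^esub> = 1"
proof (cases p)
  case (Pair H \<Phi>)
  have H: "subgroup H G" and \<Phi>: "\<Phi> \<in> linear_characters (char_group G A H)"
    using p by (auto simp: Pair mem_species_pairs)
  have Hc: "H \<subseteq> carrier G" using H by (rule subgroup.subset)
  let ?q = "(carrier G, \<one>\<^bsub>char_group G A (carrier G)\<^esub>)"
  have "mark G p ?q h = 1" if h: "h \<in> carrier G" for h
  proof -
    have "conj_set G h (carrier G) = carrier G" using conj_set_self[OF subgroup_self h] .
    moreover have "conj_char G h (carrier G) \<one>\<^bsub>char_group G A (carrier G)\<^esub> = \<one>\<^bsub>char_group G A (carrier G)\<^esub>"
      using conj_char_self[OF comm_A subgroup_self h] one_pair_mem by (simp add: mem_fib_pairs)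
    moreover have "restrict \<one>\<^bsub>char_group G A (carrier G)\<^esub> H = \<one>\<^bsub>char_group G A H\<^esub>"
      using Hc by (auto simp: char_group_def fun_eq_iff restrict_def)
    ultimately show ?thesis
      using Hc linear_charactersD(3)[OF group_chars[OF H] \<Phi>] by (simp add: Pair mark_def)
  qed
  then have "species_value G p ?q = 1"
    using finite_G one_closed by (auto simp: species_value_def card_eq_0_iff)
  then show ?thesis using species_orbit[OF p one_pair_mem] by (simp add: fib_burnside_simps)
qed

lemma species_mult:
  fixes p :: "'g set \<times> (('g \<Rightarrow> 'a) \<Rightarrow> 'k::field_char_0)"
  assumes p: "p \<in> species_pairs G A" and x: "x \<in> carrier (fib_burnside G A)" and y: "y \<in> carrier (fib_burnside G A)"
  shows "species G p (x \<otimes>\<^bsub>fib_burnside G A\<^esub> y) = species G p x * species G p y"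
proof -
  let ?v = "\<lambda>a. species_value G p (rep a)"
  have "species G p (x \<otimes>\<^bsub>fib_burnside G A\<^esub> y) =
      lin_ext (*) (\<lambda>a. lin_ext (*) (\<lambda>b. species G p (fib_mult_pairs G A (rep a) (rep b))) y) x"
    by (simp add: fib_burnside_simps linear_lin_ext_commute[OF species_linear])
  also have "\<dots> = lin_ext (*) (\<lambda>a. lin_ext (*) (\<lambda>b. ?v a * ?v b) y) x"
  proof (intro lin_ext_cong)
    fix a b assume "a \<in> Poly_Mapping.keys x" "b \<in> Poly_Mapping.keys y"
    then have "a \<in> \<O>" "b \<in> \<O>" using x y by (auto simp: fib_burnside_simps)
    then show "species G p (fib_mult_pairs G A (rep a) (rep b)) = ?v a * ?v b"
      by (intro species_fib_mult_pairs p rep_mem_fib_pairs)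
  qed
  also have "\<dots> = lin_ext (*) ?v x * lin_ext (*) ?v y"
    unfolding lin_ext_def sum_product unfolding sum_distrib_left by (intro sum.cong refl) (simp add: mult_ac)
  also have "\<dots> = species G p x * species G p y"
    using x y species_eq[OF p] by (simp add: fib_burnside_simps)
  finally show ?thesis .
qed

lemma fib_burnside_closed:
  fixes x y :: "_ \<Rightarrow>\<^sub>0 'k::field"
  assumes x: "x \<in> carrier (fib_burnside G A)"
  shows "y \<in> carrier (fib_burnside G A) \<Longrightarrow> x \<otimes>\<^bsub>fib_burnside G A\<^esub> y \<in> carrier (fib_burnside G A)"
    and "y \<in> carrier (fib_burnside G A) \<Longrightarrow> x \<oplus>\<^bsub>fib_burnside G A\<^esub> y \<in> carrier (fib_burnside G A)"
    and "c \<odot>\<^bsub>fib_burnside G A\<^esub> x \<in> carrier (fib_burnside G A)"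
proof -
  show "x \<otimes>\<^bsub>fib_burnside G A\<^esub> y \<in> carrier (fib_burnside G A)" if "y \<in> carrier (fib_burnside G A)"
  proof -
    have "Poly_Mapping.keys (lin_ext pm_scale (\<lambda>a. lin_ext pm_scale (\<lambda>b. fib_mult_pairs G A (rep a) (rep b)) y) x) \<subseteq> \<O>"
    proof (intro keys_lin_ext)
      fix a b assume "a \<in> Poly_Mapping.keys x" "b \<in> Poly_Mapping.keys y"
      then have "a \<in> \<O>" "b \<in> \<O>" using x that by (auto simp: fib_burnside_simps)
      then show "Poly_Mapping.keys (fib_mult_pairs G A (rep a) (rep b) :: _ \<Rightarrow>\<^sub>0 'k) \<subseteq> \<O>"
        by (intro keys_fib_mult_pairs rep_mem_fib_pairs)
    qed
    then show ?thesis by (simp add: fib_burnside_simps)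
  qed
  show "x \<oplus>\<^bsub>fib_burnside G A\<^esub> y \<in> carrier (fib_burnside G A)" if "y \<in> carrier (fib_burnside G A)"
    using x that Poly_Mapping.keys_add[of x y] by (auto simp: fib_burnside_simps)
  have "Poly_Mapping.keys (pm_scale c x) \<subseteq> Poly_Mapping.keys x" by (auto simp: in_keys_iff)
  then show "c \<odot>\<^bsub>fib_burnside G A\<^esub> x \<in> carrier (fib_burnside G A)"
    using x by (auto simp: fib_burnside_simps)
qed

lemma fib_burnside_one_zero_closed:
  "\<one>\<^bsub>fib_burnside G A\<^esub> \<in> carrier (fib_burnside G A)" "\<zero>\<^bsub>fib_burnside G A\<^esub> \<in> carrier (fib_burnside G A)"
  using fib_orbit_mem[OF one_pair_mem] by (simp_all add: fib_burnside_simps)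

lemma species_add: "species G p (x \<oplus>\<^bsub>fib_burnside G A\<^esub> y) = species G p x + species G p y"
  using species_linear[of G p] by (simp add: fib_burnside_simps Vector_Spaces.linear_iff)

lemma species_smult: "species G p (c \<odot>\<^bsub>fib_burnside G A\<^esub> x) = c * species G p x"
  using species_linear[of G p] by (simp add: fib_burnside_simps Vector_Spaces.linear_iff)

lemma species_zero: "species G p \<zero>\<^bsub>fib_burnside G A\<^esub> = 0"
  using species_smult[of p 0 0] by (simp add: fib_burnside_simps)

lemma species_invariant:
  fixes p :: "'g set \<times> (('g \<Rightarrow> 'a) \<Rightarrow> 'k::field_char_0)"
  assumes p: "p \<in> species_pairs G A" and g: "g \<in> carrier G" and x: "x \<in> carrier (fib_burnside G A)"
  shows "species G (species_act G A g p) x = species G p x"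
proof -
  have "species_value G (species_act G A g p) (rep a) = species_value G p (rep a)"
    if "a \<in> Poly_Mapping.keys x" for a
    using that x by (intro species_value_species_act p g rep_mem_fib_pairs) (auto simp: fib_burnside_simps)
  then show ?thesis
    using x p g by (simp add: species_eq species_act_closed fib_burnside_simps cong: lin_ext_cong)
qed

section \<open>Bijectivity of the species map\<close>

text \<open>
  Let \<open>U\<close> be of maximal order among the subgroups in the support of \<open>x\<close>. For \<open>p = (U, \<Phi>)\<close> only pairs
  with first component conjugate to \<open>U\<close> contribute to the species, and
  \<open>|U| s\<^sub>p(x) = \<Sum>\<^sub>\<psi> f(\<psi>) \<Phi>(\<psi>)\<close>, where \<open>f(\<psi>)\<close> is the coefficient of \<open>[U, \<psi>]\<close> times the order of the
  stabilizer of \<open>(U, \<psi>)\<close>. As this vanishes for all \<open>\<Phi>\<close>, so does \<open>f\<close>.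
\<close>

lemma species_injective:
  fixes x :: "_ \<Rightarrow>\<^sub>0 'k::field_char_0"
  assumes split: "\<And>H. subgroup H G \<Longrightarrow> splitting_field TYPE('k) (char_group G A H)"
    and x: "x \<in> carrier (fib_burnside G A)"
    and 0: "\<And>p :: _ \<times> (_ \<Rightarrow> 'k). p \<in> species_pairs G A \<Longrightarrow> species G p x = 0"
  shows "x = 0"
proof (rule ccontr)
  assume "x \<noteq> 0"
  let ?K = "Poly_Mapping.keys x" and ?N = "\<lambda>a. card (fst (rep a))"
  have "?K \<noteq> {}" using \<open>x \<noteq> 0\<close> by simp
  then have "Max (?N ` ?K) \<in> ?N ` ?K" by (intro Max_in) simp_all
  then obtain a0 where "a0 \<in> ?K" "Max (?N ` ?K) = ?N a0" by blast
  moreover have "?N a \<le> Max (?N ` ?K)" if "a \<in> ?K" for a using that by (intro Max_ge) simp_all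
  ultimately have a0: "a0 \<in> ?K" "\<And>a. a \<in> ?K \<Longrightarrow> ?N a \<le> ?N a0" by simp_all
  obtain U \<phi> where U\<phi>: "rep a0 = (U, \<phi>)" by (cases "rep a0")
  have K: "a \<in> \<O>" if "a \<in> ?K" for a using x that by (auto simp: fib_burnside_simps)
  have U: "subgroup U G" and \<phi>: "\<phi> \<in> chars U"
    using rep_mem_fib_pairs(1)[OF K[OF a0(1)]] by (auto simp: U\<phi> mem_fib_pairs)
  have Uc: "U \<subseteq> carrier G" using U by (rule subgroup.subset)
  have finU: "card U > 0" using Uc finite_G subgroup.one_closed[OF U] by (auto simp: card_gt_0_iff intro: finite_subset)
  \<comment> \<open>the inner sum over \<open>h\<close> is nonzero only for the orbit \<open>a\<close> of \<open>(U, \<psi>)\<close>, where it counts the stabilizer\<close>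
  define f where "f \<psi> = (\<Sum>a\<in>?K. \<Sum>h\<in>carrier G. if fib_act G h (rep a) = (U, \<psi>) then Poly_Mapping.lookup x a else 0)" for \<psi>
  have "(\<Sum>\<psi>\<in>chars U. f \<psi> * \<Phi> \<psi>) = 0" if \<Phi>: "\<Phi> \<in> linear_characters (char_group G A U)" for \<Phi>
  proof -
    let ?p = "(U, \<Phi>)"
    have p: "?p \<in> species_pairs G A" using U \<Phi> by (simp add: mem_species_pairs)
    have mark: "mark G ?p (rep a) h / of_nat (?N a) =
        (\<Sum>\<psi>\<in>chars U. if fib_act G h (rep a) = (U, \<psi>) then \<Phi> \<psi> else 0) / of_nat (card U)"
      if a: "a \<in> ?K" and h: "h \<in> carrier G" for a h
    proof -
      obtain V \<psi> where V\<psi>: "rep a = (V, \<psi>)" by (cases "rep a")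
      have V: "subgroup V G" and \<psi>: "\<psi> \<in> chars V"
        using rep_mem_fib_pairs(1)[OF K[OF a]] by (auto simp: V\<psi> mem_fib_pairs)
      have Vc: "V \<subseteq> carrier G" using V by (rule subgroup.subset)
      have card: "card (conj_set G h V) \<le> card U"
        using a0(2)[OF a] h Vc by (simp add: U\<phi> V\<psi> card_conj_set)
      have fin: "finite (conj_set G h V)" using conj_set_subset[OF h Vc] finite_G by (rule finite_subset)
      have iff: "U \<subseteq> conj_set G h V \<longleftrightarrow> conj_set G h V = U"
        using card_seteq[OF fin _ card] by auto
      show ?thesis
      proof (cases "conj_set G h V = U")
        case True
        then have N: "?N a = card U" using card_conj_set[OF h Vc] by (simp add: V\<psi>)
        have ch: "conj_char G h V \<psi> \<in> chars U" using conj_char_mem[OF V h \<psi>] True by simp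
        then have "restrict (conj_char G h V \<psi>) U = conj_char G h V \<psi>"
          by (simp add: mem_char_group extensional_restrict)
        then show ?thesis
          using True N ch finite_chars[OF U] by (simp add: mark_def V\<psi> fib_act_def)
      next
        case False
        then show ?thesis using iff by (simp add: mark_def V\<psi> fib_act_def)
      qed
    qed
    have "0 = (\<Sum>a\<in>?K. Poly_Mapping.lookup x a * species_value G ?p (rep a))"
      using 0[OF p] species_eq[OF p] x by (simp add: fib_burnside_simps lin_ext_def)
    also have "\<dots> = (\<Sum>a\<in>?K. \<Sum>h\<in>carrier G. Poly_Mapping.lookup x a * (mark G ?p (rep a) h / of_nat (?N a)))"
      by (simp add: species_value_def sum_distrib_left sum_divide_distrib)
    also have "\<dots> = (\<Sum>a\<in>?K. \<Sum>h\<in>carrier G. \<Sum>\<psi>\<in>chars U.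
        (if fib_act G h (rep a) = (U, \<psi>) then Poly_Mapping.lookup x a else 0) * \<Phi> \<psi> / of_nat (card U))"
      by (intro sum.cong refl) (simp add: mark sum_distrib_left sum_divide_distrib if_distrib if_distribR cong: if_cong)
    also have "\<dots> = (\<Sum>a\<in>?K. \<Sum>\<psi>\<in>chars U. \<Sum>h\<in>carrier G.
        (if fib_act G h (rep a) = (U, \<psi>) then Poly_Mapping.lookup x a else 0) * \<Phi> \<psi> / of_nat (card U))"
      by (intro sum.cong refl sum.swap)
    also have "\<dots> = (\<Sum>\<psi>\<in>chars U. f \<psi> * \<Phi> \<psi>) / of_nat (card U)"
      unfolding f_def sum_distrib_right sum_divide_distrib by (rule sum.swap)
    finally show ?thesis using finU by simp
  qed
  then have "f \<phi> = 0"
    by (rule linear_characters_separate[OF comm_group_char_group[OF comm_A U] finite_chars[OF U] split[OF U] _ \<phi>])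
  moreover have "f \<phi> = of_nat (card {h \<in> carrier G. fib_act G h (rep a0) = (U, \<phi>)}) * Poly_Mapping.lookup x a0"
  proof -
    have "(\<Sum>h\<in>carrier G. if fib_act G h (rep a) = (U, \<phi>) then Poly_Mapping.lookup x a else 0) = 0"
      if a: "a \<in> ?K - {a0}" for a
    proof (intro sum.neutral ballI)
      fix h assume h: "h \<in> carrier G"
      have "fib_act G h (rep a) \<noteq> rep a0"
      proof
        assume "fib_act G h (rep a) = rep a0"
        then have "fib_orbit G (rep a) = fib_orbit G (rep a0)"
          using fib_orbit_act[OF h rep_mem_fib_pairs(1)[OF K]] a by (metis DiffD1)
        then show False using rep_mem_fib_pairs(2)[OF K] a a0(1) by (metis DiffE singletonI)
      qed
      then show "(if fib_act G h (rep a) = (U, \<phi>) then Poly_Mapping.lookup x a else 0) = 0" by (simp add: U\<phi>)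
    qed
    then have "f \<phi> = (\<Sum>h\<in>carrier G. if fib_act G h (rep a0) = (U, \<phi>) then Poly_Mapping.lookup x a0 else 0)"
      unfolding f_def using a0(1) by (subst sum.remove[of _ a0]) simp_all
    then show ?thesis using finite_G by (simp add: sum.If_cases Int_def conj_commute)
  qed
  moreover have "\<one> \<in> {h \<in> carrier G. fib_act G h (rep a0) = (U, \<phi>)}"
    using fib_act_one[OF rep_mem_fib_pairs(1)[OF K[OF a0(1)]]] by (simp add: U\<phi>)
  then have "card {h \<in> carrier G. fib_act G h (rep a0) = (U, \<phi>)} \<noteq> 0"
    using finite_G by (auto simp: card_eq_0_iff)
  ultimately show False using a0(1) by (simp add: in_keys_iff)
qed

text \<open>
  For each subgroup \<open>K\<close> of order \<open>n\<close> interpolate \<open>\<Phi> \<mapsto> b(K, \<Phi>)\<close> by an element \<open>c\<^sub>K\<close> of the group algebra of its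
  characters, and let \<open>y\<close> be \<open>n/|G|\<close> times the sum of all \<open>c\<^sub>K(\<psi>) [K, \<psi>]\<close>. At a pair \<open>(H, \<Phi>)\<close> with \<open>|H| = n\<close>
  the group element \<open>h\<close> contributes the value of \<open>b\<close> at the conjugate of \<open>(H, \<Phi>)\<close> by \<open>h\<^sup>-\<^sup>1\<close>, up to the factor
  \<open>1/|G|\<close>; by invariance these add up to \<open>b(H, \<Phi>)\<close>.
\<close>

lemma species_layer:
  fixes b :: "'g set \<times> (('g \<Rightarrow> 'a) \<Rightarrow> 'k::field_char_0) \<Rightarrow> 'k"
  assumes inv: "\<And>p g. \<lbrakk>p \<in> species_pairs G A; g \<in> carrier G\<rbrakk> \<Longrightarrow> b (species_act G A g p) = b p"
    and n: "n > 0"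
  obtains y where "y \<in> carrier (fib_burnside G A)"
    and "\<And>p. \<lbrakk>p \<in> species_pairs G A; card (fst p) = n\<rbrakk> \<Longrightarrow> species G p y = b p"
    and "\<And>p :: _ \<times> (_ \<Rightarrow> 'k). \<lbrakk>p \<in> species_pairs G A; card (fst p) > n\<rbrakk> \<Longrightarrow> species G p y = 0"
proof -
  have "\<exists>c. \<forall>\<Phi>\<in>linear_characters (char_group G A K). (\<Sum>\<psi>\<in>chars K. c \<psi> * \<Phi> \<psi>) = b (K, \<Phi>)"
    if K: "subgroup K G" for K
    using linear_characters_interpolate[OF group_chars[OF K] finite_chars[OF K], of "\<lambda>\<Phi>. b (K, \<Phi>)"] by metis
  then obtain c where c: "\<And>K \<Phi>. \<lbrakk>subgroup K G; \<Phi> \<in> linear_characters (char_group G A K)\<rbrakk> \<Longrightarrow>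
      (\<Sum>\<psi>\<in>chars K. c K \<psi> * \<Phi> \<psi>) = b (K, \<Phi>)"
    by metis
  define I where "I = {q \<in> \<M>. card (fst q) = n}"
  have finI: "finite I" using finite_fib_pairs by (simp add: I_def)
  define N :: 'k where "N = of_nat (card (carrier G))"
  have N: "N \<noteq> 0" using finite_G one_closed by (auto simp: N_def card_eq_0_iff)
  define y where "y = (\<Sum>q\<in>I. pm_scale (c (fst q) (snd q) * of_nat n / N) (Poly_Mapping.single (fib_orbit G q) 1))"
  \<comment> \<open>the contribution of \<open>h = \<one>\<close>; that of any other \<open>h\<close> is reduced to it by conjugating \<open>p\<close>\<close>
  have at_one: "(\<Sum>q\<in>I. c (fst q) (snd q) * mark G p q \<one>) = (if card (fst p) = n then b p else 0)"
    if p: "p \<in> species_pairs G A" and ge: "card (fst p) \<ge> n" for p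
  proof (cases p)
    case (Pair H \<Phi>)
    have H: "subgroup H G" and \<Phi>: "\<Phi> \<in> linear_characters (char_group G A H)"
      using p by (auto simp: Pair mem_species_pairs)
    have mark: "mark G p q \<one> = (if fst q = H then \<Phi> (snd q) else 0)" if q: "q \<in> I" for q
    proof (cases q)
      case q_eq: (Pair K \<psi>)
      have K: "subgroup K G" and \<psi>: "\<psi> \<in> chars K" and cK: "card K = n" using q by (auto simp: I_def q_eq mem_fib_pairs)
      have Kc: "K \<subseteq> carrier G" using K by (rule subgroup.subset)
      then have "finite K" using finite_G by (rule finite_subset)
      then have "H \<subseteq> K \<longleftrightarrow> K = H" using ge cK card_seteq[of K H] by (auto simp: Pair)
      moreover have "conj_set G \<one> K = K" "conj_char G \<one> K \<psi> = \<psi>"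
        using fib_act_one[of q] q by (simp_all add: I_def q_eq fib_act_def)
      moreover have "restrict \<psi> K = \<psi>" using \<psi> by (simp add: mem_char_group extensional_restrict)
      ultimately show ?thesis by (auto simp: Pair q_eq mark_def)
    qed
    have "(\<Sum>q\<in>I. c (fst q) (snd q) * mark G p q \<one>) =
        (\<Sum>q\<in>I. if fst q = H then c H (snd q) * \<Phi> (snd q) else 0)"
      by (rule sum.cong) (auto simp: mark)
    also have "\<dots> = (\<Sum>q\<in>{q \<in> I. fst q = H}. c H (snd q) * \<Phi> (snd q))"
      using finI by (rule sum.inter_filter[symmetric])
    also have "\<dots> = (if card H = n then b p else 0)"
    proof (cases "card H = n")
      case True
      then have "{q \<in> I. fst q = H} = Pair H ` chars H" using H by (auto simp: I_def mem_fib_pairs)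
      then show ?thesis using True c[OF H \<Phi>] by (simp add: Pair sum.reindex inj_on_def)
    next
      case False
      then have "{q \<in> I. fst q = H} = {}" by (auto simp: I_def)
      then show ?thesis using False by (simp only: if_False sum.empty)
    qed
    finally show ?thesis by (simp add: Pair)
  qed
  have species_y: "species G p y = (if card (fst p) = n then b p else 0)"
    if p: "p \<in> species_pairs G A" and ge: "card (fst p) \<ge> n" for p
  proof -
    interpret s: Vector_Spaces.linear pm_scale "(*)" "species G p" by (rule species_linear)
    have "species G p y = (\<Sum>q\<in>I. c (fst q) (snd q) * of_nat n / N * species_value G p q)"
      unfolding y_def s.sum s.scale
      by (rule sum.cong) (auto simp: I_def species_orbit[OF p])
    also have "\<dots> = (\<Sum>q\<in>I. c (fst q) (snd q) * (\<Sum>h\<in>carrier G. mark G p q h) / N)"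
      using n by (intro sum.cong refl) (simp add: species_value_def I_def)
    also have "\<dots> = (\<Sum>q\<in>I. \<Sum>h\<in>carrier G. c (fst q) (snd q) * mark G p q h / N)"
      unfolding sum_distrib_left sum_divide_distrib ..
    also have "\<dots> = (\<Sum>h\<in>carrier G. (\<Sum>q\<in>I. c (fst q) (snd q) * mark G p q h) / N)"
      unfolding sum_divide_distrib by (rule sum.swap)
    also have "\<dots> = (\<Sum>h\<in>carrier G. (if card (fst p) = n then b p else 0) / N)"
    proof (intro sum.cong refl arg_cong2[where f = "(/)"])
      fix h assume h: "h \<in> carrier G"
      let ?p = "species_act G A (inv h) p"
      have card: "card (fst ?p) = card (fst p)"
        using p h by (cases p) (simp add: species_act_def mem_species_pairs card_conj_set subgroup.subset)
      have "(\<Sum>q\<in>I. c (fst q) (snd q) * mark G p q h) = (\<Sum>q\<in>I. c (fst q) (snd q) * mark G ?p q \<one>)"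
        using h by (intro sum.cong refl) (simp add: I_def mark_species_act[OF p])
      also have "\<dots> = (if card (fst p) = n then b p else 0)"
        using at_one[OF species_act_closed[OF inv_closed[OF h] p]] card ge inv[OF p inv_closed[OF h]] by simp
      finally show "(\<Sum>q\<in>I. c (fst q) (snd q) * mark G p q h) = (if card (fst p) = n then b p else 0)" .
    qed
    also have "\<dots> = (if card (fst p) = n then b p else 0)" using N by (simp add: N_def)
    finally show ?thesis .
  qed
  have "y \<in> carrier (fib_burnside G A)"
  proof -
    have "Poly_Mapping.lookup y k = 0" if "k \<notin> \<O>" for k
      using that fib_orbit_mem by (auto simp: y_def lookup_sum lookup_single when_def I_def intro!: sum.neutral)
    then show ?thesis by (auto simp: fib_burnside_simps in_keys_iff)
  qed
  then show ?thesis using species_y by (intro that) auto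
qed

text \<open>
  The layers are corrected from large to small subgroups, since \<open>species_layer\<close> leaves the values at
  larger subgroups untouched.
\<close>

lemma species_surjective:
  fixes b :: "'g set \<times> (('g \<Rightarrow> 'a) \<Rightarrow> 'k::field_char_0) \<Rightarrow> 'k"
  assumes inv: "\<And>p g. \<lbrakk>p \<in> species_pairs G A; g \<in> carrier G\<rbrakk> \<Longrightarrow> b (species_act G A g p) = b p"
  obtains x where "x \<in> carrier (fib_burnside G A)" and "\<And>p. p \<in> species_pairs G A \<Longrightarrow> species G p x = b p"
proof -
  have "\<exists>x\<in>carrier (fib_burnside G A). \<forall>p\<in>species_pairs G A. species G p x = b p"
    if "\<And>p g. \<lbrakk>p \<in> species_pairs G A; g \<in> carrier G\<rbrakk> \<Longrightarrow> b (species_act G A g p) = b p"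
      and "\<And>p. \<lbrakk>p \<in> species_pairs G A; card (fst p) > k\<rbrakk> \<Longrightarrow> b p = 0"
    for k and b :: "'g set \<times> (('g \<Rightarrow> 'a) \<Rightarrow> 'k) \<Rightarrow> 'k"
    using that
  proof (induction k arbitrary: b)
    case 0
    have "b p = 0" if p: "p \<in> species_pairs G A" for p
    proof (rule "0.prems"(2)[OF p])
      have H: "subgroup (fst p) G" using p by (cases p) (simp add: mem_species_pairs)
      then show "card (fst p) > 0"
        using subgroup.subset[OF H] subgroup.one_closed[OF H] finite_G
        by (auto simp: card_gt_0_iff intro: finite_subset)
    qed
    then show ?case
      by (intro bexI[of _ "\<zero>\<^bsub>fib_burnside G A\<^esub>"] ballI) (simp_all add: species_zero fib_burnside_one_zero_closed)
  next
    case (Suc k)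
    obtain y where y: "y \<in> carrier (fib_burnside G A)"
      and y_eq: "\<And>p. \<lbrakk>p \<in> species_pairs G A; card (fst p) = Suc k\<rbrakk> \<Longrightarrow> species G p y = b p"
      and y_0: "\<And>p :: _ \<times> (_ \<Rightarrow> 'k). \<lbrakk>p \<in> species_pairs G A; card (fst p) > Suc k\<rbrakk> \<Longrightarrow> species G p y = 0"
      using species_layer[of b "Suc k"] Suc.prems(1) by auto
    have "\<exists>x\<in>carrier (fib_burnside G A). \<forall>p\<in>species_pairs G A. species G p x = b p - species G p y"
    proof (rule Suc.IH)
      fix p :: "'g set \<times> (('g \<Rightarrow> 'a) \<Rightarrow> 'k)" and g assume p: "p \<in> species_pairs G A" and g: "g \<in> carrier G"
      show "b (species_act G A g p) - species G (species_act G A g p) y = b p - species G p y"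
        using Suc.prems(1)[OF p g] species_invariant[OF p g y] by simp
    next
      fix p :: "'g set \<times> (('g \<Rightarrow> 'a) \<Rightarrow> 'k)"
      assume p: "p \<in> species_pairs G A" and "card (fst p) > k"
      then consider "card (fst p) = Suc k" | "card (fst p) > Suc k" by linarith
      then show "b p - species G p y = 0"
        using y_eq[OF p] y_0[OF p] Suc.prems(2)[OF p] by cases auto
    qed
    then obtain x where "x \<in> carrier (fib_burnside G A)" "\<forall>p\<in>species_pairs G A. species G p x = b p - species G p y"
      by blast
    then show ?case
      using fib_burnside_closed(2)[OF _ y] by (intro bexI[of _ "x \<oplus>\<^bsub>fib_burnside G A\<^esub> y"]) (simp_all add: species_add)
  qed
  moreover have "card (fst p) \<le> card (carrier G)" if "p \<in> species_pairs G A" for p :: "'g set \<times> (('g \<Rightarrow> 'a) \<Rightarrow> 'k)"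
    using that finite_G by (cases p) (auto simp: mem_species_pairs intro!: card_mono dest: subgroup.subset)
  ultimately show ?thesis
    using inv that by (metis linorder_not_le)
qed

end

section \<open>The isomorphism and its consequences\<close>

context fibered_burnside_setting
begin

lemma fib_burnside_eqI:
  fixes x y :: "_ \<Rightarrow>\<^sub>0 'k::field_char_0"
  assumes split: "\<And>H. subgroup H G \<Longrightarrow> splitting_field TYPE('k) (char_group G A H)"
    and x: "x \<in> carrier (fib_burnside G A)" and y: "y \<in> carrier (fib_burnside G A)"
    and eq: "\<And>p :: _ \<times> (_ \<Rightarrow> 'k). p \<in> species_pairs G A \<Longrightarrow> species G p x = species G p y"
  shows "x = y"
proof -
  let ?z = "x \<oplus>\<^bsub>fib_burnside G A\<^esub> ((- 1) \<odot>\<^bsub>fib_burnside G A\<^esub> y)"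
  have "?z = 0"
    by (rule species_injective[OF split])
       (use x y eq in \<open>simp_all add: fib_burnside_closed species_add species_smult\<close>)
  then show ?thesis by (simp add: fib_burnside_simps pm.scale_minus_left)
qed

lemma algebra_fib_burnside:
  assumes split: "\<And>H. subgroup H G \<Longrightarrow> splitting_field TYPE('k::field_char_0) (char_group G A H)"
  shows "algebra class_ring (fib_burnside G A :: ('k, _) module)"
proof (rule algebra_of_separating_evaluations
    [where S = "species_pairs G A :: (_ \<times> (_ \<Rightarrow> 'k)) set" and e = "species G"])
  show "x = y" if "x \<in> carrier (fib_burnside G A)" "y \<in> carrier (fib_burnside G A)"
    "\<And>p :: _ \<times> (_ \<Rightarrow> 'k). p \<in> species_pairs G A \<Longrightarrow> species G p x = species G p y" for x y
    by (rule fib_burnside_eqI[OF split that])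
qed (simp_all add: fib_burnside_closed fib_burnside_one_zero_closed species_mult species_add species_smult species_one
    species_zero)

text \<open>
  If \<open>f\<close> is not a species, choose for each \<open>p\<close> an \<open>x\<^sub>p\<close> with \<open>f(x\<^sub>p) \<noteq> s\<^sub>p(x\<^sub>p)\<close>. All species vanish on the product of
  the \<open>x\<^sub>p - s\<^sub>p(x\<^sub>p) 1\<close>, which is therefore zero, but \<open>f\<close> does not vanish on it.
\<close>

lemma algebra_hom_is_species:
  fixes f :: "_ \<Rightarrow> 'k::field_char_0"
  assumes split: "\<And>H. subgroup H G \<Longrightarrow> splitting_field TYPE('k) (char_group G A H)"
    and f: "f \<in> algebra_hom class_ring (fib_burnside G A) scalar_algebra"
  shows "\<exists>p\<in>species_pairs G A. \<forall>x\<in>carrier (fib_burnside G A). f x = species G p x"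
proof (rule ccontr)
  let ?A = "fib_burnside G A :: ('k, _) module"
  have f_mult: "f (x \<otimes>\<^bsub>?A\<^esub> y) = f x * f y" and f_add: "f (x \<oplus>\<^bsub>?A\<^esub> y) = f x + f y"
    if "x \<in> carrier ?A" "y \<in> carrier ?A" for x y
    using f that by (auto simp: algebra_hom_def Ring.ring_hom_def scalar_algebra_def)
  have f_one: "f \<one>\<^bsub>?A\<^esub> = 1" using f by (auto simp: algebra_hom_def Ring.ring_hom_def scalar_algebra_def)
  have f_smult: "f (c \<odot>\<^bsub>?A\<^esub> x) = c * f x" if "x \<in> carrier ?A" for c x
    using f that by (auto simp: algebra_hom_def scalar_algebra_def)
  note closed = fib_burnside_closed fib_burnside_one_zero_closed
  assume "\<not> ?thesis"
  then have ne: "\<exists>x\<in>carrier ?A. f x \<noteq> species G p x" if "p \<in> species_pairs G A" for p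
    using that by blast
  have "\<exists>y\<in>carrier ?A. f y \<noteq> 0 \<and> (\<forall>p\<in>T. species G p y = 0)"
    if "finite T" "T \<subseteq> species_pairs G A" for T
    using that
  proof (induction T)
    case empty
    show ?case using f_one closed by (intro bexI[of _ "\<one>\<^bsub>?A\<^esub>"]) simp_all
  next
    case (insert p T)
    then obtain y where y: "y \<in> carrier ?A" "f y \<noteq> 0" "\<forall>p\<in>T. species G p y = 0" by blast
    obtain x where x: "x \<in> carrier ?A" "f x \<noteq> species G p x" using ne insert.prems by blast
    let ?z = "x \<oplus>\<^bsub>?A\<^esub> ((- species G p x) \<odot>\<^bsub>?A\<^esub> \<one>\<^bsub>?A\<^esub>)"
    have z: "?z \<in> carrier ?A" using x by (simp add: closed)
    have fz: "f ?z = f x - species G p x" using x by (simp add: f_add f_smult f_one closed)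
    have "species G p ?z = 0"
      using insert.prems by (simp add: species_add species_smult species_one)
    then have "species G q (?z \<otimes>\<^bsub>?A\<^esub> y) = 0" if "q \<in> insert p T" for q
      using that y(3) insert.prems by (subst species_mult[OF _ z y(1)]) auto
    moreover have "f (?z \<otimes>\<^bsub>?A\<^esub> y) \<noteq> 0"
      using x(2) y(2) by (simp add: f_mult[OF z y(1)] fz)
    ultimately show ?case using closed(1)[OF z y(1)] by blast
  qed
  from this[OF finite_species_pairs order_refl]
  obtain y where y: "y \<in> carrier ?A" "f y \<noteq> 0" "\<forall>p\<in>species_pairs G A. species G p y = 0" by blast
  have "y = 0" by (rule species_injective[OF split y(1)]) (use y(3) in auto)
  then have "f y = 0" using f_smult[OF y(1), of 0] by (simp add: fib_burnside_simps)
  then show False using y(2) by simp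
qed

lemma species_map_algebra_iso:
  assumes split: "\<And>H. subgroup H G \<Longrightarrow> splitting_field TYPE('k::field_char_0) (char_group G A H)"
  shows "(\<lambda>x. \<lambda>p\<in>species_pairs G A. species G p x) \<in>
    algebra_iso class_ring (fib_burnside G A :: ('k, _) module)
      (fixed_product_algebra G (species_pairs G A) (species_act G A))"
proof -
  let ?A = "fib_burnside G A :: ('k, _) module" and ?S = "species_pairs G A :: (_ \<times> (_ \<Rightarrow> 'k)) set"
  let ?P = "fixed_product_algebra G ?S (species_act G A) :: ('k, _) module"
  let ?\<sigma> = "\<lambda>x. \<lambda>p\<in>?S. species G p x"
  note mem_P = mem_fixed_product_algebra[OF is_group, of ?S "species_act G A", OF species_act_closed]
  have mem: "?\<sigma> x \<in> carrier ?P" if "x \<in> carrier ?A" for x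
    using that by (auto simp: mem_P species_invariant species_act_closed)
  have "?\<sigma> \<in> algebra_hom class_ring ?A ?P"
    unfolding algebra_hom_def Ring.ring_hom_def
    using mem by (auto simp: fixed_product_algebra_simps species_mult species_add species_smult species_one
        cong: restrict_cong)
  moreover have "inj_on ?\<sigma> (carrier ?A)"
  proof (rule inj_onI)
    fix x y assume x: "x \<in> carrier ?A" and y: "y \<in> carrier ?A" and eq: "?\<sigma> x = ?\<sigma> y"
    have "species G p x = species G p y" if "p \<in> ?S" for p
      using fun_cong[OF eq, of p] that by simp
    then show "x = y" using fib_burnside_eqI[OF split x y] by blast
  qed
  moreover have "?\<sigma> ` carrier ?A = carrier ?P"
  proof
    show "?\<sigma> ` carrier ?A \<subseteq> carrier ?P" using mem by blast
    show "carrier ?P \<subseteq> ?\<sigma> ` carrier ?A"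
    proof
      fix a assume "a \<in> carrier ?P"
      then have ext: "a \<in> extensional ?S" and inv: "\<And>g p. g \<in> carrier G \<Longrightarrow> p \<in> ?S \<Longrightarrow> a (species_act G A g p) = a p"
        by (auto simp: mem_P)
      obtain x where x: "x \<in> carrier ?A" "\<And>p. p \<in> ?S \<Longrightarrow> species G p x = a p"
        using species_surjective[of a] inv by auto
      have "a = ?\<sigma> x" by (rule extensionalityI[OF ext]) (use x in auto)
      then show "a \<in> ?\<sigma> ` carrier ?A" using x(1) by blast
    qed
  qed
  ultimately show ?thesis by (simp add: algebra_iso_def bij_betw_def)
qed

text \<open>
  The indicator function of the orbit of \<open>p\<close> is invariant, so some element of the Burnside algebra has it
  as its species values; it tells \<open>p\<close> from every pair outside the orbit.
\<close>

lemma species_eq_iff_conjugate: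
  fixes p q :: "'g set \<times> (('g \<Rightarrow> 'a) \<Rightarrow> 'k::field_char_0)"
  assumes p: "p \<in> species_pairs G A" and q: "q \<in> species_pairs G A"
  shows "(\<forall>x\<in>carrier (fib_burnside G A). species G p x = species G q x) \<longleftrightarrow>
    (\<exists>g\<in>carrier G. q = species_act G A g p)"
proof
  assume eq: "\<forall>x\<in>carrier (fib_burnside G A). species G p x = species G q x"
  let ?b = "\<lambda>r. if \<exists>g\<in>carrier G. r = species_act G A g p then 1 else 0 :: 'k"
  have "(\<exists>h\<in>carrier G. species_act G A g r = species_act G A h p) \<longleftrightarrow>
      (\<exists>h\<in>carrier G. r = species_act G A h p)"
    if r: "r \<in> species_pairs G A" and g: "g \<in> carrier G" for r g
  proof
    assume "\<exists>h\<in>carrier G. species_act G A g r = species_act G A h p"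
    then obtain h where h: "h \<in> carrier G" "species_act G A g r = species_act G A h p" by blast
    have "r = species_act G A (inv g) (species_act G A g r)"
      using r g by (simp add: species_act_mult species_act_one)
    also have "\<dots> = species_act G A (inv g \<otimes> h) p"
      using h g p by (simp add: species_act_mult)
    finally show "\<exists>h\<in>carrier G. r = species_act G A h p" using g h by blast
  next
    assume "\<exists>h\<in>carrier G. r = species_act G A h p"
    then show "\<exists>h\<in>carrier G. species_act G A g r = species_act G A h p"
      using g p by (auto simp: species_act_mult)
  qed
  then have inv: "?b (species_act G A g r) = ?b r" if "r \<in> species_pairs G A" "g \<in> carrier G" for r g
    using that by simp
  obtain x where x: "x \<in> carrier (fib_burnside G A)" "\<And>r. r \<in> species_pairs G A \<Longrightarrow> species G r x = ?b r"
    using species_surjective[of ?b] inv by blast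
  have "?b p = 1" using species_act_one[OF p] one_closed by (metis (full_types))
  then have "?b q = 1" using eq x p q by metis
  then show "\<exists>g\<in>carrier G. q = species_act G A g p" by (simp split: if_splits)
next
  assume "\<exists>g\<in>carrier G. q = species_act G A g p"
  then show "\<forall>x\<in>carrier (fib_burnside G A). species G p x = species G q x"
    using species_invariant[OF p] by auto
qed

end

theorem theorem3p1:
  fixes G :: "('g, 'm) monoid_scheme"
    and A :: "('a, 'n) monoid_scheme"
  assumes "group G" and "finite (carrier G)"
    and "comm_group A"
    and "\<And>H. subgroup H G \<Longrightarrow> finite (carrier (char_group G A H))"
    and "\<And>H. subgroup H G \<Longrightarrow> splitting_field TYPE('k::field_char_0) (char_group G A H)"
  shows
    "let B = (fib_burnside G A :: ('k, ('g set \<times> ('g \<Rightarrow> 'a)) set \<Rightarrow>\<^sub>0 'k) module);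
         S = (species_pairs G A :: ('g set \<times> (('g \<Rightarrow> 'a) \<Rightarrow> 'k)) set);
         P = fixed_product_algebra G S (species_act G A)
     in algebra class_ring B \<and>
        algebra class_ring P \<and>
        (\<lambda>x. \<lambda>p\<in>S. species G p x) \<in> algebra_iso class_ring B P \<and>
        (\<forall>f \<in> algebra_hom class_ring B scalar_algebra.
           \<exists>p\<in>S. \<forall>x\<in>carrier B. f x = species G p x) \<and>
        (\<forall>p\<in>S. \<forall>q\<in>S.
           (\<forall>x\<in>carrier B. species G p x = species G q x) \<longleftrightarrow>
           (\<exists>g\<in>carrier G. q = species_act G A g p))"
proof -
  interpret fibered_burnside_setting G A
    using assms(1-4) by (simp add: fibered_burnside_setting_def fibered_burnside_setting_axioms_def)
  show ?thesis
    unfolding Let_def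
    by (intro conjI ballI algebra_fib_burnside algebra_fixed_product_algebra species_map_algebra_iso
        algebra_hom_is_species species_eq_iff_conjugate species_act_closed is_group assms(5))
qed

end
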